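(* Let $\nu_1$ and $\nu_2$ be two nonnegative locally finite Borel measures on a complete Riemannian manifold $(M,g)$ such that $\nu_2\ll\nu_1$. Then there is a measurable subset $S_0\subset M$ of zero $\nu_1$-measure such that the function $D_{\nu_1}\nu_2$ is defined and finite on $M\setminus S_0$, and, setting $\tilde D_{\nu_1}\nu_2(x):=0$ for $x\in S_0$ and $\tilde D_{\nu_1}\nu_2(x):=D_{\nu_1}\nu_2(x)$ for $x\in M\setminus S_0$, the function $\tilde D_{\nu_1}\nu_2:M\to\mathbb{R}$ is measurable and serves as the Radon-Nikodym density of the measure $\nu_2$ with respect to $\nu_1$, i.e. $\nu_2(B)=\int_B\tilde D_{\nu_1}\nu_2\,d\nu_1$ for every Borel set $B\subset M$.
   Context: Riemannian manifolds are finite dimensional. For $x\in M$ and $r>0$, $D_r(x)$ denotes the open geodesic ball of radius $r$ in $M$ with center $x$ (with respect to the Riemannian distance). For locally finite Borel measures $\nu_1,\nu_2$ on $(M,g)$ with $\nu_2\ll\nu_1$ set $$\overline{D}_{\nu_1}\nu_2(x):=\limsup_{r\to0}\frac{\nu_2(D_r(x))}{\nu_1(D_r(x))},\qquad \underline{D}_{\nu_1}\nu_2(x):=\liminf_{r\to0}\frac{\nu_2(D_r(x))}{\nu_1(D_r(x))},$$ with the convention $\overline{D}_{\nu_1}\nu_2(x)=\underline{D}_{\nu_1}\nu_2(x)=+\infty$ if $\nu_1(D_r(x))=0$ for some $r>0$. If $\overline{D}_{\nu_1}\nu_2(x)=\underline{D}_{\nu_1}\nu_2(x)$, their common value is denoted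 $D_{\nu_1}\nu_2(x)$ (and $D_{\nu_1}\nu_2$ is said to be defined at $x$); it is called the derivative of $\nu_2$ with respect to $\nu_1$ at $x$. *)

theory Defs
  imports "HOL-Analysis.Analysis"
begin

section \<open>Smooth manifolds and Riemannian metrics\<close>

text \<open>
  The manifold is a whole type \<open>'a\<close>, Hausdorff and second countable through its type classes. It
  is modelled on a linear subspace \<open>E\<close> of a Euclidean space, so that every finite dimension
  \<open>dim E\<close> occurs, including 0 (which \<^class>\<open>euclidean_space\<close> itself excludes).

  In \<open>Ck_on k E V f\<close> the set \<open>V\<close> is meant to be open in \<open>E\<close>. A Frechet derivative of \<open>f\<close> within
  \<open>V\<close> is then uniquely determined on \<open>E\<close> (though not outside), which is why only directions
  \<open>v \<in> E\<close> are used here and below.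
\<close>

primrec Ck_on ::
  "nat \<Rightarrow> 'e::euclidean_space set \<Rightarrow> 'e set \<Rightarrow> ('e \<Rightarrow> 'b::real_normed_vector) \<Rightarrow> bool" where
  "Ck_on 0 E V f \<longleftrightarrow> continuous_on V f"
| "Ck_on (Suc k) E V f \<longleftrightarrow>
     (\<forall>x\<in>V. f differentiable (at x within V)) \<and>
     (\<forall>v\<in>E. Ck_on k E V (\<lambda>x. frechet_derivative f (at x within V) v))"

definition smooth_on ::
  "'e::euclidean_space set \<Rightarrow> 'e set \<Rightarrow> ('e \<Rightarrow> 'b::real_normed_vector) \<Rightarrow> bool" where
  "smooth_on E V f \<longleftrightarrow> (\<forall>k. Ck_on k E V f)"

text \<open>A chart is a pair of its domain and its coordinate map.\<close>

type_synonym ('a, 'e) chart = "'a set \<times> ('a \<Rightarrow> 'e)"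

definition transition :: "('a, 'e) chart \<Rightarrow> ('a, 'e) chart \<Rightarrow> 'e \<Rightarrow> 'e" where
  "transition c d = snd d \<circ> inv_into (fst c) (snd c)"

definition transition_domain :: "('a, 'e) chart \<Rightarrow> ('a, 'e) chart \<Rightarrow> 'e set" where
  "transition_domain c d = snd c ` (fst c \<inter> fst d)"

locale smooth_manifold =
  fixes E :: "'e::euclidean_space set"
    and A :: "('a::{t2_space, second_countable_topology}, 'e) chart set"
  assumes subspace_model: "subspace E"
    and atlas_covers: "(\<Union>c\<in>A. fst c) = UNIV"
    and open_chart_domain: "c \<in> A \<Longrightarrow> open (fst c)"
    and openin_chart_image: "c \<in> A \<Longrightarrow> openin (top_of_set E) (snd c ` fst c)"
    and homeomorphism_chart:
      "c \<in> A \<Longrightarrow> homeomorphism (fst c) (snd c ` fst c) (snd c) (inv_into (fst c) (snd c))"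
    and smooth_transition:
      "c \<in> A \<Longrightarrow> d \<in> A \<Longrightarrow> smooth_on E (transition_domain c d) (transition c d)"

text \<open>
  The metric tensor is given by its coordinate representations: for a chart \<open>c\<close> around \<open>p\<close>,
  \<open>g c p v w\<close> is the inner product of the tangent vectors at \<open>p\<close> whose coordinates in \<open>c\<close> are
  \<open>v, w \<in> E\<close>. Its values on vectors outside \<open>E\<close> are never used; asking for bilinearity on the
  ambient space is no restriction, since every bilinear form on \<open>E\<close> extends.
\<close>

type_synonym ('a, 'e) metric_tensor = "('a, 'e) chart \<Rightarrow> 'a \<Rightarrow> 'e \<Rightarrow> 'e \<Rightarrow> real"

locale riemannian_manifold = smooth_manifold E A
  for E :: "'e::euclidean_space set"
    and A :: "('a::{t2_space, second_countable_topology}, 'e) chart set" +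
  fixes g :: "('a, 'e) metric_tensor"
  assumes metric_bilinear: "c \<in> A \<Longrightarrow> p \<in> fst c \<Longrightarrow> bilinear (g c p)"
    and metric_sym:
      "c \<in> A \<Longrightarrow> p \<in> fst c \<Longrightarrow> v \<in> E \<Longrightarrow> w \<in> E \<Longrightarrow> g c p v w = g c p w v"
    and metric_pos_def:
      "c \<in> A \<Longrightarrow> p \<in> fst c \<Longrightarrow> v \<in> E \<Longrightarrow> v \<noteq> 0 \<Longrightarrow> g c p v v > 0"
    and metric_smooth:
      "c \<in> A \<Longrightarrow> v \<in> E \<Longrightarrow> w \<in> E \<Longrightarrow>
        smooth_on E (snd c ` fst c) (\<lambda>x. g c (inv_into (fst c) (snd c) x) v w)"
    and metric_change_of_chart:
      "c \<in> A \<Longrightarrow> d \<in> A \<Longrightarrow> p \<in> fst c \<inter> fst d \<Longrightarrow> v \<in> E \<Longrightarrow> w \<in> E \<Longrightarrow>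
        T = frechet_derivative (transition c d) (at (snd c p) within transition_domain c d) \<Longrightarrow>
        g d p (T v) (T w) = g c p v w"


section \<open>Riemannian distance and completeness\<close>

definition C1_curve_on :: "('a::topological_space, 'e::euclidean_space) chart set \<Rightarrow>
    real \<Rightarrow> real \<Rightarrow> (real \<Rightarrow> 'a) \<Rightarrow> bool" where
  "C1_curve_on A a b \<gamma> \<longleftrightarrow> continuous_on {a..b} \<gamma> \<and>
     (\<forall>c\<in>A.
        (\<forall>t\<in>{a..b} \<inter> \<gamma> -` fst c. (snd c \<circ> \<gamma>) differentiable (at t within {a..b})) \<and>
        continuous_on ({a..b} \<inter> \<gamma> -` fst c)
          (\<lambda>t. vector_derivative (snd c \<circ> \<gamma>) (at t within {a..b})))"

definition piecewise_C1_curve :: "('a::topological_space, 'e::euclidean_space) chart set \<Rightarrow>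
    (real \<Rightarrow> 'a) \<Rightarrow> bool" where
  "piecewise_C1_curve A \<gamma> \<longleftrightarrow>
     (\<exists>n (s :: nat \<Rightarrow> real). s 0 = 0 \<and> s n = 1 \<and>
        (\<forall>i<n. s i < s (Suc i) \<and> C1_curve_on A (s i) (s (Suc i)) \<gamma>))"

text \<open>
  By the transformation law of the metric the speed does not depend on the chosen chart. At the
  finitely many break points of a piecewise C1 curve its value is unspecified, which does not
  affect the integral in \<open>curve_length\<close>.
\<close>

definition curve_speed :: "('a, 'e::euclidean_space) chart set \<Rightarrow> ('a, 'e) metric_tensor \<Rightarrow>
    (real \<Rightarrow> 'a) \<Rightarrow> real \<Rightarrow> real" where
  "curve_speed A g \<gamma> t =
     (let c = (SOME c. c \<in> A \<and> \<gamma> t \<in> fst c);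
          v = vector_derivative (snd c \<circ> \<gamma>) (at t within {0..1})
      in sqrt (g c (\<gamma> t) v v))"

definition curve_length :: "('a, 'e::euclidean_space) chart set \<Rightarrow> ('a, 'e) metric_tensor \<Rightarrow>
    (real \<Rightarrow> 'a) \<Rightarrow> real" where
  "curve_length A g \<gamma> = integral {0..1} (curve_speed A g \<gamma>)"

text \<open>The distance is \<open>\<infinity>\<close> between points in different connected components.\<close>

definition riem_dist :: "('a::topological_space, 'e::euclidean_space) chart set \<Rightarrow>
    ('a, 'e) metric_tensor \<Rightarrow> 'a \<Rightarrow> 'a \<Rightarrow> ennreal" where
  "riem_dist A g x y =
     (INF \<gamma>\<in>{\<gamma>. piecewise_C1_curve A \<gamma> \<and> \<gamma> 0 = x \<and> \<gamma> 1 = y}. ennreal (curve_length A g \<gamma>))"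

definition geodesic_ball :: "('a::topological_space, 'e::euclidean_space) chart set \<Rightarrow>
    ('a, 'e) metric_tensor \<Rightarrow> 'a \<Rightarrow> real \<Rightarrow> 'a set" where
  "geodesic_ball A g x r = {y. riem_dist A g x y < ennreal r}"

locale complete_riemannian_manifold = riemannian_manifold +
  assumes complete:
    "(\<And>e::real. e > 0 \<Longrightarrow> \<exists>N. \<forall>m\<ge>N. \<forall>n\<ge>N. riem_dist A g (X m) (X n) < ennreal e) \<Longrightarrow>
       \<exists>x. (\<lambda>n::nat. riem_dist A g (X n) x) \<longlonglongrightarrow> 0"


section \<open>Derivatives of measures\<close>

definition locally_finite_borel_measure :: "'a::topological_space measure \<Rightarrow> bool" where
  "locally_finite_borel_measure \<nu> \<longleftrightarrow>
     sets \<nu> = sets borel \<and> (\<forall>x. \<exists>U. open U \<and> x \<in> U \<and> emeasure \<nu> U < \<infinity>)"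

definition upper_derivative :: "('a::topological_space, 'e::euclidean_space) chart set \<Rightarrow>
    ('a, 'e) metric_tensor \<Rightarrow> 'a measure \<Rightarrow> 'a measure \<Rightarrow> 'a \<Rightarrow> ennreal" where
  "upper_derivative A g \<nu>1 \<nu>2 x =
     (if \<exists>r>0. emeasure \<nu>1 (geodesic_ball A g x r) = 0 then \<infinity>
      else Limsup (at_right 0)
        (\<lambda>r. emeasure \<nu>2 (geodesic_ball A g x r) / emeasure \<nu>1 (geodesic_ball A g x r)))"

definition lower_derivative :: "('a::topological_space, 'e::euclidean_space) chart set \<Rightarrow>
    ('a, 'e) metric_tensor \<Rightarrow> 'a measure \<Rightarrow> 'a measure \<Rightarrow> 'a \<Rightarrow> ennreal" where
  "lower_derivative A g \<nu>1 \<nu>2 x =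
     (if \<exists>r>0. emeasure \<nu>1 (geodesic_ball A g x r) = 0 then \<infinity>
      else Liminf (at_right 0)
        (\<lambda>r. emeasure \<nu>2 (geodesic_ball A g x r) / emeasure \<nu>1 (geodesic_ball A g x r)))"

definition derivative_defined :: "('a::topological_space, 'e::euclidean_space) chart set \<Rightarrow>
    ('a, 'e) metric_tensor \<Rightarrow> 'a measure \<Rightarrow> 'a measure \<Rightarrow> 'a \<Rightarrow> bool" where
  "derivative_defined A g \<nu>1 \<nu>2 x \<longleftrightarrow> upper_derivative A g \<nu>1 \<nu>2 x = lower_derivative A g \<nu>1 \<nu>2 x"

definition measure_derivative :: "('a::topological_space, 'e::euclidean_space) chart set \<Rightarrow>
    ('a, 'e) metric_tensor \<Rightarrow> 'a measure \<Rightarrow> 'a measure \<Rightarrow> 'a \<Rightarrow> ennreal" where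
  "measure_derivative A g \<nu>1 \<nu>2 x =
     (THE c. upper_derivative A g \<nu>1 \<nu>2 x = c \<and> lower_derivative A g \<nu>1 \<nu>2 x = c)"

text \<open>The function that is 0 on \<open>S\<close> and agrees with the derivative, read as a real, outside \<open>S\<close>.\<close>

definition extended_derivative :: "('a::topological_space, 'e::euclidean_space) chart set \<Rightarrow>
    ('a, 'e) metric_tensor \<Rightarrow> 'a measure \<Rightarrow> 'a measure \<Rightarrow> 'a set \<Rightarrow> 'a \<Rightarrow> real" where
  "extended_derivative A g \<nu>1 \<nu>2 S x =
     (if x \<in> S then 0 else enn2real (measure_derivative A g \<nu>1 \<nu>2 x))"

end

theory Submission imports Defs begin

text \<open>
  Let \<open>f\<close> be a Radon-Nikodym density of \<open>\<nu>2\<close> with respect to \<open>\<nu>1\<close>. The theorem follows once the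
  quotients \<open>\<nu>2 (D_r(x)) / \<nu>1 (D_r(x))\<close> are known to converge to \<open>f x\<close> for \<open>\<nu>1\<close>-almost every \<open>x\<close>.
  Since \<open>\<nu>1\<close> need not be doubling, this requires a covering property of the balls themselves.

  The covering property is a condition on directions (\<open>cone_bounded\<close>): seen from a point \<open>z\<close>, the nearby
  points fall into boundedly many classes such that, for two points of one class, the one that is
  closer to \<open>z\<close> is also closer to the other point than \<open>z\<close> is, by a margin of half its distance from
  \<open>z\<close>. If balls are selected greedily by radius, then no centre lies in an earlier ball, and at most
  two selected balls per class can contain \<open>z\<close> (\<open>overlap_bound\<close>). So boundedly overlapping balls cover
  all centres, which gives a weak type estimate (\<open>weak_type_estimate\<close>). Apply it to the measures with
  densities \<open>(f - a)\<^sup>+\<close> and \<open>(b - f)\<^sup>+\<close>: each vanishes on a set where \<open>f\<close> lies on the right side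
  of \<open>a\<close> or \<open>b\<close>, so by outer regularity that set has neighbourhoods of small mass. Hence the points of
  the set at which the quotients do not follow \<open>f\<close> form a null set (\<open>zero_density_null\<close>,
  \<open>local_comparison_null\<close>), and rational \<open>a < b\<close> give the limit.

  A Riemannian distance satisfies the directional condition because the metric tensor is Lipschitz in
  charts. Near \<open>z\<close> the distance differs from the norm given by the metric at \<open>z\<close> by a relative error
  \<open>O(s)\<close> at distance \<open>s\<close> (\<open>rdist_near\<close>). This alone is too weak when the distances of two points from
  \<open>z\<close> are of different orders of magnitude. But the distance is a length metric and so has approximate
  midpoints (\<open>rdist_midpoint\<close>), and by the parallelogram law the midpoint of \<open>z\<close> and a point at distance
  \<open>s\<close> deviates in direction from that point by only \<open>O(sqrt s)\<close>. Along repeated halving these deviations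
  form a convergent geometric series, so one can descend from the farther point to the scale of the
  nearer one without losing the direction (\<open>same_direction_closer\<close>).
\<close>

section \<open>Families of balls whose centres point in boundedly many directions\<close>

text \<open>
  The values of \<open>\<kappa>\<close> number finitely many cones with apex \<open>z\<close>. The inequality quantifies that two
  points in one cone are separated by an angle well below 60 degrees: in Euclidean space it holds
  for cones of small aperture.
\<close>

definition cone_bounded :: "('a \<Rightarrow> 'a \<Rightarrow> ennreal) \<Rightarrow> 'a set \<Rightarrow> real \<Rightarrow> nat \<Rightarrow> bool" where
  "cone_bounded d W r0 m \<longleftrightarrow> (\<forall>z\<in>W. \<exists>\<kappa>. (\<forall>x. \<kappa> x < m) \<and>
     (\<forall>x y. d x z < ennreal r0 \<longrightarrow> d y z \<le> d x z \<longrightarrow> \<kappa> x = (\<kappa> y :: nat) \<longrightarrow>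
        d x y + d y z / 2 \<le> d x z))"

locale ball_distance =
  fixes d :: "'a::{t2_space, second_countable_topology} \<Rightarrow> 'a \<Rightarrow> ennreal"
  assumes dist_self: "d x x = 0"
    and dist_sym: "d x y = d y x"
    and dist_triangle: "d x w \<le> d x y + d y w"
    and open_dball: "open {y. d x y < ennreal r}"
    and dball_neighbourhood: "open U \<Longrightarrow> x \<in> U \<Longrightarrow> \<exists>r>0. {y. d x y < ennreal r} \<subseteq> U"
begin

definition dball :: "'a \<Rightarrow> real \<Rightarrow> 'a set" where
  "dball x r = {y. d x y < ennreal r}"

text \<open>
  A list of centres, each of which is outside the balls around its predecessors and has, up to the
  factor \<open>4/3\<close>, the largest radius among all points of \<open>A\<close> outside these balls. The factor is
  there because a largest radius need not exist.
\<close>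

definition greedy :: "'a set \<Rightarrow> ('a \<Rightarrow> real) \<Rightarrow> 'a list \<Rightarrow> bool" where
  "greedy A r xs \<longleftrightarrow> (\<forall>i<length xs. xs ! i \<in> A \<and>
     (\<forall>l<i. xs ! i \<notin> dball (xs ! l) (r (xs ! l))) \<and>
     (\<forall>y\<in>A. (\<forall>l<i. y \<notin> dball (xs ! l) (r (xs ! l))) \<longrightarrow> 3 * r y \<le> 4 * r (xs ! i)))"

lemma greedyD:
  assumes "greedy A r xs" "i < length xs"
  shows "xs ! i \<in> A" and "l < i \<Longrightarrow> xs ! i \<notin> dball (xs ! l) (r (xs ! l))"
    and "y \<in> A \<Longrightarrow> (\<And>l. l < i \<Longrightarrow> y \<notin> dball (xs ! l) (r (xs ! l))) \<Longrightarrow> 3 * r y \<le> 4 * r (xs ! i)"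
  using assms unfolding greedy_def by blast+

text \<open>
  The cone inequalities rule out \<open>a2 \<le> a1\<close> and \<open>a3 \<le> a2\<close>. Then \<open>a2\<close> exceeds \<open>3/4\<close> of \<open>a3\<close>
  because \<open>r1 \<le> e12 \<le> a2\<close>, and it is less than \<open>2/3\<close> of \<open>a3\<close> because \<open>a2 < r2 \<le> e23 \<le> a3 - a2 / 2\<close>.
\<close>

lemma no_three_in_cone:
  fixes a1 a2 a3 e12 e23 r1 r2 r3 :: real
  assumes "a1 < r1" "a2 < r2" "a3 < r3" "r1 \<le> e12" "r2 \<le> e23"
    "3 * r3 \<le> 4 * r1" "0 \<le> a1" "0 \<le> a2" "0 \<le> a3"
    "a2 \<le> a1 \<Longrightarrow> e12 + a2 / 2 \<le> a1" "a1 \<le> a2 \<Longrightarrow> e12 + a1 / 2 \<le> a2"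
    "a3 \<le> a2 \<Longrightarrow> e23 + a3 / 2 \<le> a2" "a2 \<le> a3 \<Longrightarrow> e23 + a2 / 2 \<le> a3"
  shows False
  using assms by linarith

text \<open>
  Three balls containing \<open>z\<close> whose centres lie in one of the \<open>m\<close> cones at \<open>z\<close> are impossible by
  \<open>no_three_in_cone\<close>.
\<close>

lemma overlap_bound:
  assumes cone: "cone_bounded d W r0 m" and z: "z \<in> W"
    and greedy: "greedy A r xs" and r: "\<And>x. x \<in> A \<Longrightarrow> 0 < r x \<and> r x \<le> r0"
  shows "card {i. i < length xs \<and> z \<in> dball (xs ! i) (r (xs ! i))} \<le> 2 * m"
proof -
  define S where "S = {i. i < length xs \<and> z \<in> dball (xs ! i) (r (xs ! i))}"
  obtain \<kappa> :: "'a \<Rightarrow> nat" where \<kappa>: "\<And>x. \<kappa> x < m"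
    and close: "\<And>x y. d x z < ennreal r0 \<Longrightarrow> d y z \<le> d x z \<Longrightarrow> \<kappa> x = \<kappa> y \<Longrightarrow>
      d x y + d y z / 2 \<le> d x z"
    using cone z unfolding cone_bounded_def by metis
  have xA: "xs ! i \<in> A" if "i \<in> S" for i using that greedy by (auto simp: S_def greedy_def)
  define a where "a i = enn2real (d (xs ! i) z)" for i
  define e where "e i j = enn2real (d (xs ! i) (xs ! j))" for i j
  have fin: "d (xs ! i) z < ennreal r0" "d (xs ! i) z = ennreal (a i)" "a i < r (xs ! i)" "0 \<le> a i"
    if "i \<in> S" for i
  proof -
    have "d (xs ! i) z < ennreal (r (xs ! i))" using that by (simp add: S_def dball_def)
    moreover have "ennreal (r (xs ! i)) \<le> ennreal r0" using r[OF xA[OF that]] by (simp add: ennreal_leI)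
    ultimately show "d (xs ! i) z < ennreal r0" by simp
    then have "d (xs ! i) z < top" using order_less_trans[OF _ ennreal_less_top] by blast
    then show eq: "d (xs ! i) z = ennreal (a i)" unfolding a_def by (rule ennreal_enn2real[symmetric])
    show "0 \<le> a i" by (simp add: a_def)
    show "a i < r (xs ! i)"
      using \<open>d (xs ! i) z < ennreal (r (xs ! i))\<close> unfolding eq
      by (subst (asm) ennreal_less_iff) (simp_all add: a_def)
  qed
  have e_eq: "d (xs ! i) (xs ! j) = ennreal (e i j)" "0 \<le> e i j" if "i \<in> S" "j \<in> S" for i j
  proof -
    have "d (xs ! i) (xs ! j) \<le> ennreal (a i) + ennreal (a j)"
      using dist_triangle[of "xs ! i" "xs ! j" z] fin(2)[OF that(1)] fin(2)[OF that(2)] dist_sym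
      by metis
    also have "\<dots> < top" by simp
    finally show "d (xs ! i) (xs ! j) = ennreal (e i j)"
      unfolding e_def by (rule ennreal_enn2real[symmetric])
    show "0 \<le> e i j" by (simp add: e_def)
  qed
  have half: "ennreal t / 2 = ennreal (t / 2)" if "0 \<le> t" for t
    using divide_ennreal[of t 2] that by simp
  have cl: "e i j + a j / 2 \<le> a i"
    if "i \<in> S" "j \<in> S" "\<kappa> (xs ! i) = \<kappa> (xs ! j)" "a j \<le> a i" for i j
  proof -
    have "d (xs ! j) z \<le> d (xs ! i) z" using that fin by (simp add: ennreal_leI)
    then have "d (xs ! i) (xs ! j) + d (xs ! j) z / 2 \<le> d (xs ! i) z"
      using close fin that by blast
    then have "ennreal (e i j + a j / 2) \<le> ennreal (a i)"
      using fin that e_eq by (simp add: half ennreal_plus[symmetric] del: ennreal_plus)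
    then show ?thesis using fin(4)[OF that(1)] by (simp add: ennreal_le_iff)
  qed
  have e_sym: "e i j = e j i" for i j using dist_sym by (simp add: e_def)
  have sep: "r (xs ! i) \<le> e i j" "3 * r (xs ! j) \<le> 4 * r (xs ! i)"
    if "i \<in> S" "j \<in> S" "i < j" for i j
  proof -
    have "j < length xs" "i < length xs" using that by (auto simp: S_def)
    then have "xs ! j \<notin> dball (xs ! i) (r (xs ! i))"
      using greedyD(2)[OF greedy] that by blast
    then show "r (xs ! i) \<le> e i j"
      using e_eq[OF that(1,2)] by (simp add: dball_def not_less ennreal_le_iff)
    have "\<forall>l<i. xs ! j \<notin> dball (xs ! l) (r (xs ! l))"
      using greedy \<open>j < length xs\<close> that(3) unfolding greedy_def by (meson less_trans)
    then show "3 * r (xs ! j) \<le> 4 * r (xs ! i)"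
      using greedy \<open>i < length xs\<close> xA[OF that(2)] unfolding greedy_def by blast
  qed
  have finS: "finite S" by (simp add: S_def)
  have fibre: "card {i \<in> S. \<kappa> (xs ! i) = c} \<le> 2" for c
  proof (rule ccontr)
    assume "\<not> card {i \<in> S. \<kappa> (xs ! i) = c} \<le> 2"
    then obtain T where T: "T \<subseteq> {i \<in> S. \<kappa> (xs ! i) = c}" "card T = 3"
      using obtain_subset_with_card_n[of 3 "{i \<in> S. \<kappa> (xs ! i) = c}"] by force
    then have "finite T" using card.infinite by fastforce
    define i where "i = Min T"
    define k where "k = Max T"
    have "T \<noteq> {}" using T by auto
    have "i \<in> T" "k \<in> T" using \<open>finite T\<close> \<open>T \<noteq> {}\<close> by (auto simp: i_def k_def)
    have "card {i, k} \<le> 2" by (simp add: card_insert_if)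
    then have "T - {i, k} \<noteq> {}"
      using T(2) card_mono[of "{i, k}" T] by fastforce
    then obtain j where j: "j \<in> T" "j \<noteq> i" "j \<noteq> k" by auto
    have ij: "i < j" "j < k"
      using j \<open>finite T\<close> by (auto simp: i_def k_def order.strict_iff_order)
    have mem: "i \<in> S" "j \<in> S" "k \<in> S" "\<kappa> (xs ! i) = \<kappa> (xs ! j)" "\<kappa> (xs ! j) = \<kappa> (xs ! k)"
      using T(1) \<open>i \<in> T\<close> \<open>k \<in> T\<close> j by auto
    show False
    proof (rule no_three_in_cone[of "a i" "r (xs ! i)" "a j" "r (xs ! j)" "a k" "r (xs ! k)"
          "e i j" "e j k"])
      show "a j \<le> a i \<Longrightarrow> e i j + a j / 2 \<le> a i" "a i \<le> a j \<Longrightarrow> e i j + a i / 2 \<le> a j"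
        using cl[OF mem(1,2,4)] cl[OF mem(2,1) mem(4)[symmetric]] e_sym[of i j] by auto
      show "a k \<le> a j \<Longrightarrow> e j k + a k / 2 \<le> a j" "a j \<le> a k \<Longrightarrow> e j k + a j / 2 \<le> a k"
        using cl[OF mem(2,3,5)] cl[OF mem(3,2) mem(5)[symmetric]] e_sym[of j k] by auto
    qed (use fin(3,4) mem sep ij less_trans[OF ij] in blast)+
  qed
  have "S = (\<Union>c<m. {i \<in> S. \<kappa> (xs ! i) = c})" using \<kappa> by auto
  then have "card S \<le> (\<Sum>c<m. card {i \<in> S. \<kappa> (xs ! i) = c})"
    by (metis card_UN_le finite_lessThan)
  also have "\<dots> \<le> (\<Sum>c<m. 2)" by (intro sum_mono fibre)
  finally show ?thesis by (simp add: S_def mult.commute)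
qed

text \<open>
  Centres of a greedy list are \<open>\<delta>\<close>-separated, so compactness bounds the length of such lists. A
  longest one covers \<open>A\<close>: otherwise a point of nearly maximal radius could be appended.
\<close>

lemma greedy_cover:
  assumes K: "compact K" "A \<subseteq> K" and \<delta>: "0 < \<delta>" "\<And>x. x \<in> A \<Longrightarrow> \<delta> \<le> r x \<and> r x \<le> r0"
  obtains xs where "greedy A r xs" "A \<subseteq> (\<Union>i<length xs. dball (xs ! i) (r (xs ! i)))"
proof -
  obtain P where P: "finite P" "K \<subseteq> (\<Union>p\<in>P. {y. d p y < ennreal (\<delta>/2)})"
  proof -
    have "K \<subseteq> (\<Union>p\<in>K. {y. d p y < ennreal (\<delta>/2)})"
    proof
      fix y assume "y \<in> K"
      moreover have "d y y < ennreal (\<delta>/2)" using \<delta> by (simp add: dist_self)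
      ultimately show "y \<in> (\<Union>p\<in>K. {y. d p y < ennreal (\<delta>/2)})" by blast
    qed
    then obtain C where "C \<subseteq> K" "finite C" "K \<subseteq> (\<Union>p\<in>C. {y. d p y < ennreal (\<delta>/2)})"
      by (rule compactE_image[OF K(1) open_dball])
    then show ?thesis by (intro that)
  qed
  have bound: "length xs \<le> card P" if "greedy A r xs" for xs
  proof -
    have "\<forall>i<length xs. \<exists>p\<in>P. d p (xs ! i) < ennreal (\<delta>/2)"
      using that K P(2) unfolding greedy_def by blast
    then obtain q where q: "\<And>i. i < length xs \<Longrightarrow> q i \<in> P \<and> d (q i) (xs ! i) < ennreal (\<delta>/2)"
      by metis
    have "inj_on q {..<length xs}"
    proof (rule linorder_inj_onI)
      fix i j assume ij: "i < j" "i \<in> {..<length xs}" "j \<in> {..<length xs}"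
      show "q i \<noteq> q j"
      proof
        assume eq: "q i = q j"
        have "d (xs ! i) (xs ! j) \<le> d (q i) (xs ! i) + d (q i) (xs ! j)"
          using dist_triangle[of "xs ! i" "xs ! j" "q i"] dist_sym by metis
        also have "\<dots> < ennreal (\<delta>/2) + ennreal (\<delta>/2)"
          using q[of i] q[of j] ij eq by (intro add_strict_mono) auto
        also have "\<dots> = ennreal \<delta>" using \<delta> by (simp add: ennreal_plus[symmetric] del: ennreal_plus)
        also have "\<dots> \<le> ennreal (r (xs ! i))"
          using \<delta>(2)[OF greedyD(1)[OF that, of i]] ij by (intro ennreal_leI) simp
        finally have "xs ! j \<in> dball (xs ! i) (r (xs ! i))" by (simp add: dball_def)
        moreover have "xs ! j \<notin> dball (xs ! i) (r (xs ! i))"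
          using ij by (intro greedyD(2)[OF that]) auto
        ultimately show False by (rule notE[rotated])
      qed
    qed (rule linear)
    moreover have "q ` {..<length xs} \<subseteq> P" using q by blast
    ultimately have "card {..<length xs} \<le> card P" by (rule card_inj_on_le[OF _ _ P(1)])
    then show ?thesis by simp
  qed
  define n where "n = Max (length ` {xs. greedy A r xs})"
  have fin: "finite (length ` {xs. greedy A r xs})"
    by (rule finite_subset[of _ "{..card P}"]) (use bound in blast, simp)
  have "greedy A r []" by (simp add: greedy_def)
  then have "length ` {xs. greedy A r xs} \<noteq> {}" by blast
  from Max_in[OF fin this] have "n \<in> length ` {xs. greedy A r xs}" by (simp only: n_def)
  then obtain xs where xs: "greedy A r xs" "length xs = n" by (elim imageE) simp
  have "A \<subseteq> (\<Union>i<length xs. dball (xs ! i) (r (xs ! i)))"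
  proof (rule ccontr)
    define A' where "A' = A - (\<Union>i<length xs. dball (xs ! i) (r (xs ! i)))"
    assume "\<not> ?thesis"
    then obtain y0 where y0: "y0 \<in> A'" unfolding A'_def by blast
    have A': "A' \<subseteq> A" by (auto simp: A'_def)
    have bdd: "bdd_above (r ` A')" using \<delta>(2) A' by (intro bdd_aboveI2[of _ _ r0]) blast
    have "0 < r y0" using \<delta>(1) \<delta>(2)[of y0] y0 A' by auto
    also have "r y0 \<le> Sup (r ` A')" by (rule cSUP_upper[OF y0 bdd])
    finally have "3/4 * Sup (r ` A') < Sup (r ` A')" by simp
    moreover have "r ` A' \<noteq> {}" using y0 by blast
    ultimately obtain t where "t \<in> r ` A'" "3/4 * Sup (r ` A') < t"
      using less_cSup_iff[OF _ bdd] by metis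
    then obtain y where y: "y \<in> A'" "3/4 * Sup (r ` A') < r y" by (elim imageE) simp
    have ymax: "3 * r y' \<le> 4 * r y" if "y' \<in> A'" for y'
      using cSUP_upper[OF that bdd] y(2) by linarith
    have "greedy A r (xs @ [y])"
      unfolding greedy_def
    proof (intro allI impI)
      fix i assume i: "i < length (xs @ [y])"
      show "(xs @ [y]) ! i \<in> A \<and>
         (\<forall>l<i. (xs @ [y]) ! i \<notin> dball ((xs @ [y]) ! l) (r ((xs @ [y]) ! l))) \<and>
         (\<forall>y'\<in>A. (\<forall>l<i. y' \<notin> dball ((xs @ [y]) ! l) (r ((xs @ [y]) ! l))) \<longrightarrow>
            3 * r y' \<le> 4 * r ((xs @ [y]) ! i))"
      proof (cases "i < length xs")
        case True
        have nth: "(xs @ [y]) ! l = xs ! l" if "l \<le> i" for l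
          using that True by (simp add: nth_append)
        show ?thesis
        proof (intro conjI ballI allI impI)
          show "(xs @ [y]) ! i \<in> A" using greedyD(1)[OF xs(1) True] by (simp only: nth)
          show "(xs @ [y]) ! i \<notin> dball ((xs @ [y]) ! l) (r ((xs @ [y]) ! l))" if "l < i" for l
            using greedyD(2)[OF xs(1) True that] that by (simp only: nth less_imp_le order_refl not_False_eq_True)
          show "3 * r y' \<le> 4 * r ((xs @ [y]) ! i)"
            if "y' \<in> A" and that': "\<forall>l<i. y' \<notin> dball ((xs @ [y]) ! l) (r ((xs @ [y]) ! l))" for y'
          proof -
            have "y' \<notin> dball (xs ! l) (r (xs ! l))" if "l < i" for l
              using that' that nth[of l] by (metis less_imp_le)
            then show ?thesis using greedyD(3)[OF xs(1) True \<open>y' \<in> A\<close>] nth[of i] by simp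
          qed
        qed
      next
        case False
        then have "i = length xs" using i by simp
        then show ?thesis using y(1) ymax by (auto simp: nth_append A'_def)
      qed
    qed
    then have "length (xs @ [y]) \<in> length ` {xs. greedy A r xs}" by blast
    then have "length (xs @ [y]) \<le> n" unfolding n_def by (rule Max_ge[OF fin])
    then show False using xs by simp
  qed
  then show ?thesis using xs(1) by (intro that)
qed

end

section \<open>Differentiation of measures along balls\<close>

text \<open>
  The Borel sets that can be approximated both from inside and from outside form a \<open>\<sigma>\<close>-algebra, and
  it contains the open sets because these are countable unions of closed sets.
\<close>

lemma finite_borel_regular:
  fixes M :: "'a::topological_space measure"
  assumes fm: "finite_measure M" and sets: "sets M = sets borel"
    and F_sigma: "\<And>U. open U \<Longrightarrow> \<exists>F::nat \<Rightarrow> 'a set. (\<forall>n. closed (F n)) \<and> (\<Union>n. F n) = U"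
    and B: "B \<in> sets borel" and "0 < e"
  shows "\<exists>F U. closed F \<and> open U \<and> F \<subseteq> B \<and> B \<subseteq> U \<and> measure M (U - F) < e"
proof -
  interpret finite_measure M by fact
  have cl: "closed F \<Longrightarrow> F \<in> sets M" for F by (simp add: sets)
  have op: "open U \<Longrightarrow> U \<in> sets M" for U by (simp add: sets)
  \<comment> \<open>the part of a countable union missed by its first members has small measure\<close>
  have tail: "\<exists>n::nat. measure M ((\<Union>i. F i) - (\<Union>i<n. F i)) < e"
    if "\<And>i. closed (F i)" "0 < e" for F and e :: real
  proof -
    define D where "D n = (\<Union>i. F i) - (\<Union>i<n. F i)" for n :: nat
    have "range D \<subseteq> sets M" using that cl by (auto simp: D_def)
    moreover have "decseq D" by (auto simp: decseq_def D_def)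
    moreover have "(\<Inter>n. D n) = {}" by (auto simp: D_def)
    ultimately have "(\<lambda>n. measure M (D n)) \<longlonglongrightarrow> 0"
      using finite_Lim_measure_decseq[of D] by simp
    then have "\<forall>\<^sub>F n in sequentially. measure M (D n) < e" by (rule order_tendstoD) fact
    then show ?thesis by (auto simp: D_def eventually_sequentially)
  qed
  have "B \<in> sigma_sets UNIV {S. open S}" using B by (simp add: sets_borel)
  then show ?thesis using \<open>0 < e\<close>
  proof (induction arbitrary: e rule: sigma_sets.induct)
    case (Basic U)
    then have "open U" by simp
    then obtain F :: "nat \<Rightarrow> 'a set" where F: "\<And>n. closed (F n)" "(\<Union>n. F n) = U"
      using F_sigma by metis
    obtain n where n: "measure M ((\<Union>i. F i) - (\<Union>i<n. F i)) < e" using tail[of F e, OF F(1) Basic(2)] by blast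
    have "closed (\<Union>i<n. F i)" using F(1) by (intro closed_UN) auto
    then show ?case using \<open>open U\<close> n F(2)
      by (intro exI[of _ "\<Union>i<n. F i"] exI[of _ U]) auto
  next
    case Empty
    then show ?case by (intro exI[of _ "{}"]) simp
  next
    case (Compl a)
    then obtain F U where FU: "closed F" "open U" "F \<subseteq> a" "a \<subseteq> U" "measure M (U - F) < e" by metis
    have "(- F) - (- U) = U - F" by auto
    then show ?case using FU by (intro exI[of _ "- U"] exI[of _ "- F"]) (auto simp: open_Compl closed_Compl)
  next
    case (Union a)
    \<comment> \<open>one half of the error is spent on the single members, the other half on truncating the union\<close>
    define w where "w i = e / 4 * (1/2) ^ i" for i :: nat
    have "(\<lambda>i. (1/2) ^ i) sums (2::real)" using geometric_sums[of "1/2::real"] by simp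
    then have "(\<lambda>i. e / 4 * (1/2) ^ i) sums (e / 4 * 2)" by (rule sums_mult)
    then have "w sums (e / 2)" by (simp add: w_def[abs_def])
    then have w: "summable w" "suminf w = e / 2" "\<And>i. 0 < w i"
      using \<open>0 < e\<close> by (auto simp: w_def[abs_def] sums_iff)
    have "\<forall>i. \<exists>F U. closed F \<and> open U \<and> F \<subseteq> a i \<and> a i \<subseteq> U \<and> measure M (U - F) < w i"
      using Union.IH w(3) by blast
    then obtain F U where FU: "\<And>i. closed (F i)" "\<And>i. open (U i)" "\<And>i. F i \<subseteq> a i"
      "\<And>i. a i \<subseteq> U i" "\<And>i. measure M (U i - F i) < w i"
      by metis
    obtain n where n: "measure M ((\<Union>i. F i) - (\<Union>i<n. F i)) < e / 2"
      using tail[of F "e/2"] FU(1) \<open>0 < e\<close> by auto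
    have meas: "U i - F i \<in> sets M" for i using cl[OF FU(1)] op[OF FU(2)] by blast
    have meas_tail: "(\<Union>i. F i) - (\<Union>i<n. F i) \<in> sets M" using cl[OF FU(1)] by blast
    have le: "norm (measure M (U i - F i)) \<le> w i" for i using FU(5)[of i] by simp
    have "(\<Union>i. U i) - (\<Union>i<n. F i) \<subseteq> (\<Union>i. U i - F i) \<union> ((\<Union>i. F i) - (\<Union>i<n. F i))" by auto
    then have "measure M ((\<Union>i. U i) - (\<Union>i<n. F i))
        \<le> measure M ((\<Union>i. U i - F i) \<union> ((\<Union>i. F i) - (\<Union>i<n. F i)))"
      using meas meas_tail by (intro finite_measure_mono) auto
    also have "\<dots> \<le> measure M (\<Union>i. U i - F i) + measure M ((\<Union>i. F i) - (\<Union>i<n. F i))"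
      using meas meas_tail by (intro measure_Un_le) auto
    also have "measure M (\<Union>i. U i - F i) \<le> (\<Sum>i. measure M (U i - F i))"
      using meas summable_comparison_test'[OF w(1) le]
      by (intro finite_measure_subadditive_countably) auto
    also have "\<dots> \<le> suminf w"
      using le summable_comparison_test'[OF w(1) le] w(1) by (intro suminf_le) auto
    finally have "measure M ((\<Union>i. U i) - (\<Union>i<n. F i)) < e" using w(2) n by simp
    moreover have "closed (\<Union>i<n. F i)" using FU(1) by (intro closed_UN) auto
    moreover have "open (\<Union>i. U i)" using FU(2) by auto
    moreover have "(\<Union>i<n. F i) \<subseteq> (\<Union>i. a i)" "(\<Union>i. a i) \<subseteq> (\<Union>i. U i)" using FU(3,4) by blast+
    ultimately show ?case by blast
  qed
qed

context ball_distance
begin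

lemma dball_small:
  assumes "open U" "x \<in> U"
  obtains \<rho> where "0 < \<rho>" "\<And>r. r \<le> \<rho> \<Longrightarrow> dball x r \<subseteq> U"
proof -
  obtain \<rho> where \<rho>: "0 < \<rho>" "{y. d x y < ennreal \<rho>} \<subseteq> U" using dball_neighbourhood[OF assms] by blast
  have "dball x r \<subseteq> U" if "r \<le> \<rho>" for r
    using \<rho>(2) order_less_le_trans[OF _ ennreal_leI[OF that]] unfolding dball_def by blast
  then show ?thesis using that \<rho>(1) by blast
qed

lemma sets_dball [measurable]: "dball x r \<in> sets borel"
  unfolding dball_def using open_dball by simp

text \<open>
  The points at distance at least \<open>1/(n+1)\<close> from the complement of an open set form a closed set.
\<close>

lemma open_is_F_sigma:
  assumes "open U"
  shows "\<exists>F::nat \<Rightarrow> 'a set. (\<forall>n. closed (F n)) \<and> (\<Union>n. F n) = U"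
proof (intro exI conjI allI)
  define F where "F n = - (\<Union>y\<in>-U. dball y (1 / Suc n))" for n :: nat
  show "closed (F n)" for n
    unfolding F_def dball_def closed_def using open_dball by auto
  show "(\<Union>n. F n) = U"
  proof (intro equalityI subsetI)
    fix x assume "x \<in> (\<Union>n. F n)"
    then obtain n where n: "x \<in> F n" by blast
    show "x \<in> U"
    proof (rule ccontr)
      assume "x \<notin> U"
      moreover have "x \<in> dball x (1 / Suc n)" by (simp add: dball_def dist_self)
      ultimately show False using n by (auto simp: F_def)
    qed
  next
    fix x assume x: "x \<in> U"
    obtain \<rho> where \<rho>: "0 < \<rho>" "\<And>r. r \<le> \<rho> \<Longrightarrow> dball x r \<subseteq> U" using dball_small[OF assms x] by blast
    obtain n where n: "1 / Suc n < \<rho>" using nat_approx_posE[OF \<rho>(1)] by blast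
    have "x \<notin> dball y (1 / Suc n)" if "y \<notin> U" for y
    proof
      assume "x \<in> dball y (1 / Suc n)"
      then have "y \<in> dball x (1 / Suc n)" by (simp add: dball_def dist_sym)
      then show False using \<rho>(2)[OF less_imp_le[OF n]] that by blast
    qed
    then have "x \<in> F n" by (auto simp: F_def)
    then show "x \<in> (\<Union>n. F n)" by blast
  qed
qed

text \<open>
  Choose for each \<open>x \<in> A\<close> one admissible ball inside \<open>U\<close>. The points whose radius is at least
  \<open>1/(n+1)\<close> are covered by a greedy list of these balls, which overlap at most \<open>2 * m\<close> times, and the
  sum of their \<open>\<eta>\<close>-masses is at most \<open>2 * m * \<eta> U\<close>. The set \<open>A\<close> itself need not be measurable,
  so it is enclosed in the lower limit of these covers.
\<close>

lemma weak_type_estimate: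
  assumes cone: "cone_bounded d W r0 m" and r0: "0 < r0" and K: "compact K" "W \<subseteq> K"
    and U: "open U" "U \<subseteq> W" and A: "A \<subseteq> U"
    and sets: "sets \<nu> = sets borel" "sets \<eta> = sets borel"
    and dense: "\<And>x \<rho>. x \<in> A \<Longrightarrow> 0 < \<rho> \<Longrightarrow>
      \<exists>r. 0 < r \<and> r < \<rho> \<and> c * emeasure \<nu> (dball x r) \<le> emeasure \<eta> (dball x r)"
  obtains A' where "A' \<in> sets borel" "A \<subseteq> A'"
    "c * emeasure \<nu> A' \<le> of_nat (2 * m) * emeasure \<eta> U"
proof -
  have "\<exists>r. 0 < r \<and> r \<le> r0 \<and> dball x r \<subseteq> U \<and> c * emeasure \<nu> (dball x r) \<le> emeasure \<eta> (dball x r)"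
    if x: "x \<in> A" for x
  proof -
    have "x \<in> U" using A x by blast
    then obtain \<rho> where \<rho>: "0 < \<rho>" "\<And>r. r \<le> \<rho> \<Longrightarrow> dball x r \<subseteq> U"
      using dball_small[OF U(1)] by blast
    obtain r where "0 < r" "r < min \<rho> r0" "c * emeasure \<nu> (dball x r) \<le> emeasure \<eta> (dball x r)"
      using dense[OF x, of "min \<rho> r0"] \<rho>(1) r0 by auto
    then show ?thesis using \<rho>(2)[of r] by (intro exI[of _ r]) auto
  qed
  then obtain r where r: "\<And>x. x \<in> A \<Longrightarrow> 0 < r x \<and> r x \<le> r0 \<and> dball x (r x) \<subseteq> U \<and>
      c * emeasure \<nu> (dball x (r x)) \<le> emeasure \<eta> (dball x (r x))"
    by metis
  define P where "P n = {x \<in> A. 1 / Suc n \<le> r x}" for n :: nat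
  have "\<exists>O'. O' \<in> sets borel \<and> P n \<subseteq> O' \<and> c * emeasure \<nu> O' \<le> of_nat (2 * m) * emeasure \<eta> U" for n
  proof -
    have PK: "P n \<subseteq> K" using A U K by (auto simp: P_def)
    obtain xs where xs: "greedy (P n) r xs" "P n \<subseteq> (\<Union>i<length xs. dball (xs ! i) (r (xs ! i)))"
    proof (rule greedy_cover[OF K(1) PK])
      show "0 < 1 / real (Suc n)" by simp
      show "1 / real (Suc n) \<le> r x \<and> r x \<le> r0" if "x \<in> P n" for x using that r by (auto simp: P_def)
    qed
    define B where "B i = dball (xs ! i) (r (xs ! i))" for i
    have xA: "xs ! i \<in> A" if "i < length xs" for i using greedyD(1)[OF xs(1) that] by (simp add: P_def)
    have B: "B i \<in> sets borel" for i by (simp add: B_def)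
    have overlap: "(\<Sum>i<length xs. indicator (B i) z) \<le> of_nat (2 * m) * (indicator U z :: ennreal)" for z
    proof (cases "z \<in> U")
      case True
      have eq: "{..<length xs} \<inter> {i. z \<in> B i} = {i. i < length xs \<and> z \<in> dball (xs ! i) (r (xs ! i))}"
        by (auto simp: B_def)
      have "(\<Sum>i<length xs. indicator (B i) z :: ennreal) = of_nat (card ({..<length xs} \<inter> {i. z \<in> B i}))"
        by (simp add: indicator_def sum.If_cases)
      also have "\<dots> = of_nat (card {i. i < length xs \<and> z \<in> dball (xs ! i) (r (xs ! i))})"
        by (simp only: eq)
      also have "\<dots> \<le> of_nat (2 * m)"
      proof (rule of_nat_mono, rule overlap_bound[OF cone _ xs(1)])
        show "z \<in> W" using True U by blast
        show "0 < r x \<and> r x \<le> r0" if "x \<in> P n" for x using that r by (auto simp: P_def)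
      qed
      finally show ?thesis using True by simp
    next
      case False
      have "z \<notin> B i" if "i < length xs" for i using r[OF xA[OF that]] False by (auto simp: B_def)
      then have "(\<Sum>i<length xs. indicator (B i) z) = (0 :: ennreal)" by (intro sum.neutral) auto
      then show ?thesis by simp
    qed
    have "c * emeasure \<nu> (\<Union>i<length xs. B i) \<le> c * (\<Sum>i<length xs. emeasure \<nu> (B i))"
      using B by (intro mult_left_mono emeasure_subadditive_finite) (auto simp: sets)
    also have "\<dots> = (\<Sum>i<length xs. c * emeasure \<nu> (B i))" by (simp add: sum_distrib_left)
    also have "\<dots> \<le> (\<Sum>i<length xs. emeasure \<eta> (B i))"
      using r xA unfolding B_def by (intro sum_mono) simp
    also have "\<dots> = (\<Sum>i<length xs. \<integral>\<^sup>+z. indicator (B i) z \<partial>\<eta>)" using B by (simp add: sets)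
    also have "\<dots> = (\<integral>\<^sup>+z. (\<Sum>i<length xs. indicator (B i) z) \<partial>\<eta>)"
      using B by (intro nn_integral_sum[symmetric] borel_measurable_indicator) (simp add: sets)
    also have "\<dots> \<le> (\<integral>\<^sup>+z. of_nat (2 * m) * indicator U z \<partial>\<eta>)"
      by (intro nn_integral_mono overlap)
    also have "\<dots> = of_nat (2 * m) * emeasure \<eta> U"
      using U by (intro nn_integral_cmult_indicator) (simp add: sets)
    finally have "c * emeasure \<nu> (\<Union>i<length xs. B i) \<le> of_nat (2 * m) * emeasure \<eta> U" .
    moreover have "(\<Union>i<length xs. B i) \<in> sets borel" using B by blast
    ultimately show ?thesis using xs(2) unfolding B_def by blast
  qed
  then obtain Q where Q: "\<And>n. Q n \<in> sets borel" "\<And>n. P n \<subseteq> Q n"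
    "\<And>n. c * emeasure \<nu> (Q n) \<le> of_nat (2 * m) * emeasure \<eta> U"
    by metis
  \<comment> \<open>each \<open>x\<close> belongs to \<open>P n\<close> for all large \<open>n\<close>\<close>
  define J where "J k = (\<Inter>n\<in>{k..}. Q n)" for k :: nat
  have J: "J k \<in> sets borel" for k unfolding J_def using Q(1) by (intro sets.countable_INT'') auto
  have "incseq J" unfolding incseq_def J_def by fastforce
  have "A \<subseteq> (\<Union>k. J k)"
  proof
    fix x assume x: "x \<in> A"
    obtain k where k: "1 / Suc k < r x" using nat_approx_posE r[OF x] by blast
    have "x \<in> Q n" if "k \<le> n" for n
    proof -
      have "1 / real (Suc n) \<le> 1 / Suc k" using that by (simp add: field_simps)
      then have "x \<in> P n" using k x by (simp add: P_def)
      then show ?thesis using Q(2) by blast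
    qed
    then show "x \<in> (\<Union>k. J k)" by (auto simp: J_def)
  qed
  moreover have "(\<Union>k. J k) \<in> sets borel" using J by blast
  moreover have "c * emeasure \<nu> (\<Union>k. J k) \<le> of_nat (2 * m) * emeasure \<eta> U"
  proof -
    have "c * emeasure \<nu> (\<Union>k. J k) = (SUP k. c * emeasure \<nu> (J k))"
      using J \<open>incseq J\<close> by (subst SUP_emeasure_incseq[symmetric]) (auto simp: sets SUP_mult_left_ennreal)
    also have "\<dots> \<le> of_nat (2 * m) * emeasure \<eta> U"
    proof (rule SUP_least)
      fix k
      have "J k \<subseteq> Q k" by (auto simp: J_def)
      then have "c * emeasure \<nu> (J k) \<le> c * emeasure \<nu> (Q k)"
        using Q(1) by (intro mult_left_mono emeasure_mono) (auto simp: sets)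
      also note Q(3)
      finally show "c * emeasure \<nu> (J k) \<le> of_nat (2 * m) * emeasure \<eta> U" .
    qed
    finally show ?thesis .
  qed
  ultimately show ?thesis using that by blast
qed

text \<open>
  The measure \<open>h \<nu>\<close> vanishes on the zero set of \<open>h\<close>, so this set has open neighbourhoods of
  arbitrarily small mass; insert these as \<open>U\<close> into \<open>weak_type_estimate\<close>.
\<close>

lemma zero_density_null:
  assumes cone: "cone_bounded d W r0 m" and r0: "0 < r0" and K: "compact K" "W \<subseteq> K" and W: "open W"
    and sets: "sets \<nu> = sets borel" and h: "h \<in> borel_measurable borel"
    and fin: "(\<integral>\<^sup>+x\<in>W. h x \<partial>\<nu>) < \<infinity>" and c: "0 < c"
    and A: "A \<subseteq> {x \<in> W. h x = 0}"
    and dense: "\<And>x \<rho>. x \<in> A \<Longrightarrow> 0 < \<rho> \<Longrightarrow>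
      \<exists>r. 0 < r \<and> r < \<rho> \<and> ennreal c * emeasure \<nu> (dball x r) \<le> (\<integral>\<^sup>+y\<in>dball x r. h y \<partial>\<nu>)"
  shows "\<exists>N\<in>null_sets \<nu>. A \<subseteq> N"
proof -
  define \<eta> where "\<eta> = density \<nu> (\<lambda>x. h x * indicator W x)"
  have [measurable_cong]: "sets \<nu> = sets borel" by fact
  have [measurable]: "h \<in> borel_measurable borel" "W \<in> sets borel" using h W by auto
  have \<eta>sets: "sets \<eta> = sets borel" by (simp add: \<eta>_def sets)
  have em: "emeasure \<eta> B = (\<integral>\<^sup>+x\<in>B. (h x * indicator W x) \<partial>\<nu>)" if "B \<in> sets borel" for B
    unfolding \<eta>_def using that by (intro emeasure_density) (auto simp: sets)
  have "space \<eta> = UNIV" using sets_eq_imp_space_eq[OF \<eta>sets] by simp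
  then have "emeasure \<eta> (space \<eta>) < \<infinity>" using em[of UNIV] fin by simp
  then interpret \<eta>: finite_measure \<eta> by (intro finite_measureI) simp
  define Z where "Z = {x \<in> W. h x = 0}"
  have Z: "Z \<in> sets borel" unfolding Z_def by measurable
  have Z0: "emeasure \<eta> Z = 0"
    unfolding em[OF Z] by (subst nn_integral_0_iff_AE) (auto simp: Z_def indicator_def)
  have small_open: "\<exists>U. open U \<and> U \<subseteq> W \<and> Z \<subseteq> U \<and> emeasure \<eta> U \<le> ennreal e" if "0 < e" for e :: real
  proof -
    obtain F U where FU: "closed F" "open U" "F \<subseteq> Z" "Z \<subseteq> U" "measure \<eta> (U - F) < e"
      using finite_borel_regular[OF \<eta>.finite_measure_axioms \<eta>sets open_is_F_sigma Z \<open>0 < e\<close>] by blast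
    have "emeasure \<eta> (U \<inter> W) \<le> emeasure \<eta> ((U - F) \<union> Z)"
      using FU W Z by (intro emeasure_mono) (auto simp: \<eta>sets)
    also have "\<dots> \<le> emeasure \<eta> (U - F) + emeasure \<eta> Z"
      using FU Z by (intro emeasure_subadditive) (auto simp: \<eta>sets)
    also have "\<dots> \<le> ennreal e"
      using FU(5) Z0 by (simp add: \<eta>.emeasure_eq_measure ennreal_leI)
    finally show ?thesis
      using FU W by (intro exI[of _ "U \<inter> W"]) (auto simp: Z_def)
  qed
  have "\<exists>N. N \<in> sets borel \<and> A \<subseteq> N \<and> ennreal c * emeasure \<nu> N \<le> ennreal e" if "0 < e" for e :: real
  proof -
    have "0 < e / (2 * m + 1)" using that by simp
    then obtain U where U: "open U" "U \<subseteq> W" "Z \<subseteq> U" "emeasure \<eta> U \<le> ennreal (e / (2 * m + 1))"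
      using small_open by blast
    have AU: "A \<subseteq> U" using A U by (auto simp: Z_def)
    have dense': "\<exists>r. 0 < r \<and> r < \<rho> \<and> ennreal c * emeasure \<nu> (dball x r) \<le> emeasure \<eta> (dball x r)"
      if x: "x \<in> A" and \<rho>: "0 < \<rho>" for x \<rho>
    proof -
      have "x \<in> W" using A x by blast
      then obtain \<rho>' where \<rho>': "0 < \<rho>'" "\<And>r. r \<le> \<rho>' \<Longrightarrow> dball x r \<subseteq> W" using dball_small[OF W] by blast
      obtain r where r: "0 < r" "r < min \<rho> \<rho>'"
        "ennreal c * emeasure \<nu> (dball x r) \<le> (\<integral>\<^sup>+y\<in>dball x r. h y \<partial>\<nu>)"
        using dense[OF x, of "min \<rho> \<rho>'"] \<rho> \<rho>' by auto
      have "dball x r \<subseteq> W" using r \<rho>' by simp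
      then have "(\<integral>\<^sup>+y\<in>dball x r. h y \<partial>\<nu>) = emeasure \<eta> (dball x r)"
        unfolding em[OF sets_dball] by (intro nn_integral_cong) (auto simp: indicator_def)
      then show ?thesis using r by auto
    qed
    obtain N where N: "N \<in> sets borel" "A \<subseteq> N"
      "ennreal c * emeasure \<nu> N \<le> of_nat (2 * m) * emeasure \<eta> U"
      by (rule weak_type_estimate[OF cone r0 K U(1,2) AU sets \<eta>sets dense'])
    note N(3)
    also have "of_nat (2 * m) * emeasure \<eta> U \<le> of_nat (2 * m) * ennreal (e / (2 * m + 1))"
      by (intro mult_left_mono U) auto
    also have "\<dots> = ennreal (2 * m * (e / (2 * m + 1)))"
      using that unfolding ennreal_of_nat_eq_real_of_nat
      by (subst ennreal_mult[symmetric]) (simp_all only: of_nat_mult of_nat_numeral, simp_all)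
    also have "\<dots> \<le> ennreal e"
      using that by (intro ennreal_leI) (simp add: field_simps)
    finally show ?thesis using N by blast
  qed
  then have "\<forall>k. \<exists>N. N \<in> sets borel \<and> A \<subseteq> N \<and> ennreal c * emeasure \<nu> N \<le> ennreal (1 / Suc k)" by simp
  then obtain N where N: "\<And>k. N k \<in> sets borel" "\<And>k. A \<subseteq> N k"
    "\<And>k. ennreal c * emeasure \<nu> (N k) \<le> ennreal (1 / Suc k)"
    by metis
  have I: "(\<Inter>k. N k) \<in> sets borel" using N(1) by blast
  have "ennreal c * emeasure \<nu> (\<Inter>k. N k) \<le> 0"
  proof (rule ennreal_le_epsilon)
    fix e :: real assume "0 < e"
    then obtain k where k: "1 / Suc k < e" using nat_approx_posE by blast
    have "ennreal c * emeasure \<nu> (\<Inter>k. N k) \<le> ennreal c * emeasure \<nu> (N k)"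
      using N(1) by (intro mult_left_mono emeasure_mono) (auto simp: sets)
    also have "\<dots> \<le> ennreal (1 / Suc k)" by (rule N(3))
    also have "\<dots> \<le> ennreal e" using k by (intro ennreal_leI) simp
    finally show "ennreal c * emeasure \<nu> (\<Inter>k. N k) \<le> 0 + ennreal e" by simp
  qed
  then have "emeasure \<nu> (\<Inter>k. N k) = 0" using c by simp
  then have "(\<Inter>k. N k) \<in> null_sets \<nu>" using I by (auto simp: sets)
  then show ?thesis using N(2) by blast
qed

end

lemma cone_bounded_subset: "cone_bounded d W r0 m \<Longrightarrow> V \<subseteq> W \<Longrightarrow> cone_bounded d V r0 m"
  unfolding cone_bounded_def by blast

context ball_distance
begin

text \<open>
  On the first set \<open>h = (f - a)\<^sup>+\<close> vanishes, and \<open>f \<le> a + h\<close> turns the assumption on the balls into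
  \<open>(b - a) \<nu>(B) \<le> (h \<nu>)(B)\<close>. On the second set the same works with \<open>h = (b - f)\<^sup>+\<close>.
\<close>

lemma local_comparison_null:
  assumes cone: "cone_bounded d W r0 m" and r0: "0 < r0" and K: "compact K" "W \<subseteq> K" and W: "open W"
    and sets: "sets \<nu> = sets borel" and f: "f \<in> borel_measurable borel"
    and fin: "emeasure \<nu> W < \<infinity>" "emeasure (density \<nu> f) W < \<infinity>" and ab: "0 \<le> a" "a < b"
  shows "\<exists>N\<in>null_sets \<nu>. {x \<in> W. f x \<le> ennreal a \<and> (\<forall>\<rho>>0. \<exists>r. 0 < r \<and> r < \<rho> \<and>
      ennreal b * emeasure \<nu> (dball x r) \<le> emeasure (density \<nu> f) (dball x r))} \<subseteq> N"
      (is "\<exists>N\<in>_. ?A1 \<subseteq> N")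
    and "\<exists>N\<in>null_sets \<nu>. {x \<in> W. ennreal b \<le> f x \<and> (\<forall>\<rho>>0. \<exists>r. 0 < r \<and> r < \<rho> \<and>
      emeasure (density \<nu> f) (dball x r) \<le> ennreal a * emeasure \<nu> (dball x r))} \<subseteq> N"
      (is "\<exists>N\<in>_. ?A2 \<subseteq> N")
proof -
  have [measurable_cong]: "sets \<nu> = sets borel" by fact
  have [measurable]: "f \<in> borel_measurable borel" "W \<in> sets borel" using f W by auto
  have em: "emeasure (density \<nu> f) B = (\<integral>\<^sup>+x\<in>B. f x \<partial>\<nu>)" if "B \<in> sets borel" for B
    using that by (intro emeasure_density) (auto simp: sets)
  have const: "(\<integral>\<^sup>+x\<in>B. t \<partial>\<nu>) = t * emeasure \<nu> B" if "B \<in> sets borel" for t B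
    using that by (intro nn_integral_cmult_indicator) (simp add: sets)
  have le_add_diff: "t \<le> u + (t - u)" for t u :: ennreal
  proof (cases "u \<le> t")
    case True
    then have "u + (t - u) = t" using diff_add_cancel_ennreal by (metis add.commute)
    then show ?thesis by (metis order_refl)
  next
    case False
    then show ?thesis by (intro add_increasing2) auto
  qed
  have add: "(\<integral>\<^sup>+x\<in>B. p x + q x \<partial>\<nu>) = (\<integral>\<^sup>+x\<in>B. p x \<partial>\<nu>) + (\<integral>\<^sup>+x\<in>B. q x \<partial>\<nu>)"
    if [measurable]: "B \<in> sets borel" "p \<in> borel_measurable borel" "q \<in> borel_measurable borel" for p q B
    unfolding distrib_right by (intro nn_integral_add) measurable
  \<comment> \<open>\<open>a * v\<close> can be cancelled because it is finite\<close>
  have cancel: "ennreal (b - a) * v \<le> t" if "ennreal b * v \<le> ennreal a * v + t" "v < \<infinity>" for v t :: ennreal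
  proof -
    have "ennreal a * v + ennreal (b - a) * v = ennreal b * v"
      using ab by (subst distrib_right[symmetric]) (simp add: ennreal_plus[symmetric] del: ennreal_plus)
    moreover have "ennreal a * v \<noteq> \<infinity>" using that(2) by (simp add: ennreal_mult_eq_top_iff)
    ultimately show ?thesis using that(1) by (metis ennreal_add_left_cancel_le)
  qed
  have reduce: "\<exists>r. 0 < r \<and> r < \<rho> \<and> ennreal (b - a) * emeasure \<nu> (dball x r) \<le> (\<integral>\<^sup>+y\<in>dball x r. h y \<partial>\<nu>)"
    if x: "x \<in> W" and \<rho>: "0 < \<rho>" and often: "\<forall>\<rho>>0. \<exists>r. 0 < r \<and> r < \<rho> \<and> Q r" and
      Q: "\<And>r. Q r \<Longrightarrow> ennreal b * emeasure \<nu> (dball x r)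
        \<le> ennreal a * emeasure \<nu> (dball x r) + (\<integral>\<^sup>+y\<in>dball x r. h y \<partial>\<nu>)" for x \<rho> Q h
  proof -
    obtain \<rho>' where \<rho>': "0 < \<rho>'" "\<And>r. r \<le> \<rho>' \<Longrightarrow> dball x r \<subseteq> W" using dball_small[OF W x] by blast
    have "0 < min \<rho> \<rho>'" using \<rho>'(1) \<rho> by simp
    then obtain r where r: "0 < r" "r < min \<rho> \<rho>'" "Q r" using often by blast
    have "emeasure \<nu> (dball x r) \<le> emeasure \<nu> W"
      using r \<rho>' by (intro emeasure_mono) (auto simp: sets)
    then have "emeasure \<nu> (dball x r) < \<infinity>" using fin(1) by (rule order_le_less_trans)
    then show ?thesis using cancel[OF Q[OF r(3)]] r by (intro exI[of _ r]) auto
  qed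
  show "\<exists>N\<in>null_sets \<nu>. ?A1 \<subseteq> N"
  proof (rule zero_density_null[OF cone r0 K W sets])
    let ?h = "\<lambda>x. f x - ennreal a"
    show h: "?h \<in> borel_measurable borel" by measurable
    have "(\<integral>\<^sup>+x\<in>W. ?h x \<partial>\<nu>) \<le> (\<integral>\<^sup>+x\<in>W. f x \<partial>\<nu>)"
      by (intro nn_integral_mono mult_right_mono) (auto intro: diff_le_self_ennreal)
    then show "(\<integral>\<^sup>+x\<in>W. ?h x \<partial>\<nu>) < \<infinity>" using fin(2) em[of W] by (simp add: order_le_less_trans)
    show "?A1 \<subseteq> {x \<in> W. ?h x = 0}"
      by (auto simp: diff_eq_0_iff_ennreal intro: order_le_less_trans[OF _ ennreal_less_top])
    show "0 < b - a" using ab by simp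
    fix x \<rho> assume x: "x \<in> ?A1" and \<rho>: "(0::real) < \<rho>"
    show "\<exists>r. 0 < r \<and> r < \<rho> \<and> ennreal (b - a) * emeasure \<nu> (dball x r) \<le> (\<integral>\<^sup>+y\<in>dball x r. ?h y \<partial>\<nu>)"
    proof (rule reduce[OF _ \<rho>])
      show "x \<in> W" using x by blast
      show "\<forall>\<rho>>0. \<exists>r. 0 < r \<and> r < \<rho> \<and>
        ennreal b * emeasure \<nu> (dball x r) \<le> emeasure (density \<nu> f) (dball x r)" using x by blast
      fix r assume "ennreal b * emeasure \<nu> (dball x r) \<le> emeasure (density \<nu> f) (dball x r)"
      also have "\<dots> = (\<integral>\<^sup>+y\<in>dball x r. f y \<partial>\<nu>)" by (rule em[OF sets_dball])
      also have "\<dots> \<le> (\<integral>\<^sup>+y\<in>dball x r. (ennreal a + ?h y) \<partial>\<nu>)"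
        by (intro nn_integral_mono mult_right_mono) (auto intro: le_add_diff)
      also have "\<dots> = ennreal a * emeasure \<nu> (dball x r) + (\<integral>\<^sup>+y\<in>dball x r. ?h y \<partial>\<nu>)"
        by (subst add) (simp_all add: const h)
      finally show "ennreal b * emeasure \<nu> (dball x r)
        \<le> ennreal a * emeasure \<nu> (dball x r) + (\<integral>\<^sup>+y\<in>dball x r. ?h y \<partial>\<nu>)" .
    qed
  qed
  show "\<exists>N\<in>null_sets \<nu>. ?A2 \<subseteq> N"
  proof (rule zero_density_null[OF cone r0 K W sets])
    let ?h = "\<lambda>x. ennreal b - f x"
    show h: "?h \<in> borel_measurable borel" by measurable
    have "(\<integral>\<^sup>+x\<in>W. ?h x \<partial>\<nu>) \<le> (\<integral>\<^sup>+x\<in>W. ennreal b \<partial>\<nu>)"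
      by (intro nn_integral_mono mult_right_mono) (auto intro: diff_le_self_ennreal)
    also have "\<dots> < \<infinity>" using fin(1) const[of W] by (simp add: ennreal_mult_less_top)
    finally show "(\<integral>\<^sup>+x\<in>W. ?h x \<partial>\<nu>) < \<infinity>" .
    show "?A2 \<subseteq> {x \<in> W. ?h x = 0}" by (auto simp: diff_eq_0_iff_ennreal)
    show "0 < b - a" using ab by simp
    fix x \<rho> assume x: "x \<in> ?A2" and \<rho>: "(0::real) < \<rho>"
    show "\<exists>r. 0 < r \<and> r < \<rho> \<and> ennreal (b - a) * emeasure \<nu> (dball x r) \<le> (\<integral>\<^sup>+y\<in>dball x r. ?h y \<partial>\<nu>)"
    proof (rule reduce[OF _ \<rho>])
      show "x \<in> W" using x by blast
      show "\<forall>\<rho>>0. \<exists>r. 0 < r \<and> r < \<rho> \<and>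
        emeasure (density \<nu> f) (dball x r) \<le> ennreal a * emeasure \<nu> (dball x r)" using x by blast
      fix r assume r: "emeasure (density \<nu> f) (dball x r) \<le> ennreal a * emeasure \<nu> (dball x r)"
      have "ennreal b * emeasure \<nu> (dball x r) = (\<integral>\<^sup>+y\<in>dball x r. ennreal b \<partial>\<nu>)" by (simp add: const)
      also have "\<dots> \<le> (\<integral>\<^sup>+y\<in>dball x r. (f y + ?h y) \<partial>\<nu>)"
        by (intro nn_integral_mono mult_right_mono)
           (auto intro: order_trans[OF le_add_diff])
      also have "\<dots> = emeasure (density \<nu> f) (dball x r) + (\<integral>\<^sup>+y\<in>dball x r. ?h y \<partial>\<nu>)"
        by (subst add) (simp_all add: em h)
      also have "\<dots> \<le> ennreal a * emeasure \<nu> (dball x r) + (\<integral>\<^sup>+y\<in>dball x r. ?h y \<partial>\<nu>)"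
        by (intro add_right_mono r)
      finally show "ennreal b * emeasure \<nu> (dball x r)
        \<le> ennreal a * emeasure \<nu> (dball x r) + (\<integral>\<^sup>+y\<in>dball x r. ?h y \<partial>\<nu>)" .
    qed
  qed
qed

text \<open>
  If the quotients at \<open>x\<close> do not converge to \<open>f x\<close>, then \<open>x\<close> lies in one of the exceptional sets of
  \<open>local_comparison_null\<close> for some rational \<open>a < b\<close>.
\<close>

lemma local_differentiation:
  assumes cone: "cone_bounded d W r0 m" and r0: "0 < r0" and K: "compact K" "W \<subseteq> K" and W: "open W"
    and sets: "sets \<nu> = sets borel" and f: "f \<in> borel_measurable borel"
    and fin: "emeasure \<nu> W < \<infinity>" "emeasure (density \<nu> f) W < \<infinity>"
  shows "\<exists>N\<in>null_sets \<nu>. \<forall>x\<in>W - N. (\<forall>r>0. emeasure \<nu> (dball x r) \<noteq> 0) \<longrightarrow>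
    ((\<lambda>r. emeasure (density \<nu> f) (dball x r) / emeasure \<nu> (dball x r)) \<longlongrightarrow> f x) (at_right 0)"
proof -
  define P where "P = {p::rat \<times> rat. 0 \<le> fst p \<and> fst p < snd p}"
  have P: "0 \<le> (of_rat (fst p) :: real)" "(of_rat (fst p) :: real) < of_rat (snd p)" if "p \<in> P" for p
    using that by (simp_all add: P_def of_rat_less)
  define A1 where "A1 p = {x \<in> W. f x \<le> ennreal (of_rat (fst p)) \<and> (\<forall>\<rho>>0. \<exists>r. 0 < r \<and> r < \<rho> \<and>
      ennreal (of_rat (snd p)) * emeasure \<nu> (dball x r) \<le> emeasure (density \<nu> f) (dball x r))}" for p
  define A2 where "A2 p = {x \<in> W. ennreal (of_rat (snd p)) \<le> f x \<and> (\<forall>\<rho>>0. \<exists>r. 0 < r \<and> r < \<rho> \<and>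
      emeasure (density \<nu> f) (dball x r) \<le> ennreal (of_rat (fst p)) * emeasure \<nu> (dball x r))}" for p
  have "\<forall>p\<in>P. \<exists>N\<in>null_sets \<nu>. A1 p \<subseteq> N"
    unfolding A1_def using P by (intro ballI local_comparison_null(1)[OF cone r0 K W sets f fin])
  then obtain N1 where N1: "\<And>p. p \<in> P \<Longrightarrow> N1 p \<in> null_sets \<nu>" "\<And>p. p \<in> P \<Longrightarrow> A1 p \<subseteq> N1 p"
    by metis
  have "\<forall>p\<in>P. \<exists>N\<in>null_sets \<nu>. A2 p \<subseteq> N"
    unfolding A2_def using P by (intro ballI local_comparison_null(2)[OF cone r0 K W sets f fin])
  then obtain N2 where N2: "\<And>p. p \<in> P \<Longrightarrow> N2 p \<in> null_sets \<nu>" "\<And>p. p \<in> P \<Longrightarrow> A2 p \<subseteq> N2 p"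
    by metis
  define N where "N = (\<Union>p\<in>P. N1 p) \<union> (\<Union>p\<in>P. N2 p)"
  have "N \<in> null_sets \<nu>"
    unfolding N_def using N1(1) N2(1) by (intro null_sets.Un null_sets_UN') auto
  moreover have "((\<lambda>r. emeasure (density \<nu> f) (dball x r) / emeasure \<nu> (dball x r)) \<longlongrightarrow> f x) (at_right 0)"
    if x: "x \<in> W" "x \<notin> N" and pos: "\<And>r. 0 < r \<Longrightarrow> emeasure \<nu> (dball x r) \<noteq> 0" for x
  proof -
    define v where "v r = emeasure \<nu> (dball x r)" for r
    define w where "w r = emeasure (density \<nu> f) (dball x r)" for r
    obtain \<rho>' where \<rho>': "0 < \<rho>'" "\<And>r. r \<le> \<rho>' \<Longrightarrow> dball x r \<subseteq> W" using dball_small[OF W x(1)] by blast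
    have v: "0 < v r" "v r < \<infinity>" if "0 < r" "r < \<rho>'" for r
    proof -
      show "0 < v r" using pos[OF that(1)] by (simp add: v_def zero_less_iff_neq_zero)
      have "v r \<le> emeasure \<nu> W"
        unfolding v_def using \<rho>'(2)[of r] that W by (intro emeasure_mono) (auto simp: sets)
      then show "v r < \<infinity>" using fin(1) by (rule order_le_less_trans)
    qed
    \<comment> \<open>an inequality that fails eventually holds for arbitrarily small radii\<close>
    have freq: "\<forall>\<rho>>0. \<exists>r. 0 < r \<and> r < \<rho> \<and> r < \<rho>' \<and> \<not> Q r"
      if "\<not> eventually Q (at_right 0)" for Q :: "real \<Rightarrow> bool"
    proof (intro allI impI)
      fix \<rho> :: real assume "0 < \<rho>"
      then have "0 < min \<rho> \<rho>'" using \<rho>'(1) by simp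
      then show "\<exists>r. 0 < r \<and> r < \<rho> \<and> r < \<rho>' \<and> \<not> Q r"
        using that unfolding eventually_at_right_field by (metis min_less_iff_conj)
    qed
    have "((\<lambda>r. w r / v r) \<longlongrightarrow> f x) (at_right 0)"
    proof (rule order_tendstoI)
      fix l assume "l < f x"
      then obtain b where b: "l < ennreal (of_rat b)" "ennreal (of_rat b) < f x"
        using ennreal_rat_dense by blast
      obtain a where a: "l < ennreal (of_rat a)" "ennreal (of_rat a) < ennreal (of_rat b)"
        using ennreal_rat_dense[OF b(1)] by blast
      have "0 < (of_rat a :: real)" using a(1) by (metis ennreal_neg not_less not_less_zero)
      moreover have "(of_rat a :: real) < of_rat b" using a(2) by (metis ennreal_leI not_less)
      ultimately have p: "(a, b) \<in> P" by (simp add: P_def of_rat_less)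
      show "\<forall>\<^sub>F r in at_right 0. l < w r / v r"
      proof (rule ccontr)
        assume "\<not> ?thesis"
        note fr = freq[OF this]
        have "\<exists>r. 0 < r \<and> r < \<rho> \<and> w r \<le> ennreal (of_rat a) * v r" if \<rho>: "0 < \<rho>" for \<rho>
        proof -
          obtain r where r: "0 < r" "r < \<rho>" "r < \<rho>'" "\<not> l < w r / v r" using fr \<rho> by blast
          have "w r = (w r / v r) * v r"
            using v[OF r(1,3)] by (simp add: ennreal_divide_times mult_divide_eq_ennreal)
          also have "\<dots> \<le> ennreal (of_rat a) * v r" using r(4) a(1) by (intro mult_right_mono) auto
          finally show ?thesis using r by blast
        qed
        then have "x \<in> N2 (a, b)"
          using N2(2)[OF p] x(1) less_imp_le[OF b(2)] unfolding A2_def v_def w_def fst_conv snd_conv by blast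
        then show False using x(2) p by (auto simp: N_def)
      qed
    next
      fix l assume "f x < l"
      then obtain a where a: "f x < ennreal (of_rat a)" "ennreal (of_rat a) < l"
        using ennreal_rat_dense by blast
      obtain b where b: "ennreal (of_rat a) < ennreal (of_rat b)" "ennreal (of_rat b) < l"
        using ennreal_rat_dense[OF a(2)] by blast
      have "0 < (of_rat a :: real)" using a(1) by (metis ennreal_neg not_less not_less_zero)
      moreover have "(of_rat a :: real) < of_rat b" using b(1) by (metis ennreal_leI not_less)
      ultimately have p: "(a, b) \<in> P" by (simp add: P_def of_rat_less)
      show "\<forall>\<^sub>F r in at_right 0. w r / v r < l"
      proof (rule ccontr)
        assume "\<not> ?thesis"
        note fr = freq[OF this]
        have "\<exists>r. 0 < r \<and> r < \<rho> \<and> ennreal (of_rat b) * v r \<le> w r" if \<rho>: "0 < \<rho>" for \<rho>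
        proof -
          obtain r where r: "0 < r" "r < \<rho>" "r < \<rho>'" "\<not> w r / v r < l" using fr \<rho> by blast
          have "ennreal (of_rat b) * v r \<le> (w r / v r) * v r" using r(4) b(2) by (intro mult_right_mono) auto
          also have "\<dots> = w r"
            using v[OF r(1,3)] by (simp add: ennreal_divide_times mult_divide_eq_ennreal)
          finally show ?thesis using r by blast
        qed
        then have "x \<in> N1 (a, b)"
          using N1(2)[OF p] x(1) less_imp_le[OF a(1)] unfolding A1_def v_def w_def fst_conv snd_conv by blast
        then show False using x(2) p by (auto simp: N_def)
      qed
    qed
    then show ?thesis by (simp add: v_def w_def)
  qed
  ultimately show ?thesis by blast
qed

text \<open>
  By the Lindeloef property, the union of all open null sets is a null set.
\<close>

lemma support_conull:
  assumes sets: "sets \<nu> = sets borel"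
  shows "\<exists>N\<in>null_sets \<nu>. \<forall>x. x \<notin> N \<longrightarrow> (\<forall>r>0. emeasure \<nu> (dball x r) \<noteq> 0)"
proof -
  define F where "F = {U::'a set. open U \<and> emeasure \<nu> U = 0}"
  obtain F' where F': "F' \<subseteq> F" "countable F'" "\<Union>F' = \<Union>F"
    by (rule Lindelof[of F]) (auto simp: F_def)
  have "(\<Union>U\<in>F'. U) \<in> null_sets \<nu>"
    using F' by (intro null_sets_UN') (auto simp: F_def null_sets_def sets)
  moreover have "x \<in> (\<Union>U\<in>F'. U)" if "0 < r" "emeasure \<nu> (dball x r) = 0" for x r
  proof -
    have "dball x r \<in> F" using that(2) open_dball by (simp add: F_def dball_def)
    moreover have "x \<in> dball x r" using that(1) by (simp add: dball_def dist_self)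
    ultimately show ?thesis using F'(3) by auto
  qed
  ultimately show ?thesis by blast
qed

lemma sigma_finite_of_locally_finite:
  assumes lf: "locally_finite_borel_measure (\<nu> :: 'a measure)"
  shows "sigma_finite_measure \<nu>"
proof
  define F where "F = {U::'a set. open U \<and> emeasure \<nu> U < \<infinity>}"
  have sets: "sets \<nu> = sets borel" using lf by (simp add: locally_finite_borel_measure_def)
  obtain F' where F': "F' \<subseteq> F" "countable F'" "\<Union>F' = \<Union>F"
    by (rule Lindelof[of F]) (auto simp: F_def)
  have "x \<in> \<Union>F" for x
  proof -
    obtain U where "open U" "x \<in> U" "emeasure \<nu> U < \<infinity>"
      using lf unfolding locally_finite_borel_measure_def by meson
    then show ?thesis unfolding F_def by blast
  qed
  then have "\<Union>F = UNIV" by blast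
  then show "\<exists>A. countable A \<and> A \<subseteq> sets \<nu> \<and> \<Union>A = space \<nu> \<and> (\<forall>a\<in>A. emeasure \<nu> a \<noteq> \<infinity>)"
  proof (intro exI conjI ballI)
    show "countable F'" by (rule F'(2))
    show "F' \<subseteq> sets \<nu>"
    proof
      fix U assume "U \<in> F'"
      then have "open U" using F'(1) unfolding F_def by blast
      then show "U \<in> sets \<nu>" by (simp add: sets)
    qed
    show "\<Union>F' = space \<nu>" using F'(3) \<open>\<Union>F = UNIV\<close> sets_eq_imp_space_eq[OF sets] by simp
    show "emeasure \<nu> a \<noteq> \<infinity>" if "a \<in> F'" for a using F'(1) that unfolding F_def by auto
  qed
qed

theorem differentiation:
  assumes cones: "\<And>p. \<exists>W K r0 m. open W \<and> p \<in> W \<and> W \<subseteq> K \<and> compact K \<and> 0 < r0 \<and> cone_bounded d W r0 m"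
    and lf: "locally_finite_borel_measure \<nu>1" "locally_finite_borel_measure \<nu>2"
    and ac: "absolutely_continuous \<nu>1 \<nu>2"
  obtains f N where "f \<in> borel_measurable borel" "density \<nu>1 f = \<nu>2" "N \<in> null_sets \<nu>1"
    "\<And>x. x \<notin> N \<Longrightarrow> f x < \<infinity>" "\<And>x r. x \<notin> N \<Longrightarrow> 0 < r \<Longrightarrow> emeasure \<nu>1 (dball x r) \<noteq> 0"
    "\<And>x. x \<notin> N \<Longrightarrow> ((\<lambda>r. emeasure \<nu>2 (dball x r) / emeasure \<nu>1 (dball x r)) \<longlongrightarrow> f x) (at_right 0)"
proof -
  have sets: "sets \<nu>1 = sets borel" "sets \<nu>2 = sets borel"
    using lf by (auto simp: locally_finite_borel_measure_def)
  interpret \<nu>1: sigma_finite_measure \<nu>1 by (rule sigma_finite_of_locally_finite[OF lf(1)])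
  define f where "f = RN_deriv \<nu>1 \<nu>2"
  have f: "f \<in> borel_measurable borel"
    unfolding f_def using borel_measurable_RN_deriv[of \<nu>1 \<nu>2] by (simp add: measurable_cong_sets[OF sets(1) refl])
  have dens: "density \<nu>1 f = \<nu>2" unfolding f_def by (rule \<nu>1.density_RN_deriv[OF ac]) (simp add: sets)
  have AE_f: "AE x in \<nu>1. f x \<noteq> \<infinity>"
    unfolding f_def by (rule \<nu>1.RN_deriv_finite[OF sigma_finite_of_locally_finite[OF lf(2)] ac]) (simp add: sets)
  obtain Nf where Nf: "{x \<in> space \<nu>1. f x = \<infinity>} \<subseteq> Nf" "Nf \<in> null_sets \<nu>1"
    using AE_f unfolding eventually_ae_filter by auto
  have space: "space \<nu>1 = UNIV" using sets_eq_imp_space_eq[OF sets(1)] by simp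
  from support_conull[OF sets(1)] obtain Ns where Ns: "Ns \<in> null_sets \<nu>1"
    "\<forall>x. x \<notin> Ns \<longrightarrow> (\<forall>r>0. emeasure \<nu>1 (dball x r) \<noteq> 0)" by (elim bexE)
  define G where "G W N \<longleftrightarrow> N \<in> null_sets \<nu>1 \<and> (\<forall>x\<in>W - N. (\<forall>r>0. emeasure \<nu>1 (dball x r) \<noteq> 0) \<longrightarrow>
    ((\<lambda>r. emeasure \<nu>2 (dball x r) / emeasure \<nu>1 (dball x r)) \<longlongrightarrow> f x) (at_right 0))" for W N
  define F where "F = {W. open W \<and> (\<exists>N. G W N)}"
  have cover: "\<exists>W\<in>F. p \<in> W" for p
  proof -
    from cones[of p] obtain W K r0 m where W: "open W" "p \<in> W" "W \<subseteq> K" "compact K" "0 < r0"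
      "cone_bounded d W r0 m" by (elim exE conjE)
    obtain U1 where U1: "open U1" "p \<in> U1" "emeasure \<nu>1 U1 < \<infinity>"
      using lf(1) unfolding locally_finite_borel_measure_def by meson
    obtain U2 where U2: "open U2" "p \<in> U2" "emeasure \<nu>2 U2 < \<infinity>"
      using lf(2) unfolding locally_finite_borel_measure_def by meson
    define V where "V = W \<inter> U1 \<inter> U2"
    have V: "open V" "p \<in> V" "V \<subseteq> K" using W U1 U2 by (auto simp: V_def)
    have le: "emeasure \<nu>1 V \<le> emeasure \<nu>1 U1" "emeasure \<nu>2 V \<le> emeasure \<nu>2 U2"
      using U1(1) U2(1) by (auto intro!: emeasure_mono simp: V_def sets)
    have fin: "emeasure \<nu>1 V < \<infinity>" "emeasure (density \<nu>1 f) V < \<infinity>"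
      using order_le_less_trans[OF le(1) U1(3)] order_le_less_trans[OF le(2) U2(3)]
      unfolding dens by auto
    have cone: "cone_bounded d V r0 m" by (rule cone_bounded_subset[OF W(6)]) (auto simp: V_def)
    have "\<exists>N. G V N"
      using local_differentiation[OF cone W(5,4) V(3,1) sets(1) f fin] unfolding G_def dens by blast
    then show ?thesis using V unfolding F_def by blast
  qed
  obtain F' where F': "F' \<subseteq> F" "countable F'" "\<Union>F' = \<Union>F"
    by (rule Lindelof[of F]) (auto simp: F_def)
  define n where "n W = (SOME N. G W N)" for W
  have n: "G W (n W)" if "W \<in> F" for W
    using that unfolding F_def n_def by (auto intro: someI_ex)
  define N where "N = Nf \<union> Ns \<union> (\<Union>W\<in>F'. n W)"
  show ?thesis
  proof (rule that[OF f dens])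
    have "(\<Union>W\<in>F'. n W) \<in> null_sets \<nu>1"
      using F' n by (intro null_sets_UN') (auto simp: G_def)
    then show "N \<in> null_sets \<nu>1" using Nf(2) Ns(1) unfolding N_def by (intro null_sets.Un)
    show "f x < \<infinity>" if "x \<notin> N" for x
    proof -
      have "f x \<noteq> \<infinity>" using Nf(1) that unfolding N_def space by blast
      then show ?thesis by (simp add: top.not_eq_extremum)
    qed
    show pos: "emeasure \<nu>1 (dball x r) \<noteq> 0" if "x \<notin> N" "0 < r" for x r
      using Ns(2) that unfolding N_def by blast
    show "((\<lambda>r. emeasure \<nu>2 (dball x r) / emeasure \<nu>1 (dball x r)) \<longlongrightarrow> f x) (at_right 0)"
      if x: "x \<notin> N" for x
    proof -
      obtain W where W: "W \<in> F'" "x \<in> W" using cover[of x] F'(3) by blast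
      then have "G W (n W)" using n F' by blast
      moreover have "x \<notin> n W" using x W(1) unfolding N_def by blast
      ultimately show ?thesis using W(2) pos[OF x] unfolding G_def by blast
    qed
  qed
qed

end

section \<open>Directions in a nearly Euclidean metric\<close>

lemma norm_sgn_diff_le:
  fixes a b :: "'e::real_normed_vector"
  assumes "a \<noteq> 0"
  shows "norm (sgn b - sgn a) \<le> 2 * norm (b - a) / norm a"
proof -
  have "norm a *\<^sub>R (sgn b - sgn a) = (norm a - norm b) *\<^sub>R sgn b + (b - a)"
    using assms by (cases "b = 0") (auto simp: sgn_div_norm algebra_simps)
  then have "norm a * norm (sgn b - sgn a) = norm ((norm a - norm b) *\<^sub>R sgn b + (b - a))"
    by (metis abs_norm_cancel norm_scaleR)
  also have "\<dots> \<le> \<bar>norm a - norm b\<bar> * norm (sgn b) + norm (b - a)"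
    by (metis norm_scaleR norm_triangle_ineq)
  also have "\<bar>norm a - norm b\<bar> * norm (sgn b) \<le> \<bar>norm a - norm b\<bar> * 1"
    by (intro mult_left_mono) (auto simp: norm_sgn)
  also have "\<bar>norm a - norm b\<bar> \<le> norm (b - a)"
    by (metis norm_minus_commute norm_triangle_ineq3)
  finally show ?thesis
    using assms by (simp add: field_simps)
qed

text \<open>
  For an exact midpoint in Euclidean space \<open>b = a / 2\<close>. The parallelogram law bounds the square of
  \<open>b - a / 2\<close> by the errors in the three lengths, so errors of relative size \<open>e\<close> tilt the direction by
  at most a multiple of \<open>sqrt e\<close>.
\<close>

lemma midpoint_direction:
  fixes a b :: "'e::real_inner"
  assumes R: "R > 0" and e: "0 \<le> e" "e \<le> 1/1000"
    and a: "R \<le> (1 + e) * norm a"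
    and b: "(1 - e) * norm b \<le> R/2"
    and c: "(1 - e) * norm (b - a) \<le> R/2 + e * R"
  shows "norm (sgn b - sgn a) \<le> 7 * sqrt e"
proof -
  have e2: "e * e \<le> e / 1000" using mult_left_mono[OF e(2) e(1)] by simp
  have inv: "t \<le> (1 + 2*e) * q" if "(1 - e) * t \<le> q" "0 \<le> t" for t q :: real
  proof -
    have "t * 1 \<le> t * ((1 + 2*e) * (1 - e))"
      using e e2 that by (intro mult_left_mono) (auto simp: algebra_simps)
    also have "\<dots> = (1 + 2*e) * ((1 - e) * t)" by simp
    also have "\<dots> \<le> (1 + 2*e) * q" using that e by (intro mult_left_mono) auto
    finally show ?thesis by simp
  qed
  have b': "norm b \<le> (R/2) * (1 + 2*e)" using inv[OF b] by (simp add: mult.commute)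
  have "norm (b - a) \<le> (1 + 2*e) * (R/2 + e * R)" using inv[OF c] by simp
  also have "\<dots> = (R/2) * (1 + 4*e + 4*(e*e))" by (simp add: algebra_simps)
  also have "\<dots> \<le> (R/2) * (1 + 5*e)" using e2 e R by (intro mult_left_mono) auto
  finally have c': "norm (b - a) \<le> (R/2) * (1 + 5*e)" .
  have "(1 - e) * R \<le> (1 - e) * ((1 + e) * norm a)" using a e by (intro mult_left_mono) auto
  also have "\<dots> = norm a * (1 - e*e)" by (simp add: algebra_simps)
  also have "\<dots> \<le> norm a * 1" by (intro mult_left_mono) auto
  finally have a': "R * (1 - e) \<le> norm a" by (simp add: mult.commute)
  have apos: "norm a > 0" using a' R e mult_pos_pos[of R "1 - e"] by linarith
  have "(norm (b - a /\<^sub>R 2))\<^sup>2 = (norm b)\<^sup>2 / 2 + (norm (b - a))\<^sup>2 / 2 - (norm a)\<^sup>2 / 4"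
    by (simp add: power2_norm_eq_inner inner_diff_left inner_diff_right inner_commute field_simps)
  also have "\<dots> \<le> ((R/2) * (1 + 2*e))\<^sup>2 / 2 + ((R/2) * (1 + 5*e))\<^sup>2 / 2 - (R * (1 - e))\<^sup>2 / 4"
    using a' b' c' R e by (intro diff_mono add_mono divide_right_mono power_mono) auto
  also have "\<dots> = R\<^sup>2 / 8 * (18*e + 27*(e*e))" by (simp add: power2_eq_square field_simps)
  also have "\<dots> \<le> R\<^sup>2 / 8 * (19*e)" using e2 e by (intro mult_left_mono) auto
  finally have sq: "(norm (b - a /\<^sub>R 2))\<^sup>2 \<le> R\<^sup>2 / 8 * (19*e)" .
  have "(R * (1.6 * sqrt e))\<^sup>2 = R\<^sup>2 * ((1.6)\<^sup>2 * e)"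
    using e by (simp only: power_mult_distrib real_sqrt_pow2)
  also have "\<dots> = R\<^sup>2 / 8 * (20.48 * e)" by (simp add: power2_eq_square)
  finally have "(R * (1.6 * sqrt e))\<^sup>2 = R\<^sup>2 / 8 * (20.48 * e)" .
  moreover have "R\<^sup>2 / 8 * (19*e) \<le> R\<^sup>2 / 8 * (20.48 * e)"
    using e by (intro mult_left_mono) auto
  ultimately have "R\<^sup>2 / 8 * (19*e) \<le> (R * (1.6 * sqrt e))\<^sup>2" by linarith
  with sq have "(norm (b - a /\<^sub>R 2))\<^sup>2 \<le> (R * (1.6 * sqrt e))\<^sup>2" by linarith
  then have half: "norm (b - a /\<^sub>R 2) \<le> R * (1.6 * sqrt e)"
    using R e by (elim power2_le_imp_le) simp
  have "norm (sgn b - sgn a) = norm (sgn b - sgn (a /\<^sub>R 2))" by (simp add: sgn_scaleR)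
  also have "\<dots> \<le> 2 * norm (b - a /\<^sub>R 2) / norm (a /\<^sub>R 2)" using apos by (intro norm_sgn_diff_le) auto
  also have "\<dots> = 4 * norm (b - a /\<^sub>R 2) / norm a" by simp
  also have "\<dots> \<le> 4 * (R * (1.6 * sqrt e)) / (R * (1 - e))"
    using half a' R e apos by (intro frac_le mult_left_mono) (auto intro: mult_nonneg_nonneg)
  also have "4 * (R * (1.6 * sqrt e)) = R * (6.4 * sqrt e)" by simp
  also have "R * (6.4 * sqrt e) / (R * (1 - e)) = 6.4 * sqrt e / (1 - e)"
    using R by (intro mult_divide_mult_cancel_left) simp
  also have "\<dots> \<le> 7 * sqrt e"
  proof -
    have "6.4 * sqrt e \<le> (7 * (1 - e)) * sqrt e" using e by (intro mult_right_mono) auto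
    then show ?thesis using e by (simp add: field_simps)
  qed
  finally show ?thesis .
qed

text \<open>
  The proof descends from \<open>x\<close> by replacing it with an approximate midpoint of \<open>z\<close> and \<open>x\<close>, until its
  distance from \<open>z\<close> is comparable to that of \<open>w\<close>. Then \<open>near\<close> decides. Each step costs in length
  only the inaccuracy of the midpoint; what must be controlled is the accumulated change of direction. The
  budget \<open>28 * sqrt (C * D z x)\<close> absorbs it: the change is at most \<open>7 * sqrt (C * D z x)\<close>, and the budget
  at half the distance is at most \<open>3/4\<close> of the old one.
\<close>

lemma same_direction_closer:
  fixes D :: "'a \<Rightarrow> 'a \<Rightarrow> real" and u :: "'a \<Rightarrow> 'e::real_inner"
  assumes C: "0 < C" "C * r \<le> 1/10^6"
    and X: "z \<in> X" "\<And>x. x \<in> X \<Longrightarrow> D z x < r"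
    and Dz: "D z z = 0" "u z = 0"
    and nonneg: "\<And>x y. x \<in> X \<Longrightarrow> y \<in> X \<Longrightarrow> 0 \<le> D x y"
    and sym: "\<And>x y. x \<in> X \<Longrightarrow> y \<in> X \<Longrightarrow> D x y = D y x"
    and tri: "\<And>x y w. x \<in> X \<Longrightarrow> y \<in> X \<Longrightarrow> w \<in> X \<Longrightarrow> D x w \<le> D x y + D y w"
    and near: "\<And>s x y. x \<in> X \<Longrightarrow> y \<in> X \<Longrightarrow> 0 < s \<Longrightarrow> s < r \<Longrightarrow> D z x \<le> s \<Longrightarrow> D z y \<le> s \<Longrightarrow>
        \<bar>D x y - norm (u x - u y)\<bar> \<le> C * s * norm (u x - u y)"
    and mid: "\<And>x \<delta>. x \<in> X \<Longrightarrow> 0 < \<delta> \<Longrightarrow> \<exists>y\<in>X. D z y \<le> D z x / 2 \<and> D y x \<le> D z x / 2 + \<delta>"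
    and x: "x \<in> X" and w: "w \<in> X" and le: "D z w \<le> D z x" and pos: "0 < D z w"
    and dir: "norm (sgn (u w) - sgn (u x)) \<le> 1/16"
  shows "D x w \<le> D z x - D z w / 2"
proof -
  have eps: "C * D z x \<le> 1/10^6" "0 \<le> C * D z x" if "x \<in> X" for x
  proof -
    have "C * D z x \<le> C * r" using X(2)[OF that] C by (intro mult_left_mono) auto
    then show "C * D z x \<le> 1/10^6" using C(2) by linarith
    show "0 \<le> C * D z x" using nonneg[OF X(1) that] C by simp
  qed
  have norm_u: "\<bar>D z x - norm (u x)\<bar> \<le> C * D z x * norm (u x)" if "x \<in> X" "0 < D z x" for x
    using near[of z x "D z x"] that X Dz by simp
  have base: "D w x \<le> D z x - D z w / 2"
    if "x \<in> X" "D z w \<le> D z x" "D z x \<le> 4 * D z w" "norm (sgn (u w) - sgn (u x)) \<le> 1/8" for x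
  proof -
    have xpos: "0 < D z x" using that(2) pos by simp
    have small: "C * D z x * t \<le> t / 10^6" if "0 \<le> t" for t
      using mult_right_mono[OF eps(1)[OF \<open>x \<in> X\<close>] that] by simp
    have "\<bar>D z x - norm (u x)\<bar> \<le> norm (u x) / 10^6"
      using norm_u[OF \<open>x \<in> X\<close> xpos] small[of "norm (u x)"] by simp
    moreover have "\<bar>D z w - norm (u w)\<bar> \<le> norm (u w) / 10^6"
      using norm_u[OF w pos] mult_right_mono[OF eps(1)[OF w], of "norm (u w)"] by simp
    moreover have "D w x \<le> norm (u w - u x) + norm (u w - u x) / 10^6"
      using near[OF w \<open>x \<in> X\<close> xpos X(2)[OF \<open>x \<in> X\<close>] \<open>D z w \<le> D z x\<close> order_refl]
        small[of "norm (u w - u x)"] by simp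
    moreover have "norm (u w - u x) \<le> norm (u w) / 8 + \<bar>norm (u w) - norm (u x)\<bar>"
    proof -
      have "u w - u x = norm (u w) *\<^sub>R (sgn (u w) - sgn (u x))
          + (norm (u w) - norm (u x)) *\<^sub>R sgn (u x)"
        by (cases "u w = 0"; cases "u x = 0") (auto simp: sgn_div_norm algebra_simps)
      then have "norm (u w - u x) \<le> norm (norm (u w) *\<^sub>R (sgn (u w) - sgn (u x)))
          + norm ((norm (u w) - norm (u x)) *\<^sub>R sgn (u x))"
        by (metis norm_triangle_ineq)
      also have "\<dots> \<le> norm (u w) * (1/8) + \<bar>norm (u w) - norm (u x)\<bar> * 1"
        unfolding norm_scaleR abs_norm_cancel
        using that(4) by (intro add_mono mult_left_mono) (auto simp: norm_sgn)
      finally show ?thesis by simp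
    qed
    ultimately show ?thesis
      using that(2,3) pos by (auto simp: abs_if field_simps split: if_splits)
  qed
  have step: "D w x \<le> D z x - D z w / 2 + \<delta>"
    if "x \<in> X" "D z w \<le> D z x" "D z x \<le> 4 * 2^n * D z w"
      "norm (sgn (u w) - sgn (u x)) + 28 * sqrt (C * D z x) \<le> 1/8" "\<delta> > 0" for n x \<delta>
    using that
  proof (induction n arbitrary: x \<delta>)
    case 0
    have "0 \<le> sqrt (C * D z x)" using eps[OF \<open>x \<in> X\<close>] by simp
    then have "norm (sgn (u w) - sgn (u x)) \<le> 1/8" using 0(4) by linarith
    then show ?case using base[OF 0(1,2)] 0(3,5) by simp
  next
    case (Suc n)
    have sqrt0: "0 \<le> sqrt (C * D z x)" using eps[OF \<open>x \<in> X\<close>] by simp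
    show ?case
    proof (cases "D z x \<le> 4 * D z w")
      case True
      have "norm (sgn (u w) - sgn (u x)) \<le> 1/8" using sqrt0 Suc.prems(4) by linarith
      then show ?thesis using base[OF Suc.prems(1,2) True] Suc.prems(5) by simp
    next
      case False
      define R where "R = D z x"
      define e where "e = C * R"
      have e: "0 \<le> e" "e \<le> 1/10^6" using eps Suc.prems by (auto simp: e_def R_def)
      have R: "R > 4 * D z w" "R > 0" using False pos by (auto simp: R_def)
        have "e > 0" using C R by (simp add: e_def)
        \<comment> \<open>half of \<open>\<delta>\<close> is left for the later steps; the other bounds keep the midpoint
        accurate and farther from \<open>z\<close> than \<open>w\<close>\<close>
      define \<eta> where "\<eta> = min (\<delta>/2) (min (e * R) (R/4))"
        have \<eta>: "0 < \<eta>" "\<eta> \<le> \<delta>/2" "\<eta> \<le> e * R" "\<eta> \<le> R/4"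
          using \<open>e > 0\<close> R Suc.prems by (auto simp: \<eta>_def)
        obtain y where y: "y \<in> X" "D z y \<le> R/2" "D y x \<le> R/2 + \<eta>"
          using mid[OF \<open>x \<in> X\<close> \<eta>(1)] by (auto simp: R_def)
        have "R \<le> D z y + D y x" using tri[OF X(1) y(1) \<open>x \<in> X\<close>] by (simp add: R_def)
        then have ylow: "D z y \<ge> R/4" using y \<eta> by simp
        have R_r: "R < r" using X(2)[OF \<open>x \<in> X\<close>] by (simp add: R_def)
        have "norm (sgn (u y) - sgn (u x)) \<le> 7 * sqrt e"
        proof (rule midpoint_direction[OF R(2)])
          show "R \<le> (1 + e) * norm (u x)"
            using norm_u[OF \<open>x \<in> X\<close>] R(2) by (simp add: e_def R_def algebra_simps)
          show "(1 - e) * norm (u y) \<le> R/2"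
            using near[OF X(1) y(1) R(2) R_r] X Dz y R by (simp add: e_def algebra_simps)
          show "(1 - e) * norm (u y - u x) \<le> R/2 + e * R"
            using near[OF y(1) \<open>x \<in> X\<close> R(2) R_r] y \<eta> R by (simp add: e_def R_def algebra_simps)
        qed (use e in auto)
        moreover have "sqrt (C * D z y) \<le> sqrt e / sqrt 2"
          using y(2) C mult_left_mono[OF y(2), of C]
          unfolding real_sqrt_divide[symmetric] real_sqrt_le_iff by (simp add: e_def)
        moreover have "sqrt e / sqrt 2 \<le> sqrt e * (3/4)"
        proof -
          have "1 / sqrt 2 \<le> (3/4 :: real)"
            by (rule power2_le_imp_le) (auto simp: power2_eq_square field_simps)
          then have "sqrt e * (1 / sqrt 2) \<le> sqrt e * (3/4)" using e by (intro mult_left_mono) auto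
          then show ?thesis by simp
        qed
        moreover have "norm (sgn (u w) - sgn (u y))
            \<le> norm (sgn (u w) - sgn (u x)) + norm (sgn (u y) - sgn (u x))"
          using dist_triangle2[of "sgn (u w)" "sgn (u y)" "sgn (u x)"] by (simp add: dist_norm)
        ultimately have "norm (sgn (u w) - sgn (u y)) + 28 * sqrt (C * D z y) \<le> 1/8"
          using Suc.prems(4) by (simp add: e_def R_def)
        moreover have "D z w \<le> D z y" using ylow R by simp
        moreover have "D z y \<le> 4 * 2^n * D z w" using y(2) Suc.prems(3) by (simp add: R_def)
        ultimately have "D w y \<le> D z y - D z w / 2 + \<delta>/2"
          using Suc.IH[of y "\<delta>/2"] y Suc.prems by simp
        moreover have "D w x \<le> D w y + D y x" by (rule tri[OF w y(1) \<open>x \<in> X\<close>])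
        ultimately show ?thesis using y \<eta> by (simp add: R_def)
    qed
  qed
  have "28 * sqrt (C * D z x) \<le> 1/16"
  proof -
    have "sqrt (C * D z x) \<le> sqrt ((1/10^3)\<^sup>2)"
      using eps[OF x] unfolding real_sqrt_le_iff by (simp add: power2_eq_square)
    then show ?thesis by simp
  qed
  moreover obtain n where "D z x / (4 * D z w) < 2^n"
    using real_arch_pow[of 2 "D z x / (4 * D z w)"] by auto
  then have "D z x \<le> 4 * 2^n * D z w" using pos by (simp add: field_simps)
  ultimately have "D w x \<le> D z x - D z w / 2 + \<delta>" if "\<delta> > 0" for \<delta>
    using step[OF x le] dir that by simp
  then show ?thesis
    using sym[OF x w] by (simp add: field_le_epsilon)
qed

section \<open>The metric tensor in a chart\<close>

text \<open>
  The Gram-Schmidt process, by induction on the dimension. It allows every metric norm to be treated as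
  the norm of the ambient Euclidean space.
\<close>

lemma inner_representation:
  fixes E :: "'e::euclidean_space set" and \<beta> :: "'e \<Rightarrow> 'e \<Rightarrow> real"
  assumes "bilinear \<beta>" and "subspace E"
    and "\<And>v w. v \<in> E \<Longrightarrow> w \<in> E \<Longrightarrow> \<beta> v w = \<beta> w v"
    and "\<And>v. v \<in> E \<Longrightarrow> v \<noteq> 0 \<Longrightarrow> 0 < \<beta> v v"
  shows "\<exists>T::'e \<Rightarrow> 'e. linear T \<and> (\<forall>v\<in>E. \<forall>w\<in>E. \<beta> v w = T v \<bullet> T w)"
  using assms(2-4)
proof (induction "dim E" arbitrary: E rule: less_induct)
  case less
  note b = bilinear_ladd[OF assms(1)] bilinear_radd[OF assms(1)] bilinear_lmul[OF assms(1)]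
    bilinear_rmul[OF assms(1)] bilinear_lzero[OF assms(1)] bilinear_rzero[OF assms(1)]
    bilinear_lsub[OF assms(1)] bilinear_rsub[OF assms(1)]
  show ?case
  proof (cases "E \<subseteq> {0}")
    case True
    have "\<beta> v w = 0 \<bullet> (0::'e)" if "v \<in> E" "w \<in> E" for v w
      using that True b(5)[of w] by auto
    moreover have "linear (\<lambda>_. 0 :: 'e)" by (simp add: linear_iff)
    ultimately show ?thesis by (intro exI[of _ "\<lambda>_. 0"]) simp
  next
    case False
    then obtain e0 where e0: "e0 \<in> E" "e0 \<noteq> 0" by blast
    define e where "e = (1 / sqrt (\<beta> e0 e0)) *\<^sub>R e0"
    have pos: "\<beta> e0 e0 > 0" using less.prems(3) e0 by blast
    have e: "e \<in> E" unfolding e_def using e0 less.prems(1) by (intro subspace_scale)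
    have bee: "\<beta> e e = 1" using pos by (simp add: e_def b)
    define E' where "E' = {v \<in> E. \<beta> v e = 0}"
    have E': "subspace E'"
      using less.prems(1) unfolding subspace_def E'_def by (auto simp: b)
    have "e \<notin> E'" using bee by (simp add: E'_def)
    then have "E' \<subset> E" using e unfolding E'_def by blast
    then have dim: "dim E' < dim E"
      using E' less.prems(1) by (intro dim_psubset) (simp add: span_eq_iff[THEN iffD2])
    obtain T' :: "'e \<Rightarrow> 'e" where T': "linear T'" "\<And>v w. v \<in> E' \<Longrightarrow> w \<in> E' \<Longrightarrow> \<beta> v w = T' v \<bullet> T' w"
      using less.hyps[OF dim E'] less.prems(2,3) by (auto simp: E'_def)
    have "dim (T' ` E') \<le> dim E'" by (rule dim_image_le[OF T'(1)])
    also note dim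
    also have "dim E \<le> DIM('e)" by (rule dim_subset_UNIV)
    finally obtain f0 where f0: "f0 \<noteq> 0" "\<And>y. y \<in> span (T' ` E') \<Longrightarrow> orthogonal f0 y"
      using orthogonal_to_subspace_exists by blast
    \<comment> \<open>the image of \<open>E'\<close> is a proper subspace, so there is room for the image of \<open>e\<close>\<close>
    define f where "f = f0 /\<^sub>R norm f0"
    have "norm f = 1" using f0(1) by (simp add: f_def)
    then have f1: "f \<bullet> f = 1" by (simp add: dot_square_norm)
    have f2: "T' v \<bullet> f = 0" if "v \<in> E'" for v
      using f0(2)[OF span_base[OF imageI[OF that]]] by (simp add: f_def orthogonal_def inner_commute)
    define P where "P v = v - \<beta> v e *\<^sub>R e" for v
    define T where "T v = T' (P v) + \<beta> v e *\<^sub>R f" for v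
    have P: "P v \<in> E'" if "v \<in> E" for v
      using that e bee less.prems(1) by (auto simp: P_def E'_def b intro: subspace_diff subspace_scale)
    have "linear P" unfolding P_def by (auto simp: linear_iff b algebra_simps)
    then have "linear (T' \<circ> P)" using T'(1) by (intro linear_compose)
    then have "linear T" unfolding T_def by (auto simp: linear_iff b algebra_simps)
    moreover have "\<beta> v w = T v \<bullet> T w" if "v \<in> E" "w \<in> E" for v w
    proof -
      have "\<beta> v w = \<beta> (P v + \<beta> v e *\<^sub>R e) (P w + \<beta> w e *\<^sub>R e)" by (simp add: P_def)
      also have "\<dots> = \<beta> (P v) (P w) + \<beta> w e * \<beta> (P v) e + \<beta> v e * \<beta> e (P w) + \<beta> v e * \<beta> w e"
        by (simp add: b bee algebra_simps del: P_def)
      also have "\<beta> (P v) e = 0" using P[OF that(1)] by (simp add: E'_def)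
      also have "\<beta> e (P w) = 0"
        using P[OF that(2)] less.prems(2)[OF e, of "P w"] by (simp add: E'_def)
      also have "\<beta> (P v) (P w) = T' (P v) \<bullet> T' (P w)" using T'(2) P that by blast
      finally show ?thesis
        using f1 f2[OF P[OF that(1)]] f2[OF P[OF that(2)]] by (simp add: T_def inner_add_left inner_add_right inner_commute)
    qed
    ultimately show ?thesis by blast
  qed
qed

text \<open>
  On \<open>K\<close> the derivatives in the directions of an orthonormal basis of \<open>E\<close> are bounded; apply the mean
  value theorem along segments. Only directions in \<open>E\<close> are used, as derivatives within \<open>V\<close> are
  determined only there.
\<close>

lemma C1_lipschitz:
  fixes E :: "'e::euclidean_space set" and f :: "'e \<Rightarrow> real"
  assumes E: "subspace E" and C1: "Ck_on 1 E V f" and K: "compact K" "convex K" "K \<subseteq> V" "K \<subseteq> E"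
  shows "\<exists>L\<ge>0. \<forall>x\<in>K. \<forall>y\<in>K. \<bar>f x - f y\<bar> \<le> L * norm (x - y)"
proof -
  obtain B where B: "B \<subseteq> E" "pairwise orthogonal B" "\<And>b. b \<in> B \<Longrightarrow> norm b = 1" "independent B" "span B = E"
    using orthonormal_basis_subspace[OF E] by metis
  have finB: "finite B" using B(4) by (rule independent_imp_finite)
  define D where "D x = frechet_derivative f (at x within V)" for x
  have deriv: "(f has_derivative D x) (at x within V)" if "x \<in> V" for x
    using C1 that by (simp add: D_def frechet_derivative_works[symmetric])
  have contD: "continuous_on V (\<lambda>x. D x b)" if "b \<in> E" for b
    using C1 that by (simp add: D_def)
  have "\<exists>M. \<forall>x\<in>K. \<bar>D x b\<bar> \<le> M" if "b \<in> B" for b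
  proof -
    have "continuous_on K (\<lambda>x. D x b)" using contD[of b] B(1) that K(3) continuous_on_subset by blast
    then have "bounded ((\<lambda>x. D x b) ` K)" using K(1) compact_continuous_image compact_imp_bounded by blast
    then show ?thesis by (auto simp: bounded_iff)
  qed
  then obtain M where M: "\<And>b x. b \<in> B \<Longrightarrow> x \<in> K \<Longrightarrow> \<bar>D x b\<bar> \<le> M b" by metis
  define L where "L = (\<Sum>b\<in>B. \<bar>M b\<bar>)"
  have "\<bar>f x - f y\<bar> \<le> L * norm (x - y)" if xy: "x \<in> K" "y \<in> K" for x y
  proof -
    define p where "p t = x + t *\<^sub>R (y - x)" for t :: real
    have p: "p t \<in> K" if "t \<in> {0..1}" for t
      using convexD[OF K(2) xy, of "1 - t" t] that by (simp add: p_def algebra_simps)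
    have pV: "p ` {0..1} \<subseteq> V" using p K(3) by blast
    have deriv_p: "((f \<circ> p) has_derivative (\<lambda>h. D (p t) (h *\<^sub>R (y - x)))) (at t within {0..1})"
      if t: "0 \<le> t" "t \<le> 1" for t
    proof -
      have "((\<lambda>t. x + t *\<^sub>R (y - x)) has_derivative (\<lambda>h. 0 + h *\<^sub>R (y - x))) (at t within {0..1})"
        by (rule has_derivative_add[OF has_derivative_const[of x]
              has_derivative_scaleR_left[OF has_derivative_ident]])
      then have 1: "(p has_derivative (\<lambda>h. h *\<^sub>R (y - x))) (at t within {0..1})"
        unfolding p_def[abs_def] by simp
      have "p t \<in> V" using pV t by auto
      then have 2: "(f has_derivative D (p t)) (at (p t) within p ` {0..1})"
        using has_derivative_subset[OF deriv pV] by blast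
      show ?thesis using diff_chain_within[OF 1 2] by (simp add: o_def)
    qed
    have "\<exists>t\<in>{0<..<1}. (f \<circ> p) 1 - (f \<circ> p) 0 = D (p t) ((1 - 0) *\<^sub>R (y - x))"
      by (rule mvt_simple[OF zero_less_one deriv_p])
    then obtain t where t: "t \<in> {0<..<1}" "(f \<circ> p) 1 - (f \<circ> p) 0 = D (p t) (y - x)" by auto
    have pt: "p t \<in> K" using p t(1) by simp
    have lin: "linear (D (p t))" using has_derivative_linear[OF deriv] pt K(3) by blast
    have "y - x \<in> E" using xy K(4) E by (auto intro: subspace_diff)
    then have "y - x = (\<Sum>b\<in>B. ((y - x) \<bullet> b) *\<^sub>R b)"
      using orthonormal_basis_expand[OF B(2,3) _ finB, of "y - x"] B(5) by simp
    then have "D (p t) (y - x) = D (p t) (\<Sum>b\<in>B. ((y - x) \<bullet> b) *\<^sub>R b)" by (rule arg_cong)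
    also have "\<dots> = (\<Sum>b\<in>B. ((y - x) \<bullet> b) * D (p t) b)"
      by (simp add: linear_sum[OF lin] linear_scale[OF lin])
    also have "\<bar>\<dots>\<bar> \<le> (\<Sum>b\<in>B. norm (y - x) * \<bar>M b\<bar>)"
    proof (rule order_trans[OF sum_abs sum_mono])
      fix b assume b: "b \<in> B"
      have "\<bar>(y - x) \<bullet> b\<bar> \<le> norm (y - x)" using Cauchy_Schwarz_ineq2[of "y - x" b] B(3)[OF b] by simp
      moreover have "\<bar>D (p t) b\<bar> \<le> \<bar>M b\<bar>" using M[OF b pt] by linarith
      ultimately show "\<bar>(y - x) \<bullet> b * D (p t) b\<bar> \<le> norm (y - x) * \<bar>M b\<bar>"
        unfolding abs_mult by (intro mult_mono) auto
    qed
    also have "\<dots> = L * norm (x - y)" by (simp add: L_def sum_distrib_left[symmetric] norm_minus_commute)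
    finally show ?thesis using t(2) by (simp add: p_def abs_minus_commute)
  qed
  moreover have "0 \<le> L" by (simp add: L_def sum_nonneg)
  ultimately show ?thesis by blast
qed

context smooth_manifold
begin

lemma chart_inverse:
  assumes "c \<in> A"
  shows "p \<in> fst c \<Longrightarrow> inv_into (fst c) (snd c) (snd c p) = p"
    and "p \<in> fst c \<Longrightarrow> snd c p \<in> E"
    and "x \<in> snd c ` fst c \<Longrightarrow> inv_into (fst c) (snd c) x \<in> fst c"
    and "x \<in> snd c ` fst c \<Longrightarrow> snd c (inv_into (fst c) (snd c) x) = x"
    and "continuous_on (fst c) (snd c)"
    and "continuous_on (snd c ` fst c) (inv_into (fst c) (snd c))"
  using homeomorphism_chart[OF assms] openin_imp_subset[OF openin_chart_image[OF assms]]
  unfolding homeomorphism_def by auto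

lemma orthonormal_model_basis:
  obtains B where "finite B" "B \<subseteq> E" "\<And>v. v \<in> E \<Longrightarrow> (\<Sum>b\<in>B. (v \<bullet> b) *\<^sub>R b) = v"
proof -
  obtain B where B: "B \<subseteq> E" "pairwise orthogonal B" "\<And>b. b \<in> B \<Longrightarrow> norm b = 1" "independent B" "span B = E"
    using orthonormal_basis_subspace[OF subspace_model] by metis
  have "finite B" using B(4) by (rule independent_imp_finite)
  then show ?thesis using that[of B] orthonormal_basis_expand[OF B(2,3)] B(1,5) by simp
qed

lemma chart_cball:
  assumes "c \<in> A" "p \<in> fst c"
  obtains R where "0 < R" "cball (snd c p) R \<inter> E \<subseteq> snd c ` fst c"
proof -
  obtain O' where O': "open O'" "snd c ` fst c = E \<inter> O'"
    using openin_chart_image[OF assms(1)] unfolding openin_open by blast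
  then have "snd c p \<in> O'" using assms(2) by blast
  then obtain R where "0 < R" "cball (snd c p) R \<subseteq> O'" using O'(1) open_contains_cball by blast
  then show ?thesis using that[of R] O'(2) by blast
qed

end

context riemannian_manifold
begin

definition metric_norm :: "('a, 'e) chart \<Rightarrow> 'e \<Rightarrow> 'e \<Rightarrow> real" where
  "metric_norm c x v = sqrt (g c (inv_into (fst c) (snd c) x) v v)"

lemma metric_norm_representation:
  assumes "c \<in> A" "x \<in> snd c ` fst c"
  shows "\<exists>T::'e \<Rightarrow> 'e. linear T \<and> (\<forall>v\<in>E. metric_norm c x v = norm (T v))"
proof -
  let ?p = "inv_into (fst c) (snd c) x"
  have p: "?p \<in> fst c" by (rule chart_inverse(3)[OF assms])
  obtain T :: "'e \<Rightarrow> 'e" where T: "linear T" "\<forall>v\<in>E. \<forall>w\<in>E. g c ?p v w = T v \<bullet> T w"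
    using inner_representation[OF metric_bilinear[OF assms(1) p] subspace_model
        metric_sym[OF assms(1) p] metric_pos_def[OF assms(1) p]] by blast
  have "metric_norm c x v = norm (T v)" if "v \<in> E" for v
    using T(2) that by (simp add: metric_norm_def norm_eq_sqrt_inner)
  then show ?thesis using T(1) by blast
qed

lemma metric_expand:
  assumes "c \<in> A" "p \<in> fst c" "v \<in> E" "w \<in> E"
    and "\<And>v. v \<in> E \<Longrightarrow> (\<Sum>b\<in>B. (v \<bullet> b) *\<^sub>R b) = v"
  shows "g c p v w = (\<Sum>(i,j)\<in>B \<times> B. (v \<bullet> i) * (w \<bullet> j) * g c p i j)"
proof -
  note bil = metric_bilinear[OF assms(1,2)]
  have "g c p v w = g c p (\<Sum>b\<in>B. (v \<bullet> b) *\<^sub>R b) (\<Sum>b\<in>B. (w \<bullet> b) *\<^sub>R b)" using assms(3-5) by simp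
  also have "\<dots> = (\<Sum>(i,j)\<in>B \<times> B. g c p ((v \<bullet> i) *\<^sub>R i) ((w \<bullet> j) *\<^sub>R j))"
    by (rule bilinear_sum[OF bil])
  also have "\<dots> = (\<Sum>(i,j)\<in>B \<times> B. (v \<bullet> i) * (w \<bullet> j) * g c p i j)"
    by (intro sum.cong) (auto simp: bilinear_lmul[OF bil] bilinear_rmul[OF bil])
  finally show ?thesis .
qed

lemma metric_continuous:
  assumes c: "c \<in> A" and q: "continuous_on S q" "q ` S \<subseteq> snd c ` fst c"
    and v: "continuous_on S v" "v ` S \<subseteq> E"
  shows "continuous_on S (\<lambda>s. metric_norm c (q s) (v s))"
proof -
  obtain B where B: "finite B" "B \<subseteq> E" "\<And>v. v \<in> E \<Longrightarrow> (\<Sum>b\<in>B. (v \<bullet> b) *\<^sub>R b) = v"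
    using orthonormal_model_basis by metis
  have cont: "continuous_on S (\<lambda>s. g c (inv_into (fst c) (snd c) (q s)) i j)" if "i \<in> B" "j \<in> B" for i j
  proof -
    have "smooth_on E (snd c ` fst c) (\<lambda>x. g c (inv_into (fst c) (snd c) x) i j)"
      using metric_smooth[OF c] B(2) that by blast
    then have "Ck_on 0 E (snd c ` fst c) (\<lambda>x. g c (inv_into (fst c) (snd c) x) i j)"
      unfolding smooth_on_def by blast
    then show ?thesis using continuous_on_compose2[OF _ q(1) q(2)] by simp
  qed
  have "continuous_on S (\<lambda>s. \<Sum>(i,j)\<in>B \<times> B. (v s \<bullet> i) * (v s \<bullet> j) * g c (inv_into (fst c) (snd c) (q s)) i j)"
    unfolding case_prod_beta using cont by (intro continuous_intros v(1)) auto
  moreover have "g c (inv_into (fst c) (snd c) (q s)) (v s) (v s) =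
    (\<Sum>(i,j)\<in>B \<times> B. (v s \<bullet> i) * (v s \<bullet> j) * g c (inv_into (fst c) (snd c) (q s)) i j)" if "s \<in> S" for s
    using that q(2) v(2) chart_inverse(3)[OF c] by (intro metric_expand[OF c _ _ _ B(3)]) auto
  ultimately have "continuous_on S (\<lambda>s. g c (inv_into (fst c) (snd c) (q s)) (v s) (v s))"
    by (simp cong: continuous_on_cong)
  then show ?thesis unfolding metric_norm_def by (intro continuous_on_real_sqrt)
qed

lemma metric_square_lipschitz:
  assumes c: "c \<in> A" and K: "compact K" "convex K" "K \<subseteq> snd c ` fst c"
  shows "\<exists>L\<ge>0. \<forall>x\<in>K. \<forall>y\<in>K. \<forall>v\<in>E. \<bar>(metric_norm c x v)\<^sup>2 - (metric_norm c y v)\<^sup>2\<bar> \<le> L * norm (x - y) * (norm v)\<^sup>2"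
proof -
  let ?\<psi> = "inv_into (fst c) (snd c)"
  obtain B where B: "finite B" "B \<subseteq> E" "\<And>v. v \<in> E \<Longrightarrow> (\<Sum>b\<in>B. (v \<bullet> b) *\<^sub>R b) = v"
    using orthonormal_model_basis by metis
  have KE: "K \<subseteq> E" using K(3) openin_imp_subset[OF openin_chart_image[OF c]] by blast
  have "\<exists>L\<ge>0. \<forall>x\<in>K. \<forall>y\<in>K. \<bar>g c (?\<psi> x) i j - g c (?\<psi> y) i j\<bar> \<le> L * norm (x - y)" if "i \<in> B" "j \<in> B" for i j
  proof (rule C1_lipschitz[OF subspace_model _ K KE])
    show "Ck_on 1 E (snd c ` fst c) (\<lambda>x. g c (?\<psi> x) i j)"
      using metric_smooth[OF c] B(2) that unfolding smooth_on_def by blast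
  qed
  then have "\<forall>p\<in>B \<times> B. \<exists>L\<ge>0. \<forall>x\<in>K. \<forall>y\<in>K.
      \<bar>g c (?\<psi> x) (fst p) (snd p) - g c (?\<psi> y) (fst p) (snd p)\<bar> \<le> L * norm (x - y)" by auto
  then obtain L where L: "\<And>p. p \<in> B \<times> B \<Longrightarrow> 0 \<le> L p \<and> (\<forall>x\<in>K. \<forall>y\<in>K.
      \<bar>g c (?\<psi> x) (fst p) (snd p) - g c (?\<psi> y) (fst p) (snd p)\<bar> \<le> L p * norm (x - y))" by metis
  define M where "M = (\<Sum>p\<in>B \<times> B. norm (fst p) * norm (snd p) * L p)"
  have "\<bar>(metric_norm c x v)\<^sup>2 - (metric_norm c y v)\<^sup>2\<bar> \<le> M * norm (x - y) * (norm v)\<^sup>2"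
    if x: "x \<in> K" and y: "y \<in> K" and v: "v \<in> E" for x y v
  proof -
    have sq: "(metric_norm c x v)\<^sup>2 = (\<Sum>(i,j)\<in>B \<times> B. (v \<bullet> i) * (v \<bullet> j) * g c (?\<psi> x) i j)" if "x \<in> K" for x
    proof -
      have p: "?\<psi> x \<in> fst c" using chart_inverse(3)[OF c] that K(3) by blast
      have "0 \<le> g c (?\<psi> x) v v"
        using metric_pos_def[OF c p v] bilinear_lzero[OF metric_bilinear[OF c p]] by (cases "v = 0") auto
      then have "(metric_norm c x v)\<^sup>2 = g c (?\<psi> x) v v" by (simp add: metric_norm_def)
      also have "\<dots> = (\<Sum>(i,j)\<in>B \<times> B. (v \<bullet> i) * (v \<bullet> j) * g c (?\<psi> x) i j)"
        by (rule metric_expand[OF c p v v B(3)])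
      finally show ?thesis .
    qed
    have "(metric_norm c x v)\<^sup>2 - (metric_norm c y v)\<^sup>2 = (\<Sum>p\<in>B \<times> B. (v \<bullet> fst p) * (v \<bullet> snd p) *
        (g c (?\<psi> x) (fst p) (snd p) - g c (?\<psi> y) (fst p) (snd p)))"
      unfolding sq[OF x] sq[OF y] by (simp add: case_prod_beta sum_subtractf[symmetric] algebra_simps)
    also have "\<bar>\<dots>\<bar> \<le> (\<Sum>p\<in>B \<times> B. (norm v * norm (fst p)) * (norm v * norm (snd p)) * (L p * norm (x - y)))"
    proof (rule order_trans[OF sum_abs sum_mono])
      fix p assume "p \<in> B \<times> B"
      then have "\<bar>g c (?\<psi> x) (fst p) (snd p) - g c (?\<psi> y) (fst p) (snd p)\<bar> \<le> L p * norm (x - y)"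
        using L x y by blast
      then show "\<bar>(v \<bullet> fst p) * (v \<bullet> snd p) * (g c (?\<psi> x) (fst p) (snd p) - g c (?\<psi> y) (fst p) (snd p))\<bar>
        \<le> (norm v * norm (fst p)) * (norm v * norm (snd p)) * (L p * norm (x - y))"
        unfolding abs_mult by (intro mult_mono Cauchy_Schwarz_ineq2) auto
    qed
    also have "\<dots> = M * norm (x - y) * (norm v)\<^sup>2"
      by (simp add: M_def sum_distrib_right sum_distrib_left power2_eq_square algebra_simps)
    finally show ?thesis .
  qed
  moreover have "0 \<le> M" unfolding M_def using L by (intro sum_nonneg mult_nonneg_nonneg) auto
  ultimately show ?thesis by blast
qed

text \<open>
  The bounds come from the compactness of the unit sphere bundle over a small coordinate ball. The
  Lipschitz bound for the square of the norm, divided by the norm, gives the one for the norm itself.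
\<close>

lemma metric_local_constants:
  assumes c: "c \<in> A" and p: "p \<in> fst c"
  obtains R \<alpha> \<beta> L where "0 < R" "0 < \<alpha>" "0 < \<beta>" "0 < L" "cball (snd c p) R \<inter> E \<subseteq> snd c ` fst c"
    "\<And>x v. x \<in> cball (snd c p) R \<inter> E \<Longrightarrow> v \<in> E \<Longrightarrow> \<alpha> * norm v \<le> metric_norm c x v \<and> metric_norm c x v \<le> \<beta> * norm v"
    "\<And>x y v. x \<in> cball (snd c p) R \<inter> E \<Longrightarrow> y \<in> cball (snd c p) R \<inter> E \<Longrightarrow> v \<in> E \<Longrightarrow>
      \<bar>metric_norm c x v - metric_norm c y v\<bar> \<le> L * norm (x - y) * norm v"
proof -
  obtain R where R: "0 < R" "cball (snd c p) R \<inter> E \<subseteq> snd c ` fst c" by (rule chart_cball[OF c p])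
  define K where "K = cball (snd c p) R \<inter> E"
  have KV: "K \<subseteq> snd c ` fst c" using R(2) by (simp add: K_def)
  have "closed E" by (rule closed_subspace[OF subspace_model])
  have "compact K" unfolding K_def by (rule compact_Int_closed[OF compact_cball \<open>closed E\<close>])
  moreover have "convex K"
    unfolding K_def by (rule convex_Int[OF convex_cball subspace_imp_convex[OF subspace_model]])
  moreover have "snd c p \<in> K" using chart_inverse(2)[OF c p] R(1) by (simp add: K_def)
  ultimately have K: "compact K" "convex K" "snd c p \<in> K" by blast+
  define S where "S = sphere (0::'e) 1 \<inter> E"
  have S: "compact S" unfolding S_def by (rule compact_Int_closed[OF compact_sphere \<open>closed E\<close>])
  have hom: "metric_norm c x v = norm v * metric_norm c x (sgn v)" if "x \<in> K" "v \<in> E" for x v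
  proof -
    have "x \<in> snd c ` fst c" using that(1) KV by blast
    from metric_norm_representation[OF c this]
    obtain T :: "'e \<Rightarrow> 'e" where T: "linear T" "\<forall>v\<in>E. metric_norm c x v = norm (T v)" by blast
    have "sgn v \<in> E" using that(2) subspace_model by (auto simp: sgn_div_norm intro: subspace_scale)
    moreover have "T v = norm v *\<^sub>R T (sgn v)"
    proof -
      have "v = norm v *\<^sub>R sgn v" by (cases "v = 0") (simp_all add: sgn_div_norm)
      then have "T v = T (norm v *\<^sub>R sgn v)" by (rule arg_cong)
      also have "\<dots> = norm v *\<^sub>R T (sgn v)" by (rule linear_scale[OF T(1)])
      finally show ?thesis .
    qed
    ultimately show ?thesis using T(2) that by simp
  qed
  have cont: "continuous_on (K \<times> S) (\<lambda>s. metric_norm c (fst s) (snd s))"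
    using KV by (intro metric_continuous[OF c] continuous_intros) (auto simp: S_def)
  have "\<exists>\<alpha> \<beta>. 0 < \<alpha> \<and> 0 < \<beta> \<and> (\<forall>x\<in>K. \<forall>v\<in>S. \<alpha> \<le> metric_norm c x v \<and> metric_norm c x v \<le> \<beta>)"
  proof (cases "S = {}")
    case True
    then show ?thesis by (intro exI[of _ 1]) simp
  next
    case False
    then have ne: "K \<times> S \<noteq> {}" using K(3) by blast
    have comp: "compact (K \<times> S)" using K(1) S by (rule compact_Times)
    from continuous_attains_inf[OF comp ne cont]
    obtain s where s: "s \<in> K \<times> S" "\<forall>s'\<in>K \<times> S. metric_norm c (fst s) (snd s) \<le> metric_norm c (fst s') (snd s')"
      by (elim bexE)
    from continuous_attains_sup[OF comp ne cont]
    obtain t where t: "t \<in> K \<times> S" "\<forall>s'\<in>K \<times> S. metric_norm c (fst s') (snd s') \<le> metric_norm c (fst t) (snd t)"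
      by (elim bexE)
    have "0 < metric_norm c (fst s) (snd s)"
    proof -
      have "fst s \<in> snd c ` fst c" "snd s \<in> E" "snd s \<noteq> 0" using s(1) KV by (auto simp: S_def)
      then show ?thesis
        using metric_pos_def[OF c chart_inverse(3)[OF c]] by (simp add: metric_norm_def)
    qed
    moreover have "metric_norm c (fst s) (snd s) \<le> metric_norm c (fst t) (snd t)" using s t(1) by blast
    ultimately show ?thesis
      using s(2) t(2)
      by (intro exI[of _ "metric_norm c (fst s) (snd s)"] exI[of _ "metric_norm c (fst t) (snd t)"]) force
  qed
  then obtain \<alpha> \<beta> where ab: "0 < \<alpha>" "0 < \<beta>" "\<And>x v. x \<in> K \<Longrightarrow> v \<in> S \<Longrightarrow> \<alpha> \<le> metric_norm c x v \<and> metric_norm c x v \<le> \<beta>"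
    by blast
  have bounds: "\<alpha> * norm v \<le> metric_norm c x v \<and> metric_norm c x v \<le> \<beta> * norm v" if "x \<in> K" "v \<in> E" for x v
  proof (cases "v = 0")
    case True
    then show ?thesis using hom[OF that] by simp
  next
    case False
    then have "sgn v \<in> S"
      using that(2) subspace_model by (auto simp: S_def norm_sgn sgn_div_norm intro: subspace_scale)
    then have "\<alpha> \<le> metric_norm c x (sgn v)" "metric_norm c x (sgn v) \<le> \<beta>" using ab(3) that(1) by blast+
    then show ?thesis
      unfolding hom[OF that] mult.commute[of _ "norm v"] by (intro conjI mult_left_mono) auto
  qed
  have "\<exists>M. 0 \<le> M \<and> (\<forall>x\<in>K. \<forall>y\<in>K. \<forall>v\<in>E.
      \<bar>(metric_norm c x v)\<^sup>2 - (metric_norm c y v)\<^sup>2\<bar> \<le> M * norm (x - y) * (norm v)\<^sup>2)"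
    by (rule metric_square_lipschitz[OF c K(1,2) KV])
  then obtain M where M: "0 \<le> M \<and> (\<forall>x\<in>K. \<forall>y\<in>K. \<forall>v\<in>E.
      \<bar>(metric_norm c x v)\<^sup>2 - (metric_norm c y v)\<^sup>2\<bar> \<le> M * norm (x - y) * (norm v)\<^sup>2)"
    by (rule exE)
  define L where "L = M / \<alpha> + 1"
  have "\<bar>metric_norm c x v - metric_norm c y v\<bar> \<le> L * norm (x - y) * norm v" if "x \<in> K" "y \<in> K" "v \<in> E" for x y v
  proof (cases "v = 0")
    case True
    then show ?thesis using hom[OF that(1,3)] hom[OF that(2,3)] by simp
  next
    case False
    let ?a = "metric_norm c x v" and ?b = "metric_norm c y v"
    have n: "0 < norm v" using False by simp
    have "0 \<le> \<alpha> * norm v" using ab(1) by simp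
    then have lo: "\<alpha> * norm v \<le> ?a" "0 \<le> ?b"
      using bounds[OF that(1,3)] bounds[OF that(2,3)] by linarith+
    have "\<bar>?a - ?b\<bar> * (\<alpha> * norm v) \<le> \<bar>?a - ?b\<bar> * (?a + ?b)" using lo by (intro mult_left_mono) auto
    also have "\<dots> = \<bar>?a\<^sup>2 - ?b\<^sup>2\<bar>"
    proof -
      have "?a\<^sup>2 - ?b\<^sup>2 = (?a - ?b) * (?a + ?b)" by (simp add: power2_eq_square algebra_simps)
      moreover have "0 \<le> ?a + ?b" using lo mult_pos_pos[OF ab(1) n] by linarith
      ultimately show ?thesis by (simp add: abs_mult)
    qed
    also have "\<dots> \<le> M * norm (x - y) * (norm v)\<^sup>2" using M that by blast
    also have "\<dots> = (M / \<alpha> * norm (x - y) * norm v) * (\<alpha> * norm v)"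
      using ab(1) by (simp add: power2_eq_square field_simps)
    finally have "\<bar>?a - ?b\<bar> * (\<alpha> * norm v) \<le> (M / \<alpha> * norm (x - y) * norm v) * (\<alpha> * norm v)" .
    then have "\<bar>?a - ?b\<bar> \<le> M / \<alpha> * norm (x - y) * norm v"
      by (rule mult_right_le_imp_le) (rule mult_pos_pos[OF ab(1) n])
    also have "\<dots> \<le> L * norm (x - y) * norm v" unfolding L_def by (intro mult_right_mono) auto
    finally show ?thesis .
  qed
  moreover have "0 < L" using conjunct1[OF M] ab(1) by (simp add: L_def add_nonneg_pos)
  ultimately show ?thesis
    by (intro that[of R \<alpha> \<beta> L, OF R(1) ab(1,2) _ R(2)] bounds[unfolded K_def]) (simp_all add: K_def)
qed

end

section \<open>Length of arcs\<close>

lemma C1_curve_onD: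
  assumes "C1_curve_on A a b \<gamma>"
  shows "continuous_on {a..b} \<gamma>"
    and "c \<in> A \<Longrightarrow> t \<in> {a..b} \<Longrightarrow> \<gamma> t \<in> fst c \<Longrightarrow>
      ((snd c \<circ> \<gamma>) has_vector_derivative vector_derivative (snd c \<circ> \<gamma>) (at t within {a..b})) (at t within {a..b})"
    and "c \<in> A \<Longrightarrow> continuous_on ({a..b} \<inter> \<gamma> -` fst c) (\<lambda>t. vector_derivative (snd c \<circ> \<gamma>) (at t within {a..b}))"
  using assms unfolding C1_curve_on_def vector_derivative_works by auto

text \<open>
  The integrand of the length on an arbitrary parameter interval, with one-sided derivatives at its end
  points. So the pieces of a piecewise C1 curve have a continuous speed up to their break points.
\<close>

definition arc_speed :: "('a, 'e::euclidean_space) chart set \<Rightarrow> ('a, 'e) metric_tensor \<Rightarrow>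
    real \<Rightarrow> real \<Rightarrow> (real \<Rightarrow> 'a) \<Rightarrow> real \<Rightarrow> real" where
  "arc_speed A g a b \<gamma> t =
     (let c = (SOME c. c \<in> A \<and> \<gamma> t \<in> fst c);
          v = vector_derivative (snd c \<circ> \<gamma>) (at t within {a..b})
      in sqrt (g c (\<gamma> t) v v))"

definition arc_length :: "('a, 'e::euclidean_space) chart set \<Rightarrow> ('a, 'e) metric_tensor \<Rightarrow>
    real \<Rightarrow> real \<Rightarrow> (real \<Rightarrow> 'a) \<Rightarrow> real" where
  "arc_length A g a b \<gamma> = integral {a..b} (arc_speed A g a b \<gamma>)"

context smooth_manifold
begin

lemma chart_around: obtains c where "c \<in> A" "p \<in> fst c"
  using atlas_covers by blast

text \<open>
  Lets one compute derivatives of a curve on the part of the interval that is mapped into a chart.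
\<close>

lemma at_within_preimage:
  fixes \<gamma> :: "real \<Rightarrow> 'a"
  assumes "continuous_on {a..b} \<gamma>" "open U" "t \<in> {a..b}" "\<gamma> t \<in> U"
  shows "at t within ({a..b} \<inter> \<gamma> -` U) = at t within {a..b}"
proof -
  have "openin (top_of_set {a..b}) ({a..b} \<inter> \<gamma> -` U)"
    by (rule continuous_openin_preimage_gen[OF assms(1,2)])
  then obtain T where T: "open T" "{a..b} \<inter> \<gamma> -` U = {a..b} \<inter> T" unfolding openin_open by blast
  have "t \<in> T" using assms(3,4) T(2) by blast
  then show ?thesis
    by (rule at_within_nhd[OF _ T(1)]) (use T(2) in blast)
qed

text \<open>
  The orthogonal projection \<open>P\<close> to \<open>E\<close> fixes the coordinate curve, hence also its derivative.
\<close>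

lemma coordinate_velocity_in_model:
  assumes cont: "continuous_on {a..b} \<gamma>" and ab: "a < b" and c: "c \<in> A" and t: "t \<in> {a..b}" "\<gamma> t \<in> fst c"
    and v: "((snd c \<circ> \<gamma>) has_vector_derivative v) (at t within {a..b})"
  shows "v \<in> E"
proof -
  obtain B where B: "finite B" "B \<subseteq> E" "\<And>v. v \<in> E \<Longrightarrow> (\<Sum>b\<in>B. (v \<bullet> b) *\<^sub>R b) = v"
    using orthonormal_model_basis by metis
  define P where "P x = (\<Sum>b\<in>B. (x \<bullet> b) *\<^sub>R b)" for x
  have "bounded_linear P" unfolding P_def[abs_def]
    by (intro bounded_linear_sum bounded_linear_scaleR_const bounded_linear_inner_left)
  then have 1: "((\<lambda>s. P ((snd c \<circ> \<gamma>) s)) has_vector_derivative P v) (at t within {a..b})"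
    using v by (rule bounded_linear.has_vector_derivative)
  note same = at_within_preimage[OF cont open_chart_domain[OF c] t]
  have "((snd c \<circ> \<gamma>) has_vector_derivative P v) (at t within ({a..b} \<inter> \<gamma> -` fst c))"
  proof (rule has_vector_derivative_transform)
    show "((\<lambda>s. P ((snd c \<circ> \<gamma>) s)) has_vector_derivative P v) (at t within ({a..b} \<inter> \<gamma> -` fst c))"
      using 1 unfolding same .
    show "t \<in> {a..b} \<inter> \<gamma> -` fst c" using t by simp
    fix s assume "s \<in> {a..b} \<inter> \<gamma> -` fst c"
    then have "snd c (\<gamma> s) \<in> E" using chart_inverse(2)[OF c] by simp
    then show "(snd c \<circ> \<gamma>) s = P ((snd c \<circ> \<gamma>) s)" using B(3) by (simp add: P_def)
  qed
  then have "((snd c \<circ> \<gamma>) has_vector_derivative P v) (at t within {a..b})" unfolding same .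
  then have "v = P v"
    using vector_derivative_within_closed_interval[OF ab t(1)] v by metis
  moreover have "P v \<in> E" unfolding P_def using B(2) by (intro subspace_sum subspace_scale subspace_model) auto
  ultimately show ?thesis by simp
qed

lemma coordinate_velocity_transforms:
  assumes cont: "continuous_on {a..b} \<gamma>" and c: "c \<in> A" and d: "d \<in> A"
    and t: "t \<in> {a..b}" "\<gamma> t \<in> fst c \<inter> fst d"
    and v: "((snd c \<circ> \<gamma>) has_vector_derivative v) (at t within {a..b})"
  shows "((snd d \<circ> \<gamma>) has_vector_derivative
    frechet_derivative (transition c d) (at (snd c (\<gamma> t)) within transition_domain c d) v) (at t within {a..b})"
proof -
  let ?T = "frechet_derivative (transition c d) (at (snd c (\<gamma> t)) within transition_domain c d)"
  define S where "S = {a..b} \<inter> \<gamma> -` (fst c \<inter> fst d)"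
  have same: "at t within S = at t within {a..b}"
    unfolding S_def using open_chart_domain[OF c] open_chart_domain[OF d] t
    by (intro at_within_preimage cont open_Int)
  have "Ck_on 1 E (transition_domain c d) (transition c d)"
    using smooth_transition[OF c d] unfolding smooth_on_def by blast
  moreover have "snd c (\<gamma> t) \<in> transition_domain c d" using t by (simp add: transition_domain_def)
  ultimately have "transition c d differentiable (at (snd c (\<gamma> t)) within transition_domain c d)" by simp
  then have T: "(transition c d has_derivative ?T) (at (snd c (\<gamma> t)) within transition_domain c d)"
    by (simp only: frechet_derivative_works)
  have "(snd c \<circ> \<gamma>) ` S \<subseteq> transition_domain c d" by (auto simp: S_def transition_domain_def)
  then have 1: "(transition c d has_derivative ?T) (at ((snd c \<circ> \<gamma>) t) within (snd c \<circ> \<gamma>) ` S)"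
    using has_derivative_subset[OF T] by simp
  have 2: "((snd c \<circ> \<gamma>) has_derivative (\<lambda>h. h *\<^sub>R v)) (at t within S)"
    using v unfolding same has_vector_derivative_def .
  have "(transition c d \<circ> (snd c \<circ> \<gamma>) has_derivative ?T \<circ> (\<lambda>h. h *\<^sub>R v)) (at t within S)"
    by (rule diff_chain_within[OF 2 1])
  moreover have "?T \<circ> (\<lambda>h. h *\<^sub>R v) = (\<lambda>h. h *\<^sub>R ?T v)"
    using linear_scale[OF has_derivative_linear[OF T]] by (simp add: fun_eq_iff)
  ultimately have 3: "(transition c d \<circ> (snd c \<circ> \<gamma>) has_vector_derivative ?T v) (at t within S)"
    by (simp add: has_vector_derivative_def)
  have "((snd d \<circ> \<gamma>) has_vector_derivative ?T v) (at t within S)"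
  proof (rule has_vector_derivative_transform[OF _ _ 3])
    show "t \<in> S" using t by (simp add: S_def)
    show "(snd d \<circ> \<gamma>) s = (transition c d \<circ> (snd c \<circ> \<gamma>)) s" if "s \<in> S" for s
      using that chart_inverse(1)[OF c] by (simp add: S_def transition_def)
  qed
  then show ?thesis unfolding same .
qed

end

context riemannian_manifold
begin

abbreviation "speed \<equiv> arc_speed A g"
abbreviation "len \<equiv> arc_length A g"
abbreviation "velocity a b \<gamma> c t \<equiv> vector_derivative (snd c \<circ> \<gamma>) (at t within {a..b})"

lemma speed_in_chart:
  assumes C1: "C1_curve_on A a b \<gamma>" and ab: "a < b" and c: "c \<in> A" and t: "t \<in> {a..b}" "\<gamma> t \<in> fst c"
  shows "speed a b \<gamma> t = metric_norm c (snd c (\<gamma> t)) (velocity a b \<gamma> c t)" and "velocity a b \<gamma> c t \<in> E"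
proof -
  define c0 where "c0 = (SOME c. c \<in> A \<and> \<gamma> t \<in> fst c)"
  have "\<exists>c. c \<in> A \<and> \<gamma> t \<in> fst c" using c t(2) by blast
  then have "c0 \<in> A \<and> \<gamma> t \<in> fst c0" unfolding c0_def by (rule someI_ex)
  then have c0: "c0 \<in> A" "\<gamma> t \<in> fst c \<inter> fst c0" using t(2) by auto
  note cont = C1_curve_onD(1)[OF C1]
  note v = C1_curve_onD(2)[OF C1 c t]
  show vE: "velocity a b \<gamma> c t \<in> E" by (rule coordinate_velocity_in_model[OF cont ab c t v])
  note vector_derivative_within_closed_interval[OF ab t(1) coordinate_velocity_transforms[OF cont c c0(1) t(1) c0(2) v]]
  then have "g c0 (\<gamma> t) (velocity a b \<gamma> c0 t) (velocity a b \<gamma> c0 t) = g c (\<gamma> t) (velocity a b \<gamma> c t) (velocity a b \<gamma> c t)"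
    using metric_change_of_chart[OF c c0(1,2) vE vE refl] by simp
  then show "speed a b \<gamma> t = metric_norm c (snd c (\<gamma> t)) (velocity a b \<gamma> c t)"
    by (simp add: arc_speed_def Let_def c0_def[symmetric] metric_norm_def chart_inverse(1)[OF c t(2)])
qed

lemma continuous_on_speed:
  assumes C1: "C1_curve_on A a b \<gamma>" and ab: "a < b"
  shows "continuous_on {a..b} (speed a b \<gamma>)"
  unfolding continuous_on_eq_continuous_within
proof
  fix t assume t: "t \<in> {a..b}"
  obtain c where c: "c \<in> A" "\<gamma> t \<in> fst c" by (rule chart_around)
  note cont = C1_curve_onD(1)[OF C1]
  define S where "S = {a..b} \<inter> \<gamma> -` fst c"
  have same: "at t within S = at t within {a..b}"
    unfolding S_def by (rule at_within_preimage[OF cont open_chart_domain[OF c(1)] t c(2)])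
  have "continuous_on S (\<lambda>s. metric_norm c (snd c (\<gamma> s)) (velocity a b \<gamma> c s))"
  proof (rule metric_continuous[OF c(1)])
    show "continuous_on S (\<lambda>s. snd c (\<gamma> s))"
      by (rule continuous_on_compose2[OF chart_inverse(5)[OF c(1)] continuous_on_subset[OF cont]])
        (auto simp: S_def)
    show "(\<lambda>s. snd c (\<gamma> s)) ` S \<subseteq> snd c ` fst c" by (auto simp: S_def)
    show "continuous_on S (velocity a b \<gamma> c)" unfolding S_def by (rule C1_curve_onD(3)[OF C1 c(1)])
    show "velocity a b \<gamma> c ` S \<subseteq> E" using speed_in_chart(2)[OF C1 ab c(1)] by (auto simp: S_def)
  qed
  moreover have "speed a b \<gamma> s = metric_norm c (snd c (\<gamma> s)) (velocity a b \<gamma> c s)" if "s \<in> S" for s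
    using speed_in_chart(1)[OF C1 ab c(1)] that by (simp add: S_def)
  ultimately have "continuous_on S (speed a b \<gamma>)" by (simp cong: continuous_on_cong)
  moreover have "t \<in> S" using t c by (simp add: S_def)
  ultimately show "continuous (at t within {a..b}) (speed a b \<gamma>)"
    unfolding continuous_on_eq_continuous_within same[symmetric] by blast
qed

lemma speed_nonneg:
  assumes C1: "C1_curve_on A a b \<gamma>" and ab: "a < b" and t: "t \<in> {a..b}"
  shows "0 \<le> speed a b \<gamma> t"
proof -
  obtain c where c: "c \<in> A" "\<gamma> t \<in> fst c" by (rule chart_around)
  from metric_norm_representation[OF c(1) imageI[OF c(2)]]
  obtain T :: "'e \<Rightarrow> 'e" where T: "linear T" "\<forall>v\<in>E. metric_norm c (snd c (\<gamma> t)) v = norm (T v)" by blast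
  show ?thesis using speed_in_chart[OF C1 ab c(1) t c(2)] T(2) by simp
qed

lemma integrable_speed: "C1_curve_on A a b \<gamma> \<Longrightarrow> a < b \<Longrightarrow> speed a b \<gamma> integrable_on {a..b}"
  by (intro integrable_continuous_real continuous_on_speed)

text \<open>
  Besides reversal, shifts and rescaling this covers, with \<open>m = 1\<close> and \<open>q = 0\<close>, restriction to a
  subinterval and passage to a curve that agrees with \<open>\<gamma>\<close> there.
\<close>

lemma reparametrize:
  assumes C1: "C1_curve_on A a b \<gamma>" and ab: "a < b" and m: "m \<noteq> 0" and ab': "a' < b'"
    and img: "\<And>t. t \<in> {a'..b'} \<Longrightarrow> m * t + q \<in> {a..b}"
    and eq: "\<And>t. t \<in> {a'..b'} \<Longrightarrow> \<gamma>' t = \<gamma> (m * t + q)"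
  shows "C1_curve_on A a' b' \<gamma>'"
    and "t \<in> {a'..b'} \<Longrightarrow> speed a' b' \<gamma>' t = \<bar>m\<bar> * speed a b \<gamma> (m * t + q)"
proof -
  define f where "f t = m * t + q" for t
  have vel: "((snd c \<circ> \<gamma>') has_vector_derivative m *\<^sub>R velocity a b \<gamma> c (f t)) (at t within {a'..b'})"
    if c: "c \<in> A" and t: "t \<in> {a'..b'}" "\<gamma>' t \<in> fst c" for c t
  proof -
    have ft: "f t \<in> {a..b}" "\<gamma> (f t) \<in> fst c" using img[OF t(1)] eq[OF t(1)] t(2) by (simp_all add: f_def)
    have 1: "(f has_vector_derivative m) (at t within {a'..b'})"
      unfolding f_def[abs_def] by (auto intro!: derivative_eq_intros simp: has_vector_derivative_def)
    have "f ` {a'..b'} \<subseteq> {a..b}" using img by (auto simp: f_def)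
    then have 2: "((snd c \<circ> \<gamma>) has_vector_derivative velocity a b \<gamma> c (f t)) (at (f t) within f ` {a'..b'})"
      by (rule has_vector_derivative_within_subset[OF C1_curve_onD(2)[OF C1 c ft]])
    show ?thesis
      by (rule has_vector_derivative_transform[OF t(1) _ vector_diff_chain_within[OF 1 2]])
        (simp add: eq f_def)
  qed
  have vel_eq: "velocity a' b' \<gamma>' c t = m *\<^sub>R velocity a b \<gamma> c (f t)"
    if "c \<in> A" "t \<in> {a'..b'}" "\<gamma>' t \<in> fst c" for c t
    by (rule vector_derivative_within_closed_interval[OF ab' that(2) vel[OF that]])
  have contf: "continuous_on S f" for S unfolding f_def[abs_def] by (intro continuous_intros)
  show "C1_curve_on A a' b' \<gamma>'"
    unfolding C1_curve_on_def
  proof (intro conjI ballI)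
    have "continuous_on {a'..b'} (\<lambda>t. \<gamma> (f t))"
      by (rule continuous_on_compose2[OF C1_curve_onD(1)[OF C1] contf]) (use img f_def in auto)
    then show "continuous_on {a'..b'} \<gamma>'" by (rule continuous_on_eq) (simp add: eq f_def)
    fix c assume c: "c \<in> A"
    show "(snd c \<circ> \<gamma>') differentiable (at t within {a'..b'})" if "t \<in> {a'..b'} \<inter> \<gamma>' -` fst c" for t
      using vel[OF c, of t] that unfolding has_vector_derivative_def differentiable_def by blast
    have "continuous_on ({a'..b'} \<inter> \<gamma>' -` fst c) (\<lambda>t. m *\<^sub>R velocity a b \<gamma> c (f t))"
      by (intro continuous_on_scaleR continuous_on_const
          continuous_on_compose2[OF C1_curve_onD(3)[OF C1 c] contf])
        (use img eq f_def in auto)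
    then show "continuous_on ({a'..b'} \<inter> \<gamma>' -` fst c) (velocity a' b' \<gamma>' c)"
      by (rule continuous_on_eq) (simp add: vel_eq[OF c])
  qed
  show "speed a' b' \<gamma>' t = \<bar>m\<bar> * speed a b \<gamma> (m * t + q)" if t: "t \<in> {a'..b'}"
  proof -
    define c where "c = (SOME c. c \<in> A \<and> \<gamma> (f t) \<in> fst c)"
    obtain c' where "c' \<in> A" "\<gamma> (f t) \<in> fst c'" by (rule chart_around)
    then have "\<exists>c. c \<in> A \<and> \<gamma> (f t) \<in> fst c" by blast
    then have c: "c \<in> A \<and> \<gamma> (f t) \<in> fst c" unfolding c_def by (rule someI_ex)
    have eq': "\<gamma>' t = \<gamma> (f t)" using eq[OF t] by (simp add: f_def)
    have "g c (\<gamma> (f t)) (m *\<^sub>R v) (m *\<^sub>R v) = m\<^sup>2 * g c (\<gamma> (f t)) v v" for v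
      using metric_bilinear c by (simp add: bilinear_lmul bilinear_rmul power2_eq_square)
    then have "speed a' b' \<gamma>' t = \<bar>m\<bar> * speed a b \<gamma> (f t)"
      using vel_eq[of c t] c t eq'
      by (simp add: arc_speed_def Let_def c_def[symmetric] real_sqrt_mult)
    then show ?thesis by (simp add: f_def)
  qed
qed

lemma length_reparametrize:
  assumes C1: "C1_curve_on A a b \<gamma>" and ab: "a < b" and m: "m \<noteq> 0" and ab': "a' < b'"
    and img: "(\<lambda>t. m * t + q) ` {a'..b'} = {a..b}"
    and eq: "\<And>t. t \<in> {a'..b'} \<Longrightarrow> \<gamma>' t = \<gamma> (m * t + q)"
  shows "C1_curve_on A a' b' \<gamma>'" and "len a' b' \<gamma>' = len a b \<gamma>"
proof -
  have img': "m * t + q \<in> {a..b}" if "t \<in> {a'..b'}" for t using img that by blast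
  show "C1_curve_on A a' b' \<gamma>'" by (rule reparametrize(1)[OF C1 ab m ab' img' eq])
  have "(speed a b \<gamma> has_integral len a b \<gamma>) (cbox a b)"
    unfolding arc_length_def using integrable_speed[OF C1 ab] by (simp add: integrable_integral)
  from has_integral_affinity[OF this m, of q]
  have "((\<lambda>t. speed a b \<gamma> (m * t + q)) has_integral (1 / \<bar>m\<bar>) * len a b \<gamma>)
    ((\<lambda>x. (1/m) * x + - ((1/m) * q)) ` {a..b})" by simp
  also have "(\<lambda>x. (1/m) * x + - ((1/m) * q)) ` {a..b} = {a'..b'}"
    unfolding img[symmetric] image_image using m by (simp add: field_simps)
  finally have "((\<lambda>t. \<bar>m\<bar> * speed a b \<gamma> (m * t + q)) has_integral \<bar>m\<bar> * ((1 / \<bar>m\<bar>) * len a b \<gamma>)) {a'..b'}"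
    by (rule has_integral_mult_right)
  then have "((\<lambda>t. \<bar>m\<bar> * speed a b \<gamma> (m * t + q)) has_integral len a b \<gamma>) {a'..b'}" using m by simp
  then have "(speed a' b' \<gamma>' has_integral len a b \<gamma>) {a'..b'}"
    by (rule has_integral_eq[rotated]) (rule reparametrize(2)[OF C1 ab m ab' img' eq, symmetric])
  then show "len a' b' \<gamma>' = len a b \<gamma>" unfolding arc_length_def by (rule integral_unique)
qed

lemma restrict_arc:
  assumes C1: "C1_curve_on A a b \<gamma>" and "a \<le> a'" "a' < b'" "b' \<le> b"
  shows "C1_curve_on A a' b' \<gamma>" and "len a' b' \<gamma> = integral {a'..b'} (speed a b \<gamma>)"
proof -
  have ab: "a < b" using assms by simp
  have img: "1 * t + 0 \<in> {a..b}" if "t \<in> {a'..b'}" for t using that assms by simp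
  show "C1_curve_on A a' b' \<gamma>" by (rule reparametrize(1)[OF C1 ab _ assms(3) img, where \<gamma>'=\<gamma>]) auto
  have "speed a' b' \<gamma> t = speed a b \<gamma> t" if "t \<in> {a'..b'}" for t
    using reparametrize(2)[OF C1 ab _ assms(3) img _ that, where \<gamma>'=\<gamma>] by simp
  then show "len a' b' \<gamma> = integral {a'..b'} (speed a b \<gamma>)"
    unfolding arc_length_def by (rule integral_cong)
qed

lemma length_nonneg: "C1_curve_on A a b \<gamma> \<Longrightarrow> a < b \<Longrightarrow> 0 \<le> len a b \<gamma>"
  unfolding arc_length_def by (intro integral_nonneg integrable_speed speed_nonneg)

lemma length_split:
  assumes C1: "C1_curve_on A a b \<gamma>" and "a < c" "c < b"
  shows "len a c \<gamma> + len c b \<gamma> = len a b \<gamma>"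
proof -
  have "integral {a..c} (speed a b \<gamma>) + integral {c..b} (speed a b \<gamma>) = integral {a..b} (speed a b \<gamma>)"
    using integrable_speed[OF C1] assms by (intro Henstock_Kurzweil_Integration.integral_combine) auto
  then show ?thesis
    unfolding restrict_arc(2)[OF C1 order_refl assms(2) less_imp_le[OF assms(3)]]
      restrict_arc(2)[OF C1 less_imp_le[OF assms(2)] assms(3) order_refl]
    by (simp only: arc_length_def)
qed

end

section \<open>The Riemannian distance as a length metric\<close>

text \<open>
  \<open>joined A g x y L\<close>: a chain of C1 arcs of total length \<open>L\<close> leads from \<open>x\<close> to \<open>y\<close>. Each arc keeps
  its own parameter interval, so concatenation, reversal and subdivision need no global
  parametrization.
\<close>

inductive joined :: "('a::topological_space, 'e::euclidean_space) chart set \<Rightarrow> ('a, 'e) metric_tensor \<Rightarrow>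
    'a \<Rightarrow> 'a \<Rightarrow> real \<Rightarrow> bool" for A g where
  joined_refl: "joined A g x x 0"
| joined_step: "joined A g x (\<gamma> a) L \<Longrightarrow> a < b \<Longrightarrow> C1_curve_on A a b \<gamma> \<Longrightarrow>
    joined A g x (\<gamma> b) (L + arc_length A g a b \<gamma>)"

definition pieces :: "('a::topological_space, 'e::euclidean_space) chart set \<Rightarrow> nat \<Rightarrow> (nat \<Rightarrow> real) \<Rightarrow>
    (real \<Rightarrow> 'a) \<Rightarrow> bool" where
  "pieces A n s \<gamma> \<longleftrightarrow> (\<forall>i<n. s i < s (Suc i) \<and> C1_curve_on A (s i) (s (Suc i)) \<gamma>)"

lemma pieces_mono:
  assumes "pieces A n s \<gamma>" "i \<le> j" "j \<le> n"
  shows "s i \<le> s j"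
  using assms(2,3)
proof (induction j rule: dec_induct)
  case (step k)
  then have "s k < s (Suc k)" using assms(1) by (simp add: pieces_def)
  then show ?case using step by simp
qed simp

lemma joined_arc: "a < b \<Longrightarrow> C1_curve_on A a b \<gamma> \<Longrightarrow> joined A g (\<gamma> a) (\<gamma> b) (arc_length A g a b \<gamma>)"
  using joined_step[OF joined_refl, of a b A \<gamma> g] by simp

lemma joined_trans:
  assumes "joined A g y z M" "joined A g x y L"
  shows "joined A g x z (L + M)"
  using assms
proof (induction rule: joined.induct)
  case (joined_refl y)
  then show ?case by simp
next
  case (joined_step y \<gamma> a M b)
  have "joined A g x (\<gamma> a) (L + M)" using joined_step by blast
  from joined.joined_step[OF this joined_step(2,3)] show ?case by (simp add: add.assoc)
qed

context riemannian_manifold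
begin

abbreviation "join \<equiv> joined A g"

lemma joined_nonneg: "join x y L \<Longrightarrow> 0 \<le> L"
  by (induction rule: joined.induct) (auto simp: length_nonneg)

lemma joined_sym:
  assumes "join x y L"
  shows "join y x L"
  using assms
proof (induction rule: joined.induct)
  case (joined_refl x)
  then show ?case by (rule joined.joined_refl)
next
  case (joined_step x \<gamma> a L b)
  define \<gamma>' where "\<gamma>' t = \<gamma> ((-1) * t + (a + b))" for t
  have img: "(\<lambda>t. (-1) * t + (a + b)) ` {a..b} = {a..b}"
  proof (intro equalityI subsetI)
    fix t assume "t \<in> {a..b}"
    then show "t \<in> (\<lambda>t. (-1) * t + (a + b)) ` {a..b}" by (intro image_eqI[of _ _ "a + b - t"]) auto
  qed auto
  note rev = length_reparametrize[OF joined_step(3,2) _ joined_step(2) img, of \<gamma>', OF _ \<gamma>'_def]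
  have "join (\<gamma>' a) (\<gamma>' b) (len a b \<gamma>')" using rev(1) joined_step(2) by (intro joined_arc) auto
  moreover have "\<gamma>' a = \<gamma> b" "\<gamma>' b = \<gamma> a" by (simp_all add: \<gamma>'_def)
  ultimately have "join (\<gamma> b) (\<gamma> a) (len a b \<gamma>)" using rev(2) by simp
  from joined_trans[OF joined_step.IH this] show ?case by (simp add: add.commute)
qed

text \<open>
  Cut the arc in which the accumulated length reaches \<open>s\<close>; the cut exists by the intermediate value
  theorem.
\<close>

lemma joined_split:
  assumes "join x y L" "0 \<le> s" "s \<le> L"
  shows "\<exists>w. join x w s \<and> join w y (L - s)"
  using assms
proof (induction arbitrary: s rule: joined.induct)
  case (joined_refl x)
  then have "s = 0" by simp
  then show ?case using joined.joined_refl by fastforce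
next
  case (joined_step x \<gamma> a L b)
  show ?case
  proof (cases "s \<le> L")
    case True
    then obtain w where w: "join x w s" "join w (\<gamma> a) (L - s)" using joined_step by blast
    have "join w (\<gamma> b) (L - s + len a b \<gamma>)" by (rule joined.joined_step[OF w(2) joined_step(2,3)])
    then show ?thesis using w(1) by (intro exI[of _ w]) (simp add: algebra_simps)
  next
    case False
    define F where "F t = integral {a..t} (speed a b \<gamma>)" for t
    have "continuous_on {a..b} F"
      unfolding F_def[abs_def] by (rule indefinite_integral_continuous_1[OF integrable_speed[OF joined_step(3,2)]])
    moreover have "F a \<le> s - L" "s - L \<le> F b" using False joined_step(6) by (simp_all add: F_def arc_length_def)
    ultimately obtain \<tau> where \<tau>: "a \<le> \<tau>" "\<tau> \<le> b" "F \<tau> = s - L"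
      using IVT'[of F a "s - L" b] joined_step(2) by auto
    have "a \<noteq> \<tau>" using \<tau>(3) False by (auto simp: F_def)
    then have a\<tau>: "a < \<tau>" using \<tau>(1) by simp
    note first = restrict_arc[OF joined_step(3) order_refl a\<tau> \<tau>(2)]
    have "join x (\<gamma> \<tau>) (L + len a \<tau> \<gamma>)" by (rule joined.joined_step[OF joined_step(1) a\<tau> first(1)])
    then have 1: "join x (\<gamma> \<tau>) s" using first(2) \<tau>(3) by (simp add: F_def)
    show ?thesis
    proof (cases "\<tau> = b")
      case True
      then have "s = L + len a b \<gamma>" using \<tau>(3) by (simp add: F_def arc_length_def)
      then show ?thesis using 1 joined.joined_refl[of A g "\<gamma> b"] True by auto
    next
      case False
      then have \<tau>b: "\<tau> < b" using \<tau>(2) by simp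
      have "join (\<gamma> \<tau>) (\<gamma> b) (len \<tau> b \<gamma>)"
        by (rule joined_arc[OF \<tau>b restrict_arc(1)[OF joined_step(3) \<tau>(1) \<tau>b order_refl]])
      moreover have "len \<tau> b \<gamma> = L + len a b \<gamma> - s"
        using length_split[OF joined_step(3) a\<tau> \<tau>b] first(2) \<tau>(3) by (simp add: F_def)
      ultimately show ?thesis using 1 by auto
    qed
  qed
qed

lemma joined_pieces:
  assumes "pieces A n s \<gamma>" "k \<le> n"
  shows "join (\<gamma> (s 0)) (\<gamma> (s k)) (\<Sum>i<k. len (s i) (s (Suc i)) \<gamma>)"
  using assms(2)
proof (induction k)
  case 0
  then show ?case by (simp add: joined_refl)
next
  case (Suc k)
  then have "s k < s (Suc k)" "C1_curve_on A (s k) (s (Suc k)) \<gamma>" using assms(1) by (simp_all add: pieces_def)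
  from joined_step[OF _ this, of g "\<gamma> (s 0)" "\<Sum>i<k. len (s i) (s (Suc i)) \<gamma>"] Suc
  show ?case by simp
qed

lemma curve_length_pieces:
  assumes "pieces A n s \<gamma>" "s 0 = 0" "s n = 1"
  shows "curve_length A g \<gamma> = (\<Sum>i<n. len (s i) (s (Suc i)) \<gamma>)"
proof -
  have "(curve_speed A g \<gamma> has_integral (\<Sum>i<k. len (s i) (s (Suc i)) \<gamma>)) {0..s k}" if "k \<le> n" for k
    using that
  proof (induction k)
    case 0
    then show ?case using assms(2) by (simp add: has_integral_refl)
  next
    case (Suc k)
    have k: "s k < s (Suc k)" "C1_curve_on A (s k) (s (Suc k)) \<gamma>"
      using assms(1) Suc.prems by (simp_all add: pieces_def)
    have bounds: "0 \<le> s k" "s (Suc k) \<le> 1"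
      using pieces_mono[OF assms(1), of 0 k] pieces_mono[OF assms(1), of "Suc k" n] assms(2,3) Suc.prems by auto
    have "(speed (s k) (s (Suc k)) \<gamma> has_integral len (s k) (s (Suc k)) \<gamma>) {s k..s (Suc k)}"
      unfolding arc_length_def by (rule integrable_integral[OF integrable_speed[OF k(2,1)]])
    moreover have "curve_speed A g \<gamma> t = speed (s k) (s (Suc k)) \<gamma> t" if "t \<in> {s k..s (Suc k)} - {s k, s (Suc k)}" for t
    proof -
      have "at t within {0..1} = at t" "at t within {s k..s (Suc k)} = at t"
        using that bounds by (auto intro!: at_within_Icc_at)
      then show ?thesis by (simp add: curve_speed_def arc_speed_def)
    qed
    ultimately have "(curve_speed A g \<gamma> has_integral len (s k) (s (Suc k)) \<gamma>) {s k..s (Suc k)}"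
      by (intro has_integral_spike_finite[of "{s k, s (Suc k)}" _ "curve_speed A g \<gamma>"]) auto
    from has_integral_combine[OF bounds(1) less_imp_le[OF k(1)] _ this] Suc
    show ?case by simp
  qed
  from this[of n] show ?thesis unfolding curve_length_def using assms(3) by (simp add: integral_unique)
qed

lemma constant_arc: "C1_curve_on A a b (\<lambda>_. x)" "a < b \<Longrightarrow> len a b (\<lambda>_. x) = 0"
proof -
  have 0: "((snd c \<circ> (\<lambda>_. x)) has_vector_derivative 0) (at t within {a..b})" for c :: "('a, 'e) chart" and t
    by (simp add: o_def has_vector_derivative_const)
  show C1: "C1_curve_on A a b (\<lambda>_. x)"
  proof (cases "a < b")
    case True
    have "velocity a b (\<lambda>_. x) c t = 0" if "t \<in> {a..b}" for c :: "('a, 'e) chart" and t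
      by (rule vector_derivative_within_closed_interval[OF True that 0])
    then show ?thesis unfolding C1_curve_on_def
      by (auto simp: o_def intro: continuous_on_eq[OF continuous_on_const[of _ 0]])
  next
    case False
    then show ?thesis unfolding C1_curve_on_def
      by (cases "a = b") (auto simp: o_def)
  qed
  show "len a b (\<lambda>_. x) = 0" if ab: "a < b"
  proof -
    have "speed a b (\<lambda>_. x) t = 0" if t: "t \<in> {a..b}" for t
    proof -
      obtain c where c: "c \<in> A" "x \<in> fst c" by (rule chart_around)
      have "velocity a b (\<lambda>_. x) c t = 0" by (rule vector_derivative_within_closed_interval[OF ab t 0])
      moreover have "metric_norm c (snd c x) 0 = 0"
        using bilinear_lzero[OF metric_bilinear[OF c]] chart_inverse(1)[OF c] by (simp add: metric_norm_def)
      ultimately show ?thesis using speed_in_chart(1)[OF C1 ab c(1) t] c(2) by simp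
    qed
    then have "integral {a..b} (speed a b (\<lambda>_. x)) = integral {a..b} (\<lambda>_. 0)" by (rule integral_cong)
    then show ?thesis by (simp add: arc_length_def)
  qed
qed

text \<open>
  The arcs are shifted so that their parameter intervals become adjacent. A chain without arcs becomes
  a constant curve.
\<close>

lemma joined_imp_pieces:
  assumes "join x y L"
  shows "\<exists>n s \<gamma>. 0 < n \<and> s 0 = 0 \<and> pieces A n s \<gamma> \<and> \<gamma> 0 = x \<and> \<gamma> (s n) = y \<and>
    L = (\<Sum>i<n. len (s i) (s (Suc i)) \<gamma>)"
  using assms
proof (induction rule: joined.induct)
  case (joined_refl x)
  have "pieces A 1 real (\<lambda>_. x)" by (simp add: pieces_def constant_arc(1))
  then show ?case
    by (intro exI[of _ 1] exI[of _ real] exI[of _ "\<lambda>_. x"]) (simp add: constant_arc(2))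
next
  case (joined_step x \<gamma>2 a L b)
  then obtain n s \<gamma> where P: "0 < n" "s 0 = (0::real)" "pieces A n s \<gamma>" "\<gamma> 0 = x" "\<gamma> (s n) = \<gamma>2 a"
    "L = (\<Sum>i<n. len (s i) (s (Suc i)) \<gamma>)" by blast
  define s' where "s' i = (if i \<le> n then s i else s n + (b - a))" for i
  define \<gamma>' where "\<gamma>' t = (if t \<le> s n then \<gamma> t else \<gamma>2 (t + (a - s n)))" for t
  have s0: "0 \<le> s n" using pieces_mono[OF P(3), of 0 n] P(2) by simp
  have old: "s' i < s' (Suc i)" "C1_curve_on A (s' i) (s' (Suc i)) \<gamma>'"
    "len (s' i) (s' (Suc i)) \<gamma>' = len (s i) (s (Suc i)) \<gamma>" if i: "i < n" for i
  proof -
    have s': "s' i = s i" "s' (Suc i) = s (Suc i)" using i by (simp_all add: s'_def)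
    have arc: "s i < s (Suc i)" "C1_curve_on A (s i) (s (Suc i)) \<gamma>" using P(3) i by (simp_all add: pieces_def)
    have le: "s (Suc i) \<le> s n" using pieces_mono[OF P(3), of "Suc i" n] i by simp
    have eq: "\<gamma>' t = \<gamma> (1 * t + 0)" if "t \<in> {s i..s (Suc i)}" for t using that le by (simp add: \<gamma>'_def)
    note rep = length_reparametrize[OF arc(2,1) one_neq_zero arc(1) _ eq]
    show "s' i < s' (Suc i)" "C1_curve_on A (s' i) (s' (Suc i)) \<gamma>'"
      "len (s' i) (s' (Suc i)) \<gamma>' = len (s i) (s (Suc i)) \<gamma>"
      unfolding s' using arc(1) rep by simp_all
  qed
  have s'n: "s' n = s n" "s' (Suc n) = s n + (b - a)" by (simp_all add: s'_def)
  have less: "s n < s n + (b - a)" using joined_step(2) by simp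
  have img: "(\<lambda>t. 1 * t + (a - s n)) ` {s n..s n + (b - a)} = {a..b}"
  proof (intro equalityI subsetI)
    fix t assume "t \<in> {a..b}"
    then show "t \<in> (\<lambda>t. 1 * t + (a - s n)) ` {s n..s n + (b - a)}"
      by (intro image_eqI[of _ _ "t - (a - s n)"]) auto
  qed auto
  have eq: "\<gamma>' t = \<gamma>2 (1 * t + (a - s n))" if "t \<in> {s n..s n + (b - a)}" for t
    using that P(5) by (auto simp: \<gamma>'_def)
  note rep = length_reparametrize[OF joined_step(3,2) one_neq_zero less img eq]
  have "pieces A (Suc n) s' \<gamma>'"
    unfolding pieces_def using old(1,2) rep(1) less s'n by (auto simp: less_Suc_eq)
  moreover have "s' 0 = 0" using P(2) by (simp add: s'_def)
  moreover have "\<gamma>' 0 = x" using P(4) s0 by (simp add: \<gamma>'_def)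
  moreover have "\<gamma>' (s' (Suc n)) = \<gamma>2 b" using joined_step(2) by (simp add: s'n \<gamma>'_def)
  moreover have "L + len a b \<gamma>2 = (\<Sum>i<Suc n. len (s' i) (s' (Suc i)) \<gamma>')"
    using old(3) rep(2) P(6) s'n by simp
  ultimately show ?case by blast
qed

lemma joined_iff_piecewise_C1:
  "join x y L \<longleftrightarrow> (\<exists>\<gamma>. piecewise_C1_curve A \<gamma> \<and> \<gamma> 0 = x \<and> \<gamma> 1 = y \<and> curve_length A g \<gamma> = L)"
proof
  assume "join x y L"
  from joined_imp_pieces[OF this]
  obtain n s \<gamma> where P: "0 < n" "s 0 = (0::real)" "pieces A n s \<gamma>" "\<gamma> 0 = x" "\<gamma> (s n) = y"
    "L = (\<Sum>i<n. len (s i) (s (Suc i)) \<gamma>)" by (elim exE conjE)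
  have "s 0 < s (Suc 0)" using P(1,3) by (simp add: pieces_def)
  also have "s (Suc 0) \<le> s n" using pieces_mono[OF P(3), of "Suc 0" n] P(1) by simp
  finally have T: "0 < s n" using P(2) by simp
  define T where "T = s n"
  have T: "0 < T" using T by (simp add: T_def)
  define s' where "s' i = s i / T" for i
  define \<gamma>' where "\<gamma>' t = \<gamma> (T * t + 0)" for t
  have rep: "s' i < s' (Suc i)" "C1_curve_on A (s' i) (s' (Suc i)) \<gamma>'"
    "len (s' i) (s' (Suc i)) \<gamma>' = len (s i) (s (Suc i)) \<gamma>" if i: "i < n" for i
  proof -
    have arc: "s i < s (Suc i)" "C1_curve_on A (s i) (s (Suc i)) \<gamma>" using P(3) i by (simp_all add: pieces_def)
    show less: "s' i < s' (Suc i)" using arc(1) T by (simp add: s'_def divide_strict_right_mono)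
    have img: "(\<lambda>t. T * t + 0) ` {s' i..s' (Suc i)} = {s i..s (Suc i)}"
    proof (intro equalityI subsetI)
      fix t assume "t \<in> {s i..s (Suc i)}"
      then show "t \<in> (\<lambda>t. T * t + 0) ` {s' i..s' (Suc i)}"
        using T by (intro image_eqI[of _ _ "t / T"]) (auto simp: s'_def divide_right_mono)
    qed (use T in \<open>auto simp: s'_def field_simps\<close>)
    have "T \<noteq> 0" using T by simp
    note rep = length_reparametrize[OF arc(2,1) this less img \<gamma>'_def]
    show "C1_curve_on A (s' i) (s' (Suc i)) \<gamma>'" by (rule rep(1))
    show "len (s' i) (s' (Suc i)) \<gamma>' = len (s i) (s (Suc i)) \<gamma>" by (rule rep(2))
  qed
  have P': "pieces A n s' \<gamma>'" unfolding pieces_def using rep(1,2) by blast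
  have s': "s' 0 = 0" "s' n = 1" using P(2) T by (simp_all add: s'_def T_def)
  have "curve_length A g \<gamma>' = L" unfolding curve_length_pieces[OF P' s'] P(6) using rep(3) by simp
  moreover have "piecewise_C1_curve A \<gamma>'"
    unfolding piecewise_C1_curve_def using P' s' unfolding pieces_def by blast
  moreover have "\<gamma>' 0 = x" "\<gamma>' 1 = y" using P(4,5) by (simp_all add: \<gamma>'_def T_def)
  ultimately show "\<exists>\<gamma>. piecewise_C1_curve A \<gamma> \<and> \<gamma> 0 = x \<and> \<gamma> 1 = y \<and> curve_length A g \<gamma> = L" by blast
next
  assume "\<exists>\<gamma>. piecewise_C1_curve A \<gamma> \<and> \<gamma> 0 = x \<and> \<gamma> 1 = y \<and> curve_length A g \<gamma> = L"
  then obtain \<gamma> n s where \<gamma>: "\<gamma> 0 = x" "\<gamma> 1 = y" "curve_length A g \<gamma> = L"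
    "s 0 = 0" "s n = 1" "pieces A n s \<gamma>"
    unfolding piecewise_C1_curve_def pieces_def by (elim exE conjE)
  show "join x y L"
    using joined_pieces[OF \<gamma>(6) order_refl] curve_length_pieces[OF \<gamma>(6,4,5)] \<gamma>(1-5) by simp
qed

abbreviation "rdist \<equiv> riem_dist A g"

lemma rdist_le: "join x y L \<Longrightarrow> rdist x y \<le> ennreal L"
  unfolding riem_dist_def joined_iff_piecewise_C1 by (auto intro: INF_lower)

lemma rdist_less_iff: "rdist x y < t \<longleftrightarrow> (\<exists>L. join x y L \<and> ennreal L < t)"
  unfolding riem_dist_def joined_iff_piecewise_C1 INF_less_iff by auto

lemma rdist_refl: "rdist x x = 0"
  using rdist_le[OF joined_refl[of A g x]] by simp

lemma rdist_sym: "rdist x y = rdist y x"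
proof -
  have le: "rdist y x \<le> rdist x y" for x y
  proof (rule dense_ge)
    fix t assume "rdist x y < t"
    then obtain L where L: "join x y L" "ennreal L < t" unfolding rdist_less_iff by blast
    show "rdist y x \<le> t" using rdist_le[OF joined_sym[OF L(1)]] L(2) by simp
  qed
  show ?thesis by (rule antisym[OF le le])
qed

lemma rdist_triangle: "rdist x z \<le> rdist x y + rdist y z"
proof (cases "rdist x y = \<infinity> \<or> rdist y z = \<infinity>")
  case True
  then show ?thesis by auto
next
  case False
  show ?thesis
  proof (rule ennreal_le_epsilon)
    fix e :: real assume e: "0 < e"
    have "rdist x y + ennreal 0 < rdist x y + ennreal (e/2)" "rdist y z + ennreal 0 < rdist y z + ennreal (e/2)"
      using False e unfolding ennreal_add_left_cancel_less by auto
    then have "rdist x y < rdist x y + ennreal (e/2)" "rdist y z < rdist y z + ennreal (e/2)" by simp_all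
    then obtain L M where L: "join x y L" "ennreal L < rdist x y + ennreal (e/2)"
      and M: "join y z M" "ennreal M < rdist y z + ennreal (e/2)"
      unfolding rdist_less_iff by blast
    have "rdist x z \<le> ennreal (L + M)" by (rule rdist_le[OF joined_trans[OF M(1) L(1)]])
    also have "\<dots> = ennreal L + ennreal M" using joined_nonneg L(1) M(1) by (intro ennreal_plus)
    also have "\<dots> \<le> (rdist x y + ennreal (e/2)) + (rdist y z + ennreal (e/2))"
      using L(2) M(2) by (intro add_mono less_imp_le)
    also have "\<dots> = rdist x y + rdist y z + (ennreal (e/2) + ennreal (e/2))" by (simp add: ac_simps)
    also have "ennreal (e/2) + ennreal (e/2) = ennreal e" using e by (subst ennreal_plus[symmetric]) auto
    finally show "rdist x z \<le> rdist x y + rdist y z + ennreal e" .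
  qed
qed

text \<open>
  Cut a nearly shortest chain after length \<open>D / 2\<close>.
\<close>

lemma rdist_midpoint:
  assumes "rdist x y = ennreal D" "0 \<le> D" "0 < \<delta>"
  shows "\<exists>w. rdist x w \<le> ennreal (D / 2) \<and> rdist w y \<le> ennreal (D / 2 + \<delta>)"
proof -
  have "rdist x y < ennreal (D + \<delta>)" using assms by (simp add: ennreal_less_iff)
  then obtain L where L: "join x y L" "L < D + \<delta>"
    unfolding rdist_less_iff using joined_nonneg by (auto simp: ennreal_less_iff)
  have "ennreal D \<le> ennreal L" using rdist_le[OF L(1)] assms(1) by simp
  then have "D \<le> L" using joined_nonneg[OF L(1)] by (simp add: ennreal_le_iff)
  then obtain w where w: "join x w (D / 2)" "join w y (L - D / 2)"
    using joined_split[OF L(1), of "D / 2"] assms(2) by auto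
  have "rdist w y \<le> ennreal (L - D / 2)" by (rule rdist_le[OF w(2)])
  also have "\<dots> \<le> ennreal (D / 2 + \<delta>)" using L(2) by (intro ennreal_leI) simp
  finally show ?thesis using rdist_le[OF w(1)] by blast
qed

end

section \<open>The distance compared with norms in a chart\<close>

text \<open>
  A chart together with constants as provided by \<open>metric_local_constants\<close>: \<open>\<alpha>\<close> and \<open>\<beta>\<close> compare the metric
  norms with the Euclidean norm, and \<open>L\<close> bounds how fast the norms vary.
\<close>

locale chart_estimates = riemannian_manifold E A g
  for E :: "'e::euclidean_space set"
    and A :: "('a::{t2_space, second_countable_topology}, 'e) chart set"
    and g :: "('a, 'e) metric_tensor" +
  fixes c :: "('a, 'e) chart" and p :: 'a and R \<alpha> \<beta> L :: real
  assumes c: "c \<in> A" and p: "p \<in> fst c"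
    and pos: "0 < R" "0 < \<alpha>" "0 < \<beta>" "0 < L"
    and in_chart: "cball (snd c p) R \<inter> E \<subseteq> snd c ` fst c"
    and norm_bounds: "x \<in> cball (snd c p) R \<inter> E \<Longrightarrow> v \<in> E \<Longrightarrow>
      \<alpha> * norm v \<le> metric_norm c x v \<and> metric_norm c x v \<le> \<beta> * norm v"
    and norm_lipschitz: "x \<in> cball (snd c p) R \<inter> E \<Longrightarrow> y \<in> cball (snd c p) R \<inter> E \<Longrightarrow> v \<in> E \<Longrightarrow>
      \<bar>metric_norm c x v - metric_norm c y v\<bar> \<le> L * norm (x - y) * norm v"
begin

abbreviation "\<phi> \<equiv> snd c"
abbreviation "\<psi> \<equiv> inv_into (fst c) (snd c)"
abbreviation "N \<equiv> metric_norm c"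
abbreviation "K \<equiv> cball (snd c p) R \<inter> E"

definition chart_ball :: "'e \<Rightarrow> real \<Rightarrow> 'a set" where
  "chart_ball z \<rho> = {w \<in> fst c. norm (\<phi> w - z) < \<rho>}"

lemma N_represented:
  assumes "z \<in> K"
  shows "\<exists>T::'e \<Rightarrow> 'e. linear T \<and> (\<forall>v\<in>E. N z v = norm (T v))"
  using metric_norm_representation[OF c] assms in_chart by blast

lemma N_triangle:
  assumes "z \<in> K" "v \<in> E" "w \<in> E"
  shows "N z (v + w) \<le> N z v + N z w"
proof -
  obtain T :: "'e \<Rightarrow> 'e" where T: "linear T" "\<forall>v\<in>E. N z v = norm (T v)" using N_represented[OF assms(1)] by blast
  have "v + w \<in> E" using assms subspace_model by (intro subspace_add)
  then show ?thesis using T(2) assms(2,3) linear_add[OF T(1), of v w] norm_triangle_ineq[of "T v" "T w"] by simp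
qed

lemma open_chart_ball: "open (chart_ball z \<rho>)"
proof -
  have "chart_ball z \<rho> = fst c \<inter> \<phi> -` ball z \<rho>" by (auto simp: chart_ball_def dist_norm norm_minus_commute)
  then show ?thesis
    using continuous_open_preimage[OF chart_inverse(5)[OF c] open_chart_domain[OF c] open_ball[of z \<rho>]] by simp
qed

lemma compact_chart_cball:
  assumes "cball z \<rho> \<inter> E \<subseteq> K"
  shows "compact (\<psi> ` (cball z \<rho> \<inter> E))"
proof (rule compact_continuous_image)
  show "continuous_on (cball z \<rho> \<inter> E) \<psi>"
    by (rule continuous_on_subset[OF chart_inverse(6)[OF c]]) (use assms in_chart in blast)
  show "compact (cball z \<rho> \<inter> E)"
    by (rule compact_Int_closed[OF compact_cball closed_subspace[OF subspace_model]])
qed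

lemma convex_K: "convex K"
  by (rule convex_Int[OF convex_cball subspace_imp_convex[OF subspace_model]])

lemma segment_upper:
  assumes x: "x \<in> K" "norm (x - z) \<le> \<rho>" and y: "y \<in> K" "norm (y - z) \<le> \<rho>" and z: "z \<in> K"
  shows "\<exists>l. join (\<psi> x) (\<psi> y) l \<and> l \<le> N z (y - x) + L * \<rho> * norm (y - x)"
proof -
  define l where "l t = x + t *\<^sub>R (y - x)" for t :: real
  define \<gamma> where "\<gamma> t = \<psi> (l t)" for t
  have l: "l t = (1 - t) *\<^sub>R x + t *\<^sub>R y" for t by (simp add: l_def algebra_simps)
  have lK: "l t \<in> K" if t: "t \<in> {0..1}" for t
    unfolding l using t by (intro convexD[OF convex_K x(1) y(1)]) auto
  have lz: "norm (l t - z) \<le> \<rho>" if t: "t \<in> {0..1}" for t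
  proof -
    have "l t \<in> cball z \<rho>" unfolding l
      using t x y by (intro convexD[OF convex_cball]) (auto simp: dist_norm norm_minus_commute)
    then show ?thesis by (simp add: dist_norm norm_minus_commute)
  qed
  have lV: "l t \<in> \<phi> ` fst c" if t: "t \<in> {0..1}" for t using lK[OF t] in_chart by blast
  have contl: "continuous_on S l" for S unfolding l_def[abs_def] by (intro continuous_intros)
  have \<gamma>c: "\<gamma> t \<in> fst c" "\<phi> (\<gamma> t) = l t" if t: "t \<in> {0..1}" for t
    using chart_inverse(3,4)[OF c lV[OF t]] by (simp_all add: \<gamma>_def)
  have cont: "continuous_on {0..1} \<gamma>"
    unfolding \<gamma>_def[abs_def] by (rule continuous_on_compose2[OF chart_inverse(6)[OF c] contl]) (use lV in blast)
  have "((\<lambda>t. x + t *\<^sub>R (y - x)) has_derivative (\<lambda>h. 0 + h *\<^sub>R (y - x))) (at t within {0..1})" for t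
    by (rule has_derivative_add[OF has_derivative_const[of x]
          has_derivative_scaleR_left[OF has_derivative_ident]])
  then have "(l has_vector_derivative (y - x)) (at t within {0..1})" for t
    unfolding l_def[abs_def] has_vector_derivative_def by simp
  then have vc: "((\<phi> \<circ> \<gamma>) has_vector_derivative (y - x)) (at t within {0..1})" if t: "t \<in> {0..1}" for t
    by (rule has_vector_derivative_transform[OF t, rotated]) (simp add: \<gamma>c)
  have yx: "y - x \<in> E" using x y subspace_model by (auto intro: subspace_diff)
  have C1: "C1_curve_on A 0 1 \<gamma>"
    unfolding C1_curve_on_def
  proof (intro conjI ballI cont)
    fix d assume d: "d \<in> A"
    let ?T = "\<lambda>x. frechet_derivative (transition c d) (at x within transition_domain c d)"
    have vd: "((snd d \<circ> \<gamma>) has_vector_derivative ?T (l t) (y - x)) (at t within {0..1})"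
      if t: "t \<in> {0..1}" "\<gamma> t \<in> fst d" for t
      using coordinate_velocity_transforms[OF cont c d t(1) _ vc[OF t(1)]] \<gamma>c[OF t(1)] t(2) by simp
    show "(snd d \<circ> \<gamma>) differentiable (at t within {0..1})" if "t \<in> {0..1} \<inter> \<gamma> -` fst d" for t
      using vd[of t] that unfolding has_vector_derivative_def differentiable_def by blast
    have "Ck_on 1 E (transition_domain c d) (transition c d)"
      using smooth_transition[OF c d] unfolding smooth_on_def by blast
    then have ct: "continuous_on (transition_domain c d) (\<lambda>x. ?T x (y - x'))" if "y - x' \<in> E" for x'
      using that by simp
    have "continuous_on ({0..1} \<inter> \<gamma> -` fst d) (\<lambda>t. ?T (l t) (y - x))"
    proof (rule continuous_on_compose2[OF ct[OF yx] contl])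
      show "l ` ({0..1} \<inter> \<gamma> -` fst d) \<subseteq> transition_domain c d"
      proof
        fix u assume "u \<in> l ` ({0..1} \<inter> \<gamma> -` fst d)"
        then obtain t where t: "t \<in> {0..1}" "\<gamma> t \<in> fst d" "u = l t" by blast
        then have "u = \<phi> (\<gamma> t)" "\<gamma> t \<in> fst c \<inter> fst d" using \<gamma>c by simp_all
        then show "u \<in> transition_domain c d" unfolding transition_domain_def by blast
      qed
    qed
    then show "continuous_on ({0..1} \<inter> \<gamma> -` fst d) (velocity 0 1 \<gamma> d)"
    proof (rule continuous_on_eq)
      fix t assume t: "t \<in> {0..1} \<inter> \<gamma> -` fst d"
      have "velocity 0 1 \<gamma> d t = ?T (l t) (y - x)"
        by (rule vector_derivative_within_closed_interval[OF zero_less_one]) (use t vd in auto)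
      then show "?T (l t) (y - x) = velocity 0 1 \<gamma> d t" by simp
    qed
  qed
  have speed_le: "speed 0 1 \<gamma> t \<le> N z (y - x) + L * \<rho> * norm (y - x)" if t: "t \<in> {0..1}" for t
  proof -
    have "velocity 0 1 \<gamma> c t = y - x"
      by (rule vector_derivative_within_closed_interval[OF zero_less_one t vc[OF t]])
    then have "speed 0 1 \<gamma> t = N (l t) (y - x)"
      using speed_in_chart(1)[OF C1 zero_less_one c t] \<gamma>c[OF t] by simp
    also have "\<dots> \<le> N z (y - x) + L * norm (l t - z) * norm (y - x)"
      using norm_lipschitz[OF lK[OF t] z yx] by linarith
    also have "\<dots> \<le> N z (y - x) + L * \<rho> * norm (y - x)"
      using lz[OF t] pos by (intro add_left_mono mult_right_mono mult_left_mono) auto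
    finally show ?thesis .
  qed
  have "len 0 1 \<gamma> \<le> integral {0..1} (\<lambda>_::real. N z (y - x) + L * \<rho> * norm (y - x))"
    unfolding arc_length_def
    by (rule integral_le[OF integrable_speed[OF C1 zero_less_one] _ speed_le]) auto
  then have "len 0 1 \<gamma> \<le> N z (y - x) + L * \<rho> * norm (y - x)" by simp
  moreover have "join (\<gamma> 0) (\<gamma> 1) (len 0 1 \<gamma>)" by (rule joined_arc[OF zero_less_one C1])
  moreover have "\<gamma> 0 = \<psi> x" "\<gamma> 1 = \<psi> y" by (simp_all add: \<gamma>_def l_def)
  ultimately show ?thesis by auto
qed

text \<open>
  Along the arc the metric norm is at least \<open>1 - L * \<rho> / \<alpha>\<close> times the norm at \<open>z\<close>, and the integral of
  the norm of the velocity bounds the norm of the displacement.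
\<close>

lemma arc_lower:
  assumes C1: "C1_curve_on A a b \<gamma>" and ab: "a < b" and z: "z \<in> K"
    and stays: "\<And>t. t \<in> {a..b} \<Longrightarrow> \<gamma> t \<in> fst c \<and> \<phi> (\<gamma> t) \<in> K \<and> norm (\<phi> (\<gamma> t) - z) \<le> \<rho>"
    and \<kappa>: "0 < 1 - L * \<rho> / \<alpha>"
  shows "(1 - L * \<rho> / \<alpha>) * N z (\<phi> (\<gamma> b) - \<phi> (\<gamma> a)) \<le> len a b \<gamma>"
proof -
  let ?\<kappa> = "1 - L * \<rho> / \<alpha>"
  obtain T :: "'e \<Rightarrow> 'e" where T: "linear T" "\<forall>v\<in>E. N z v = norm (T v)" using N_represented[OF z] by blast
  have bl: "bounded_linear T" using T(1) by (simp add: linear_conv_bounded_linear)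
  have vel: "((\<lambda>s. T ((\<phi> \<circ> \<gamma>) s)) has_vector_derivative T (velocity a b \<gamma> c t)) (at t within {a..b})"
    if t: "t \<in> {a..b}" for t
    by (rule bounded_linear.has_vector_derivative[OF bl C1_curve_onD(2)[OF C1 c t]]) (use stays[OF t] in blast)
  have "((\<lambda>t. T (velocity a b \<gamma> c t)) has_integral (T ((\<phi> \<circ> \<gamma>) b) - T ((\<phi> \<circ> \<gamma>) a))) {a..b}"
    by (rule fundamental_theorem_of_calculus[OF less_imp_le[OF ab] vel])
  then have int: "((\<lambda>t. T (velocity a b \<gamma> c t)) has_integral T (\<phi> (\<gamma> b) - \<phi> (\<gamma> a))) {a..b}"
    by (simp add: linear_diff[OF T(1)])
  have le: "norm (T (velocity a b \<gamma> c t)) \<le> (1 / ?\<kappa>) * speed a b \<gamma> t" if t: "t \<in> {a..b}" for t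
  proof -
    let ?v = "velocity a b \<gamma> c t"
    have st: "\<gamma> t \<in> fst c" "\<phi> (\<gamma> t) \<in> K" "norm (\<phi> (\<gamma> t) - z) \<le> \<rho>" using stays[OF t] by auto
    have vE: "?v \<in> E" by (rule speed_in_chart(2)[OF C1 ab c t st(1)])
    have "N z ?v - N (\<phi> (\<gamma> t)) ?v \<le> L * norm (\<phi> (\<gamma> t) - z) * norm ?v"
      using norm_lipschitz[OF st(2) z vE] by linarith
    also have "\<dots> \<le> L * \<rho> * norm ?v"
      using st(3) pos by (intro mult_right_mono mult_left_mono) auto
    also have "\<dots> \<le> L * \<rho> * (N z ?v / \<alpha>)"
    proof (rule mult_left_mono)
      show "norm ?v \<le> N z ?v / \<alpha>" using norm_bounds[OF z vE] pos by (simp add: field_simps)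
      have "0 \<le> \<rho>" using st(3) norm_ge_zero order_trans by blast
      then show "0 \<le> L * \<rho>" using pos by simp
    qed
    finally have "?\<kappa> * N z ?v \<le> N (\<phi> (\<gamma> t)) ?v" by (simp add: algebra_simps)
    also have "\<dots> = speed a b \<gamma> t" using speed_in_chart(1)[OF C1 ab c t st(1)] by simp
    finally have "N z ?v \<le> speed a b \<gamma> t / ?\<kappa>" using \<kappa> by (simp add: pos_le_divide_eq mult.commute)
    then show ?thesis using T(2) vE by simp
  qed
  have int2: "((\<lambda>t. (1 / ?\<kappa>) * speed a b \<gamma> t) has_integral (1 / ?\<kappa>) * len a b \<gamma>) {a..b}"
    unfolding arc_length_def by (rule has_integral_mult_right[OF integrable_integral[OF integrable_speed[OF C1 ab]]])
  have "norm (T (\<phi> (\<gamma> b) - \<phi> (\<gamma> a))) \<le> (1 / ?\<kappa>) * len a b \<gamma>"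
    using Henstock_Kurzweil_Integration.integral_norm_bound_integral[OF has_integral_integrable[OF int]
        has_integral_integrable[OF int2] le]
    unfolding integral_unique[OF int] integral_unique[OF int2] .
  moreover have "\<phi> (\<gamma> b) - \<phi> (\<gamma> a) \<in> E" using stays[of a] stays[of b] ab subspace_model by (auto intro: subspace_diff)
  ultimately have "N z (\<phi> (\<gamma> b) - \<phi> (\<gamma> a)) \<le> len a b \<gamma> / ?\<kappa>" using T(2) by simp
  then show ?thesis using \<kappa> by (simp add: pos_le_divide_eq mult.commute)
qed

text \<open>
  Either the chain stays in the coordinate ball, and \<open>arc_lower\<close> applies to each of its arcs, or it
  leaves the ball at a first parameter \<open>\<tau>\<close>, and already the part up to \<open>\<tau>\<close> is long.
\<close>

lemma joined_lower:
  assumes z: "z \<in> K" and ball: "cball z \<rho> \<inter> E \<subseteq> K" and \<kappa>: "0 < 1 - L * \<rho> / \<alpha>"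
    and xy: "join x y l" and x: "x \<in> chart_ball z \<rho>"
  shows "(y \<in> chart_ball z \<rho> \<and> (1 - L * \<rho> / \<alpha>) * N z (\<phi> y - \<phi> x) \<le> l) \<or>
    (1 - L * \<rho> / \<alpha>) * \<alpha> * (\<rho> - norm (\<phi> x - z)) \<le> l"
  using xy x
proof (induction rule: joined.induct)
  case (joined_refl x)
  have "N z 0 = 0" using norm_bounds[OF z subspace_0[OF subspace_model]] by simp
  then show ?case using joined_refl by simp
next
  case (joined_step x \<gamma> a l b)
  let ?\<kappa> = "1 - L * \<rho> / \<alpha>"
  let ?O = "chart_ball z \<rho>"
  note C1 = joined_step(3) and ab = joined_step(2)
  have len0: "0 \<le> len a b \<gamma>" by (rule length_nonneg[OF C1 ab])
  have \<phi>E: "\<phi> w \<in> E" if "w \<in> fst c" for w by (rule chart_inverse(2)[OF c that])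
  have stays: "\<gamma> t \<in> fst c \<and> \<phi> (\<gamma> t) \<in> K \<and> norm (\<phi> (\<gamma> t) - z) \<le> \<rho>"
    if t: "\<gamma> t \<in> \<psi> ` (cball z \<rho> \<inter> E)" for t
  proof -
    obtain u where u: "u \<in> cball z \<rho> \<inter> E" "\<gamma> t = \<psi> u" using t by blast
    have "u \<in> \<phi> ` fst c" using u(1) ball in_chart by blast
    then have "\<gamma> t \<in> fst c" "\<phi> (\<gamma> t) = u" using chart_inverse(3,4)[OF c] u(2) by simp_all
    then show ?thesis using u(1) ball by (auto simp: dist_norm norm_minus_commute)
  qed
  have O_sub: "w \<in> \<psi> ` (cball z \<rho> \<inter> E)" if w: "w \<in> ?O" for w
  proof -
    have "w = \<psi> (\<phi> w)" using chart_inverse(1)[OF c] w by (simp add: chart_ball_def)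
    moreover have "\<phi> w \<in> cball z \<rho> \<inter> E"
      using w \<phi>E by (auto simp: chart_ball_def dist_norm norm_minus_commute)
    ultimately show ?thesis by blast
  qed
  show ?case
  proof (cases "?\<kappa> * \<alpha> * (\<rho> - norm (\<phi> x - z)) \<le> l")
    case True
    then show ?thesis using len0 by simp
  next
    case False
    then have start: "\<gamma> a \<in> ?O" "?\<kappa> * N z (\<phi> (\<gamma> a) - \<phi> x) \<le> l" using joined_step.IH joined_step.prems by blast+
    have xc: "x \<in> fst c" "\<gamma> a \<in> fst c" using joined_step.prems start(1) by (simp_all add: chart_ball_def)
    \<comment> \<open>travelling inside the ball up to a parameter costs at least the comparison norm\<close>
    have travel: "?\<kappa> * N z (\<phi> (\<gamma> \<tau>) - \<phi> x) \<le> l + len a \<tau> \<gamma>"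
      if \<tau>: "a < \<tau>" "\<tau> \<le> b" and inside: "\<And>t. t \<in> {a..\<tau>} \<Longrightarrow> \<gamma> t \<in> \<psi> ` (cball z \<rho> \<inter> E)" for \<tau>
    proof -
      have 1: "?\<kappa> * N z (\<phi> (\<gamma> \<tau>) - \<phi> (\<gamma> a)) \<le> len a \<tau> \<gamma>"
        by (rule arc_lower[OF restrict_arc(1)[OF C1 order_refl \<tau>] \<tau>(1) z stays[OF inside] \<kappa>])
      have "\<gamma> \<tau> \<in> fst c" using stays[OF inside, of \<tau>] \<tau> by simp
      then have "\<phi> (\<gamma> \<tau>) - \<phi> (\<gamma> a) \<in> E" "\<phi> (\<gamma> a) - \<phi> x \<in> E"
        using \<phi>E xc subspace_model by (auto intro: subspace_diff)
      from N_triangle[OF z this]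
      have "?\<kappa> * N z (\<phi> (\<gamma> \<tau>) - \<phi> x) \<le> ?\<kappa> * (N z (\<phi> (\<gamma> \<tau>) - \<phi> (\<gamma> a)) + N z (\<phi> (\<gamma> a) - \<phi> x))"
        using \<kappa> by (intro mult_left_mono) auto
      also have "\<dots> = ?\<kappa> * N z (\<phi> (\<gamma> \<tau>) - \<phi> (\<gamma> a)) + ?\<kappa> * N z (\<phi> (\<gamma> a) - \<phi> x)"
        by (rule distrib_left)
      finally show ?thesis using 1 start(2) by linarith
    qed
    show ?thesis
    proof (cases "\<forall>t\<in>{a..b}. \<gamma> t \<in> ?O")
      case True
      then have "?\<kappa> * N z (\<phi> (\<gamma> b) - \<phi> x) \<le> l + len a b \<gamma>"
        using O_sub by (intro travel[OF ab order_refl]) blast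
      moreover have "\<gamma> b \<in> ?O" using True ab by simp
      ultimately show ?thesis by blast
    next
      case False
      define S where "S = {a..b} \<inter> \<gamma> -` (- ?O)"
      have "closed S"
        unfolding S_def
        by (rule continuous_closed_preimage[OF C1_curve_onD(1)[OF C1] closed_atLeastAtMost
              closed_Compl[OF open_chart_ball]])
      have S: "S \<noteq> {}" "bdd_below S" using False by (auto simp: S_def)
      define \<tau> where "\<tau> = Inf S"
      have \<tau>S: "\<tau> \<in> S" unfolding \<tau>_def by (rule closed_contains_Inf[OF S \<open>closed S\<close>])
      then have "\<tau> \<noteq> a" using start(1) by (auto simp: S_def)
      then have \<tau>: "a < \<tau>" "\<tau> \<le> b" using \<tau>S by (auto simp: S_def)
      have before: "\<gamma> t \<in> ?O" if t: "t \<in> {a..<\<tau>}" for t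
      proof (rule ccontr)
        assume "\<gamma> t \<notin> ?O"
        then have "t \<in> S" using t \<tau>(2) by (simp add: S_def)
        then have "\<tau> \<le> t" unfolding \<tau>_def by (rule cInf_lower[OF _ S(2)])
        then show False using t by simp
      qed
      have cont\<tau>: "continuous_on {a..\<tau>} \<gamma>"
        using continuous_on_subset[OF C1_curve_onD(1)[OF C1]] \<tau> by auto
      have clK: "closed (\<psi> ` (cball z \<rho> \<inter> E))" by (rule compact_imp_closed[OF compact_chart_cball[OF ball]])
      have "\<gamma> ` closure {a..<\<tau>} \<subseteq> \<psi> ` (cball z \<rho> \<inter> E)"
      proof (rule image_closure_subset[OF _ clK])
        show "continuous_on (closure {a..<\<tau>}) \<gamma>" using cont\<tau> \<tau>(1) by simp
        show "\<gamma> ` {a..<\<tau>} \<subseteq> \<psi> ` (cball z \<rho> \<inter> E)" using before O_sub by blast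
      qed
      then have inside: "\<gamma> t \<in> \<psi> ` (cball z \<rho> \<inter> E)" if "t \<in> {a..\<tau>}" for t
        using that \<tau>(1) by auto
      note exit = stays[OF inside, of \<tau>]
      have "norm (\<phi> (\<gamma> \<tau>) - z) = \<rho>"
        using exit \<tau>S \<tau>(1) by (auto simp: S_def chart_ball_def)
      then have "\<rho> - norm (\<phi> x - z) \<le> norm (\<phi> (\<gamma> \<tau>) - \<phi> x)"
        using norm_triangle_ineq[of "\<phi> (\<gamma> \<tau>) - \<phi> x" "\<phi> x - z"] by simp
      then have "\<alpha> * (\<rho> - norm (\<phi> x - z)) \<le> \<alpha> * norm (\<phi> (\<gamma> \<tau>) - \<phi> x)"
        using pos by (intro mult_left_mono) auto
      also have "\<dots> \<le> N z (\<phi> (\<gamma> \<tau>) - \<phi> x)"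
        using norm_bounds[OF z, of "\<phi> (\<gamma> \<tau>) - \<phi> x"] exit \<tau>(1) \<phi>E xc subspace_model
        by (auto intro: subspace_diff)
      finally have "?\<kappa> * (\<alpha> * (\<rho> - norm (\<phi> x - z))) \<le> ?\<kappa> * N z (\<phi> (\<gamma> \<tau>) - \<phi> x)"
        using \<kappa> by (intro mult_left_mono) auto
      also have "\<dots> \<le> l + len a \<tau> \<gamma>" by (rule travel[OF \<tau> inside])
      also have "len a \<tau> \<gamma> \<le> len a b \<gamma>"
      proof (cases "\<tau> = b")
        case False
        then have "\<tau> < b" using \<tau>(2) by simp
        from length_split[OF C1 \<tau>(1) this] length_nonneg[OF restrict_arc(1)[OF C1 less_imp_le[OF \<tau>(1)] this order_refl] this]
        show ?thesis by simp
      qed simp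
      finally show ?thesis by (simp add: mult.assoc)
    qed
  qed
qed

end

context riemannian_manifold
begin

lemma chart_estimates_exist:
  assumes "c \<in> A" "p \<in> fst c"
  shows "\<exists>R \<alpha> \<beta> L. chart_estimates E A g c p R \<alpha> \<beta> L"
proof (rule metric_local_constants[OF assms])
  fix R \<alpha> \<beta> L :: real
  assume "0 < R" "0 < \<alpha>" "0 < \<beta>" "0 < L" "cball (snd c p) R \<inter> E \<subseteq> snd c ` fst c"
    "\<And>x v. x \<in> cball (snd c p) R \<inter> E \<Longrightarrow> v \<in> E \<Longrightarrow> \<alpha> * norm v \<le> metric_norm c x v \<and> metric_norm c x v \<le> \<beta> * norm v"
    "\<And>x y v. x \<in> cball (snd c p) R \<inter> E \<Longrightarrow> y \<in> cball (snd c p) R \<inter> E \<Longrightarrow> v \<in> E \<Longrightarrow>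
      \<bar>metric_norm c x v - metric_norm c y v\<bar> \<le> L * norm (x - y) * norm v"
  then have "chart_estimates E A g c p R \<alpha> \<beta> L"
    by (intro chart_estimates.intro chart_estimates_axioms.intro riemannian_manifold_axioms assms)
  then show ?thesis by blast
qed

end

section \<open>The directional condition for geodesic balls\<close>

context chart_estimates
begin

lemma cball_in_K:
  assumes "norm (\<phi> z - \<phi> p) < R / 2" "\<rho> \<le> R / 2"
  shows "cball (\<phi> z) \<rho> \<inter> E \<subseteq> K"
proof
  fix x assume x: "x \<in> cball (\<phi> z) \<rho> \<inter> E"
  have "dist (\<phi> p) x \<le> dist (\<phi> p) (\<phi> z) + dist (\<phi> z) x" by (rule dist_triangle)
  also have "\<dots> \<le> R" using assms x by (simp add: dist_norm norm_minus_commute)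
  finally show "x \<in> K" using x by simp
qed

text \<open>
  A chain that leaves the coordinate ball has length at least \<open>\<alpha> * \<rho> / 2\<close>.
\<close>

lemma captured:
  assumes z: "z \<in> fst c" "norm (\<phi> z - \<phi> p) < R / 2" and \<rho>: "0 < \<rho>" "\<rho> \<le> R / 2" "L * \<rho> / \<alpha> \<le> 1/2"
    and x: "rdist z x < ennreal (\<alpha> * \<rho> / 2)"
  shows "x \<in> chart_ball (\<phi> z) \<rho>"
proof -
  have zK: "\<phi> z \<in> K"
    using z chart_inverse(2)[OF c z(1)] pos by (simp add: dist_norm norm_minus_commute)
  have z0: "z \<in> chart_ball (\<phi> z) \<rho>" using z(1) \<rho>(1) by (simp add: chart_ball_def)
  obtain l where l: "join z x l" "ennreal l < ennreal (\<alpha> * \<rho> / 2)" using x unfolding rdist_less_iff by blast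
  have l2: "l < \<alpha> * \<rho> / 2" using l(2) joined_nonneg[OF l(1)] by (simp add: ennreal_less_iff)
  have "0 < 1 - L * \<rho> / \<alpha>" using \<rho>(3) by linarith
  from joined_lower[OF zK cball_in_K[OF z(2) \<rho>(2)] this l(1) z0]
  show ?thesis
  proof
    assume "(1 - L * \<rho> / \<alpha>) * \<alpha> * (\<rho> - norm (\<phi> z - \<phi> z)) \<le> l"
    then have "(1 - L * \<rho> / \<alpha>) * (\<alpha> * \<rho>) \<le> l" by (simp add: mult.assoc)
    moreover have "1/2 * (\<alpha> * \<rho>) \<le> (1 - L * \<rho> / \<alpha>) * (\<alpha> * \<rho>)"
      using \<rho> pos by (intro mult_right_mono) auto
    ultimately have "1/2 * (\<alpha> * \<rho>) \<le> l" by linarith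
    then show ?thesis using l2 by simp
  qed blast
qed

text \<open>
  All points at distance at most \<open>s\<close> from the centre lie in the coordinate ball of radius
  \<open>\<rho> = 4 * s / \<alpha>\<close>. A chain between two points of this ball that leaves the concentric ball of radius
  \<open>spread * \<rho>\<close> is, up to the error in comparing the metrics, no shorter than the norm of their
  difference. So it suffices to compare the metrics on the larger ball, where the metric norms differ
  by a relative error of at most \<open>distortion * s\<close>.
\<close>

definition spread :: real where "spread = 1 + 2 * \<beta> / \<alpha>"
definition distortion :: real where "distortion = 4 * L * spread / (\<alpha> * \<alpha>)"

lemma spread_ge_1: "1 \<le> spread" using pos by (simp add: spread_def)

lemma distortion_pos: "0 < distortion"
  using pos spread_ge_1 unfolding distortion_def by (intro divide_pos_pos mult_pos_pos) auto

text \<open>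
  The upper bound is the length of the coordinate segment; the lower bound is \<open>joined_lower\<close> in the
  ball of radius \<open>spread * \<rho>\<close>.
\<close>

lemma rdist_near:
  assumes z: "z \<in> fst c" "norm (\<phi> z - \<phi> p) < R / 2"
    and s: "0 < s" "spread * (4 * s / \<alpha>) \<le> R / 2" "distortion * s \<le> 1/2"
    and x: "rdist z x \<le> ennreal s" and y: "rdist z y \<le> ennreal s"
  shows "x \<in> fst c" and "y \<in> fst c"
    and "ennreal ((1 - distortion * s) * N (\<phi> z) (\<phi> x - \<phi> y)) \<le> rdist x y"
    and "rdist x y \<le> ennreal ((1 + distortion * s) * N (\<phi> z) (\<phi> x - \<phi> y))"
proof -
  define \<rho> where "\<rho> = 4 * s / \<alpha>"
  have \<rho>: "0 < \<rho>" using s(1) pos by (simp add: \<rho>_def)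
  have \<rho>_le: "\<rho> \<le> spread * \<rho>" using mult_right_mono[OF spread_ge_1, of \<rho>] \<rho> by simp
  have \<rho>R: "spread * \<rho> \<le> R / 2" "\<rho> \<le> R / 2" using s(2) \<rho>_le by (simp_all add: \<rho>_def)
  have dist_eq: "L * (spread * \<rho>) / \<alpha> = distortion * s" by (simp add: \<rho>_def distortion_def)
  have "L * \<rho> / \<alpha> \<le> L * (spread * \<rho>) / \<alpha>" using \<rho>_le pos by (intro divide_right_mono mult_left_mono) auto
  then have L\<rho>: "L * \<rho> / \<alpha> \<le> distortion * s" "L * \<rho> / \<alpha> \<le> 1/2" using s(3) dist_eq by linarith+
  have "ennreal s < ennreal (\<alpha> * \<rho> / 2)" using s(1) pos by (simp add: \<rho>_def ennreal_less_iff)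
  then have xO: "x \<in> chart_ball (\<phi> z) \<rho>" and yO: "y \<in> chart_ball (\<phi> z) \<rho>"
    using captured[OF z \<rho> \<rho>R(2) L\<rho>(2)] x y order_le_less_trans by blast+
  then show xy: "x \<in> fst c" "y \<in> fst c" by (simp_all add: chart_ball_def)
  have near: "norm (\<phi> x - \<phi> z) < \<rho>" "norm (\<phi> y - \<phi> z) < \<rho>" using xO yO by (simp_all add: chart_ball_def)
  have E: "\<phi> x \<in> E" "\<phi> y \<in> E" "\<phi> z \<in> E" using xy z(1) chart_inverse(2)[OF c] by auto
  have zK: "\<phi> z \<in> K" using z E pos by (simp add: dist_norm norm_minus_commute)
  have "\<phi> x \<in> cball (\<phi> z) \<rho> \<inter> E" "\<phi> y \<in> cball (\<phi> z) \<rho> \<inter> E"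
    using near E by (simp_all add: dist_norm norm_minus_commute)
  then have xyK: "\<phi> x \<in> K" "\<phi> y \<in> K" using cball_in_K[OF z(2) \<rho>R(2)] by blast+
  have dE: "\<phi> y - \<phi> x \<in> E" using E subspace_model by (intro subspace_diff)
  obtain T :: "'e \<Rightarrow> 'e" where T: "linear T" "\<forall>v\<in>E. N (\<phi> z) v = norm (T v)" using N_represented[OF zK] by blast
  have "T (\<phi> x - \<phi> y) = - T (\<phi> y - \<phi> x)" using linear_diff[OF T(1)] by simp
  moreover have "\<phi> x - \<phi> y \<in> E" using E subspace_model by (intro subspace_diff)
  ultimately have N_sym: "N (\<phi> z) (\<phi> x - \<phi> y) = N (\<phi> z) (\<phi> y - \<phi> x)" using T(2) dE by simp
  let ?n = "N (\<phi> z) (\<phi> y - \<phi> x)"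
  have n: "\<alpha> * norm (\<phi> y - \<phi> x) \<le> ?n" "?n \<le> \<beta> * norm (\<phi> y - \<phi> x)" "0 \<le> ?n"
    using norm_bounds[OF zK dE] T(2) dE by auto
  have d2: "norm (\<phi> y - \<phi> x) \<le> 2 * \<rho>"
    using norm_triangle_ineq4[of "\<phi> y - \<phi> z" "\<phi> x - \<phi> z"] near by simp
  have \<kappa>: "0 < 1 - L * (spread * \<rho>) / \<alpha>" unfolding dist_eq using s(3) by simp
  have xO': "x \<in> chart_ball (\<phi> z) (spread * \<rho>)" using xy near \<rho>_le by (simp add: chart_ball_def)
  have lower: "(1 - distortion * s) * ?n \<le> l" if l: "join x y l" for l
    using joined_lower[OF zK cball_in_K[OF z(2) \<rho>R(1)] \<kappa> l xO'] unfolding dist_eq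
  proof
    assume far: "(1 - distortion * s) * \<alpha> * (spread * \<rho> - norm (\<phi> x - \<phi> z)) \<le> l"
    have "?n \<le> \<beta> * (2 * \<rho>)" using n(2) d2 pos by (meson mult_left_mono less_imp_le order_trans)
    also have "\<dots> = \<alpha> * (spread * \<rho> - \<rho>)" using pos by (simp add: spread_def field_simps)
    also have "\<dots> \<le> \<alpha> * (spread * \<rho> - norm (\<phi> x - \<phi> z))" using near pos by (intro mult_left_mono) auto
    finally have "(1 - distortion * s) * ?n \<le> (1 - distortion * s) * (\<alpha> * (spread * \<rho> - norm (\<phi> x - \<phi> z)))"
      using s(3) by (intro mult_left_mono) auto
    then show ?thesis using far by (simp add: mult.assoc)
  qed blast
  show "ennreal ((1 - distortion * s) * N (\<phi> z) (\<phi> x - \<phi> y)) \<le> rdist x y"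
    unfolding N_sym
  proof (rule ccontr)
    assume "\<not> ennreal ((1 - distortion * s) * ?n) \<le> rdist x y"
    then have "rdist x y < ennreal ((1 - distortion * s) * ?n)" by simp
    then obtain l where l: "join x y l" "ennreal l < ennreal ((1 - distortion * s) * ?n)"
      unfolding rdist_less_iff by blast
    then show False using ennreal_leI[OF lower[OF l(1)]] by simp
  qed
  have "norm (\<phi> x - \<phi> z) \<le> \<rho>" "norm (\<phi> y - \<phi> z) \<le> \<rho>" using near by auto
  from segment_upper[OF xyK(1) this(1) xyK(2) this(2) zK]
  obtain l where l: "join x y l" "l \<le> ?n + L * \<rho> * norm (\<phi> y - \<phi> x)"
    using chart_inverse(1)[OF c xy(1)] chart_inverse(1)[OF c xy(2)] by auto
  have "norm (\<phi> y - \<phi> x) \<le> ?n / \<alpha>" using n(1) pos by (simp add: field_simps)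
  then have "L * \<rho> * norm (\<phi> y - \<phi> x) \<le> L * \<rho> * (?n / \<alpha>)" using pos \<rho> by (intro mult_left_mono) auto
  also have "\<dots> = (L * \<rho> / \<alpha>) * ?n" by simp
  also have "\<dots> \<le> (distortion * s) * ?n" by (rule mult_right_mono[OF L\<rho>(1) n(3)])
  finally have "l \<le> (1 + distortion * s) * ?n" using l(2) by (simp add: distrib_right)
  then show "rdist x y \<le> ennreal ((1 + distortion * s) * N (\<phi> z) (\<phi> x - \<phi> y))"
    unfolding N_sym using rdist_le[OF l(1)] ennreal_leI order_trans by blast
qed

text \<open>
  With \<open>T\<close> mapping the metric norm at \<open>z\<close> to the Euclidean norm, the class of a point is given by an
  element of the net \<open>Q\<close> close to the direction of \<open>T (\<phi> x - \<phi> z)\<close>. The net, and hence the number of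
  classes, does not depend on \<open>z\<close>.
\<close>

lemma cone_bounded_near:
  fixes r :: real and Q :: "'e set"
  assumes r: "0 < r" "spread * (4 * r / \<alpha>) \<le> R / 2" "distortion * r \<le> 1/10^6"
    and Q: "finite Q" "cball (0::'e) 1 \<subseteq> (\<Union>q\<in>Q. ball q (1/32))"
  shows "cone_bounded rdist (chart_ball (\<phi> p) (R / 2)) r (card Q)"
  unfolding cone_bounded_def
proof
  fix z assume "z \<in> chart_ball (\<phi> p) (R / 2)"
  then have z: "z \<in> fst c" "norm (\<phi> z - \<phi> p) < R / 2" by (simp_all add: chart_ball_def)
  have zE: "\<phi> z \<in> E" by (rule chart_inverse(2)[OF c z(1)])
  have zK: "\<phi> z \<in> K" using z zE pos by (simp add: dist_norm norm_minus_commute)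
  obtain T :: "'e \<Rightarrow> 'e" where T: "linear T" "\<forall>v\<in>E. N (\<phi> z) v = norm (T v)" using N_represented[OF zK] by blast
  define u where "u x = T (\<phi> x - \<phi> z)" for x
  define X where "X = {x. rdist z x < ennreal r}"
  define D where "D x y = enn2real (rdist x y)" for x y
  have zX: "z \<in> X" using r(1) by (simp add: X_def rdist_refl)
  have D0: "D z z = 0" "u z = 0" using linear_0[OF T(1)] by (simp_all add: D_def rdist_refl u_def)
  have Dnn: "0 \<le> D x y" for x y by (simp add: D_def)
  have Dsym: "D x y = D y x" for x y unfolding D_def by (simp only: rdist_sym)
  have fin: "rdist x y = ennreal (D x y)" if "x \<in> X" "y \<in> X" for x y
  proof -
    have "rdist x y \<le> rdist z x + rdist z y" using rdist_triangle[of x y z] rdist_sym[of x z] by simp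
    also have "\<dots> < top" using that by (auto simp: X_def intro: order_less_trans)
    finally show ?thesis unfolding D_def by (rule ennreal_enn2real[symmetric])
  qed
  have Dr: "D z x < r" if "x \<in> X" for x
    using that fin[OF zX that] Dnn by (simp add: X_def ennreal_less_iff)
  have tri: "D x w \<le> D x y + D y w" if "x \<in> X" "y \<in> X" "w \<in> X" for x y w
  proof -
    have "ennreal (D x w) \<le> ennreal (D x y) + ennreal (D y w)"
      using rdist_triangle[of x w y] fin that by metis
    then show ?thesis using Dnn by (simp add: ennreal_plus[symmetric] del: ennreal_plus)
  qed
  have near: "\<bar>D x y - norm (u x - u y)\<bar> \<le> distortion * s * norm (u x - u y)"
    if xy: "x \<in> X" "y \<in> X" and s: "0 < s" "s < r" "D z x \<le> s" "D z y \<le> s" for s x y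
  proof -
    have "4 * s / \<alpha> \<le> 4 * r / \<alpha>" using s pos by (intro divide_right_mono) auto
    then have "spread * (4 * s / \<alpha>) \<le> spread * (4 * r / \<alpha>)" using spread_ge_1 by (intro mult_left_mono) auto
    then have s1: "spread * (4 * s / \<alpha>) \<le> R / 2" using r(2) by linarith
    have "distortion * s \<le> distortion * r" using s distortion_pos by (intro mult_left_mono) auto
    then have s2: "distortion * s \<le> 1/2" using r(3) by (simp add: field_simps)
    have "rdist z x \<le> ennreal s" "rdist z y \<le> ennreal s"
      using fin[OF zX] xy s by (simp_all add: ennreal_leI)
    note rn = rdist_near[OF z s(1) s1 s2 this]
    have E: "\<phi> x \<in> E" "\<phi> y \<in> E" using rn(1,2) chart_inverse(2)[OF c] by auto
    have "u x - u y = T (\<phi> x - \<phi> y)" unfolding u_def using linear_diff[OF T(1)] by simp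
    moreover have "\<phi> x - \<phi> y \<in> E" using E subspace_model by (intro subspace_diff)
    ultimately have N_eq: "N (\<phi> z) (\<phi> x - \<phi> y) = norm (u x - u y)" using T(2) by simp
    have "(1 - distortion * s) * norm (u x - u y) \<le> D x y"
      using rn(3) Dnn unfolding N_eq fin[OF xy] by (simp add: ennreal_le_iff)
    moreover have "D x y \<le> (1 + distortion * s) * norm (u x - u y)"
      using rn(4) distortion_pos s(1) unfolding N_eq fin[OF xy] by (simp add: ennreal_le_iff)
    ultimately show ?thesis by (simp add: abs_le_iff algebra_simps)
  qed
  have mid: "\<exists>y\<in>X. D z y \<le> D z x / 2 \<and> D y x \<le> D z x / 2 + \<delta>" if x: "x \<in> X" and \<delta>: "0 < \<delta>" for x \<delta>
  proof -
    obtain w where w: "rdist z w \<le> ennreal (D z x / 2)" "rdist w x \<le> ennreal (D z x / 2 + \<delta>)"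
      using rdist_midpoint[OF fin[OF zX x] Dnn \<delta>] by blast
    have "ennreal (D z x / 2) < ennreal r" using Dr[OF x] Dnn[of z x] r(1) by (simp add: ennreal_less_iff)
    then have wX: "w \<in> X" using w(1) by (simp add: X_def)
    have "D z w \<le> D z x / 2"
      using w(1) Dnn[of z x] unfolding fin[OF zX wX] by (simp add: ennreal_le_iff)
    moreover have "D w x \<le> D z x / 2 + \<delta>"
      using w(2) Dnn[of z x] \<delta> unfolding fin[OF wX x] by (subst (asm) ennreal_le_iff) auto
    ultimately show ?thesis using wX by blast
  qed
  obtain h where h: "bij_betw h Q {0..<card Q}" using ex_bij_betw_finite_nat[OF Q(1)] by blast
  define \<kappa> where "\<kappa> x = h (SOME q. q \<in> Q \<and> sgn (u x) \<in> ball q (1/32))" for x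
  have some: "(SOME q. q \<in> Q \<and> sgn (u x) \<in> ball q (1/32)) \<in> Q \<and>
      sgn (u x) \<in> ball (SOME q. q \<in> Q \<and> sgn (u x) \<in> ball q (1/32)) (1/32)" for x
  proof (rule someI_ex)
    have "sgn (u x) \<in> cball 0 1" by (simp add: norm_sgn)
    then show "\<exists>q. q \<in> Q \<and> sgn (u x) \<in> ball q (1/32)" using Q(2) by blast
  qed
  show "\<exists>\<kappa>. (\<forall>x. \<kappa> x < card Q) \<and> (\<forall>x y. rdist x z < ennreal r \<longrightarrow> rdist y z \<le> rdist x z \<longrightarrow>
      \<kappa> x = (\<kappa> y::nat) \<longrightarrow> rdist x y + rdist y z / 2 \<le> rdist x z)"
  proof (intro exI[of _ \<kappa>] conjI allI impI)
    show "\<kappa> x < card Q" for x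
      using bij_betwE[OF h] some[of x] by (simp add: \<kappa>_def)
    fix x y assume xz: "rdist x z < ennreal r" and yz: "rdist y z \<le> rdist x z" and eq: "\<kappa> x = \<kappa> y"
    have X: "x \<in> X" "y \<in> X" using xz yz rdist_sym by (auto simp: X_def)
    have Dle: "D z y \<le> D z x"
      using yz Dnn unfolding rdist_sym[of y z] rdist_sym[of x z] fin[OF zX X(1)] fin[OF zX X(2)]
      by (simp add: ennreal_le_iff)
    have half: "ennreal t / 2 = ennreal (t / 2)" if "0 \<le> t" for t
      using divide_ennreal[of t 2] that by simp
    have "D x y \<le> D z x - D z y / 2"
    proof (cases "D z y = 0")
      case True
      then show ?thesis using tri[OF X(1) zX X(2)] Dsym[of x z] by simp
    next
      case False
      then have "0 < D z y" using Dnn[of z y] by simp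
      define q where "q = (SOME q. q \<in> Q \<and> sgn (u x) \<in> ball q (1/32))"
      have "inj_on h Q" using h by (rule bij_betw_imp_inj_on)
      then have "q = (SOME q. q \<in> Q \<and> sgn (u y) \<in> ball q (1/32))"
        using eq some[of x] some[of y] unfolding \<kappa>_def q_def by (auto dest: inj_onD)
      then have "dist q (sgn (u x)) < 1/32" "dist q (sgn (u y)) < 1/32"
        using some[of x] some[of y] by (simp_all add: q_def)
      then have dir: "norm (sgn (u y) - sgn (u x)) \<le> 1/16"
        using dist_triangle3[of "sgn (u y)" "sgn (u x)" q] by (simp add: dist_norm)
      show ?thesis
        by (rule same_direction_closer[OF distortion_pos r(3) zX Dr D0 Dnn Dsym tri near mid X Dle \<open>0 < D z y\<close> dir])
    qed
    then have "D x y + D z y / 2 \<le> D z x" by simp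
    then have "ennreal (D x y) + ennreal (D z y / 2) \<le> ennreal (D z x)"
      using Dnn by (simp add: ennreal_plus[symmetric] ennreal_leI del: ennreal_plus)
    then show "rdist x y + rdist y z / 2 \<le> rdist x z"
      unfolding rdist_sym[of y z] rdist_sym[of x z] fin[OF zX X(1)] fin[OF zX X(2)] fin[OF X] half[OF Dnn] .
  qed
qed

lemma cone_neighbourhood:
  "\<exists>W K' r0 m. open W \<and> p \<in> W \<and> W \<subseteq> K' \<and> compact K' \<and> 0 < r0 \<and> cone_bounded rdist W r0 m"
proof -
  obtain Q where Q: "finite Q" "cball (0::'e) 1 \<subseteq> (\<Union>q\<in>Q. ball q (1/32))"
  proof -
    have "cball (0::'e) 1 \<subseteq> (\<Union>q\<in>cball 0 1. ball q (1/32))" by (auto intro!: bexI)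
    then obtain C where "C \<subseteq> cball (0::'e) 1" "finite C" "cball (0::'e) 1 \<subseteq> (\<Union>q\<in>C. ball q (1/32))"
      by (rule compactE_image[OF compact_cball open_ball])
    then show ?thesis by (intro that)
  qed
  define r where "r = min (R * \<alpha> / (8 * spread)) (1 / (10^6 * distortion))"
  have r0: "0 < r" using pos spread_ge_1 distortion_pos by (simp add: r_def)
  have "r \<le> R * \<alpha> / (8 * spread)" "r \<le> 1 / (10^6 * distortion)" by (simp_all add: r_def)
  then have r: "spread * (4 * r / \<alpha>) \<le> R / 2" "distortion * r \<le> 1/10^6"
    using pos spread_ge_1 distortion_pos by (simp_all add: field_simps)
  have sub: "chart_ball (\<phi> p) (R / 2) \<subseteq> \<psi> ` (cball (\<phi> p) R \<inter> E)"
  proof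
    fix w assume w: "w \<in> chart_ball (\<phi> p) (R / 2)"
    then have wc: "w \<in> fst c" by (simp add: chart_ball_def)
    have "\<phi> w \<in> cball (\<phi> p) R \<inter> E"
      using w chart_inverse(2)[OF c wc] pos by (auto simp: chart_ball_def dist_norm norm_minus_commute)
    then show "w \<in> \<psi> ` (cball (\<phi> p) R \<inter> E)" using chart_inverse(1)[OF c wc] by (metis imageI)
  qed
  have "p \<in> chart_ball (\<phi> p) (R / 2)" using p pos by (simp add: chart_ball_def)
  then show ?thesis
    using open_chart_ball sub compact_chart_cball[OF order_refl] r0 cone_bounded_near[OF r0 r Q] by blast
qed

text \<open>
  With \<open>rdist_small_near\<close> below, this says that the distance induces the topology of the manifold.
\<close>

lemma rdist_ball_in_open:
  assumes U: "open U" "p \<in> U"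
  shows "\<exists>r>0. {y. rdist p y < ennreal r} \<subseteq> U"
proof -
  have "openin (top_of_set (\<phi> ` fst c)) (\<phi> ` fst c \<inter> \<psi> -` U)"
    by (rule continuous_openin_preimage_gen[OF chart_inverse(6)[OF c] U(1)])
  then obtain V where V: "open V" "\<phi> ` fst c \<inter> \<psi> -` U = \<phi> ` fst c \<inter> V" unfolding openin_open by blast
  have "\<phi> p \<in> \<phi> ` fst c \<inter> \<psi> -` U" using p U(2) chart_inverse(1)[OF c p] by simp
  then have "\<phi> p \<in> V" using V(2) by blast
  then obtain e where e: "0 < e" "ball (\<phi> p) e \<subseteq> V" using V(1) open_contains_ball by blast
  define \<rho> where "\<rho> = min e (min (R / 2) (\<alpha> / (2 * L)))"
  have \<rho>: "0 < \<rho>" "\<rho> \<le> e" "\<rho> \<le> R / 2" "\<rho> \<le> \<alpha> / (2 * L)" using e(1) pos by (simp_all add: \<rho>_def)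
  then have L\<rho>: "L * \<rho> / \<alpha> \<le> 1/2" using pos by (simp add: field_simps)
  have p0: "norm (\<phi> p - \<phi> p) < R / 2" using pos by simp
  have "y \<in> U" if y: "rdist p y < ennreal (\<alpha> * \<rho> / 2)" for y
  proof -
    have yO: "y \<in> chart_ball (\<phi> p) \<rho>" by (rule captured[OF p p0 \<rho>(1,3) L\<rho> y])
    then have yc: "y \<in> fst c" by (simp add: chart_ball_def)
    have "\<phi> y \<in> V" using yO e(2) \<rho>(2) by (auto simp: chart_ball_def dist_norm norm_minus_commute)
    then have "\<phi> y \<in> \<phi> ` fst c \<inter> \<psi> -` U" unfolding V(2) using yc by blast
    then show ?thesis using chart_inverse(1)[OF c yc] by simp
  qed
  moreover have "0 < \<alpha> * \<rho> / 2" using pos \<rho>(1) by simp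
  ultimately show ?thesis by blast
qed

lemma rdist_small_near:
  assumes "0 < e"
  shows "\<exists>V. open V \<and> p \<in> V \<and> (\<forall>w\<in>V. rdist p w < ennreal e)"
proof -
  define \<rho> where "\<rho> = min R (e / (2 * (\<beta> + L * R)))"
  have b: "0 < \<beta> + L * R" using pos by (simp add: add_pos_pos)
  have \<rho>: "0 < \<rho>" "\<rho> \<le> R" "\<rho> \<le> e / (2 * (\<beta> + L * R))" using assms pos b by (simp_all add: \<rho>_def)
  have pK: "\<phi> p \<in> K" using chart_inverse(2)[OF c p] pos by simp
  have "rdist p w < ennreal e" if w: "w \<in> chart_ball (\<phi> p) \<rho>" for w
  proof -
    have wc: "w \<in> fst c" "norm (\<phi> w - \<phi> p) < \<rho>" using w by (simp_all add: chart_ball_def)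
    have wE: "\<phi> w \<in> E" by (rule chart_inverse(2)[OF c wc(1)])
    have wK: "\<phi> w \<in> K" using wE wc(2) \<rho>(2) by (simp add: dist_norm norm_minus_commute)
    have dE: "\<phi> w - \<phi> p \<in> E" using wE pK subspace_model by (intro subspace_diff) auto
    have "norm (\<phi> p - \<phi> p) \<le> \<rho>" "norm (\<phi> w - \<phi> p) \<le> \<rho>" using \<rho>(1) wc(2) by auto
    from segment_upper[OF pK this(1) wK this(2) pK]
    obtain l where l: "join p w l" "l \<le> N (\<phi> p) (\<phi> w - \<phi> p) + L * \<rho> * norm (\<phi> w - \<phi> p)"
      using chart_inverse(1)[OF c p] chart_inverse(1)[OF c wc(1)] by auto
    have "N (\<phi> p) (\<phi> w - \<phi> p) \<le> \<beta> * norm (\<phi> w - \<phi> p)" using norm_bounds[OF pK dE] by simp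
    also have "\<dots> \<le> \<beta> * \<rho>" using wc(2) pos by (intro mult_left_mono) auto
    finally have 1: "N (\<phi> p) (\<phi> w - \<phi> p) \<le> \<beta> * \<rho>" .
    have 2: "L * \<rho> * norm (\<phi> w - \<phi> p) \<le> L * R * \<rho>" using wc(2) pos \<rho> by (intro mult_mono) auto
    have "l \<le> (\<beta> + L * R) * \<rho>" using l(2) 1 2 by (simp add: distrib_right)
    also have "\<dots> \<le> (\<beta> + L * R) * (e / (2 * (\<beta> + L * R)))" using \<rho>(3) b by (intro mult_left_mono) auto
    also have "\<dots> = e / 2" using b by (simp add: field_simps)
    also have "\<dots> < e" using assms by simp
    finally have "ennreal l < ennreal e" using joined_nonneg[OF l(1)] by (simp add: ennreal_less_iff)
    then show ?thesis using rdist_le[OF l(1)] by (rule order_le_less_trans[rotated])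
  qed
  moreover have "p \<in> chart_ball (\<phi> p) \<rho>" using p \<rho>(1) by (simp add: chart_ball_def)
  ultimately show ?thesis using open_chart_ball by blast
qed

end

context riemannian_manifold
begin

lemma estimates_around: "\<exists>c R \<alpha> \<beta> L. chart_estimates E A g c p R \<alpha> \<beta> L"
proof -
  obtain c where "c \<in> A" "p \<in> fst c" by (rule chart_around)
  from chart_estimates_exist[OF this] show ?thesis by blast
qed

lemma open_rdist_ball: "open {y. rdist x y < ennreal r}"
proof (subst open_subopen, intro ballI)
  fix y assume "y \<in> {y. rdist x y < ennreal r}"
  then have y: "rdist x y < ennreal r" by simp
  then obtain t where t: "rdist x y = ennreal t" "0 \<le> t" by (cases "rdist x y") auto
  then have "t < r" using y by (simp add: ennreal_less_iff)
  then have "0 < r - t" by simp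
  obtain c R \<alpha> \<beta> L where "chart_estimates E A g c y R \<alpha> \<beta> L" using estimates_around by blast
  from chart_estimates.rdist_small_near[OF this \<open>0 < r - t\<close>]
  obtain V where V: "open V" "y \<in> V" "\<forall>w\<in>V. rdist y w < ennreal (r - t)" by blast
  have "rdist x w < ennreal r" if "w \<in> V" for w
  proof -
    have "rdist x w \<le> ennreal t + rdist y w" using rdist_triangle[of x w y] t(1) by simp
    also have "\<dots> < ennreal t + ennreal (r - t)"
      using V(3) that by (simp add: ennreal_add_left_cancel_less)
    also have "\<dots> = ennreal r" using t(2) \<open>0 < r - t\<close> by (simp add: ennreal_plus[symmetric] del: ennreal_plus)
    finally show ?thesis .
  qed
  then show "\<exists>T. open T \<and> y \<in> T \<and> T \<subseteq> {y. rdist x y < ennreal r}" using V(1,2) by blast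
qed

lemma ball_distance_rdist: "ball_distance rdist"
proof
  show "rdist x x = 0" for x by (rule rdist_refl)
  show "rdist x y = rdist y x" for x y by (rule rdist_sym)
  show "rdist x w \<le> rdist x y + rdist y w" for x y w by (rule rdist_triangle)
  show "open {y. rdist x y < ennreal r}" for x r by (rule open_rdist_ball)
  show "\<exists>r>0. {y. rdist x y < ennreal r} \<subseteq> U" if U: "open U" "x \<in> U" for U x
  proof -
    obtain c R \<alpha> \<beta> L where "chart_estimates E A g c x R \<alpha> \<beta> L" using estimates_around by blast
    from chart_estimates.rdist_ball_in_open[OF this U] show ?thesis .
  qed
qed

lemma cone_bounded_locally:
  "\<exists>W K r0 m. open W \<and> p \<in> W \<and> W \<subseteq> K \<and> compact K \<and> 0 < r0 \<and> cone_bounded rdist W r0 m"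
proof -
  obtain c R \<alpha> \<beta> L where "chart_estimates E A g c p R \<alpha> \<beta> L" using estimates_around by blast
  from chart_estimates.cone_neighbourhood[OF this] show ?thesis .
qed

end

section \<open>Differentiation along geodesic balls\<close>

theorem theorem1p2:
  fixes E :: "'e::euclidean_space set"
    and A :: "('a::{t2_space, second_countable_topology}, 'e) chart set"
    and g :: "('a, 'e) metric_tensor"
    and \<nu>1 \<nu>2 :: "'a measure"
  assumes "complete_riemannian_manifold E A g"
    and "locally_finite_borel_measure \<nu>1"
    and "locally_finite_borel_measure \<nu>2"
    and "absolutely_continuous \<nu>1 \<nu>2"
  shows "\<exists>S0 \<in> null_sets \<nu>1.
    (\<forall>x. x \<notin> S0 \<longrightarrow> derivative_defined A g \<nu>1 \<nu>2 x \<and> measure_derivative A g \<nu>1 \<nu>2 x < \<infinity>) \<and>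
    extended_derivative A g \<nu>1 \<nu>2 S0 \<in> borel_measurable borel \<and>
    (\<forall>B \<in> sets borel.
       emeasure \<nu>2 B = (\<integral>\<^sup>+x\<in>B. ennreal (extended_derivative A g \<nu>1 \<nu>2 S0 x) \<partial>\<nu>1))"
proof -
  interpret complete_riemannian_manifold E A g by fact
  interpret ball_distance "riem_dist A g" by (rule ball_distance_rdist)
  have ball: "geodesic_ball A g x r = dball x r" for x r by (simp add: geodesic_ball_def dball_def)
  have sets: "sets \<nu>1 = sets borel" using assms(2) by (simp add: locally_finite_borel_measure_def)
  obtain f S0 where f: "f \<in> borel_measurable borel" "density \<nu>1 f = \<nu>2" and S0: "S0 \<in> null_sets \<nu>1"
    and fin: "\<And>x. x \<notin> S0 \<Longrightarrow> f x < \<infinity>"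
    and pos: "\<And>x r. x \<notin> S0 \<Longrightarrow> 0 < r \<Longrightarrow> emeasure \<nu>1 (dball x r) \<noteq> 0"
    and lim: "\<And>x. x \<notin> S0 \<Longrightarrow>
      ((\<lambda>r. emeasure \<nu>2 (dball x r) / emeasure \<nu>1 (dball x r)) \<longlongrightarrow> f x) (at_right 0)"
    by (rule differentiation[OF cone_bounded_locally assms(2-4)]) blast
  have upper: "upper_derivative A g \<nu>1 \<nu>2 x = f x" if x: "x \<notin> S0" for x
    using pos[OF x] lim_imp_Limsup[OF _ lim[OF x]] by (auto simp: upper_derivative_def ball)
  have lower: "lower_derivative A g \<nu>1 \<nu>2 x = f x" if x: "x \<notin> S0" for x
    using pos[OF x] lim_imp_Liminf[OF _ lim[OF x]] by (auto simp: lower_derivative_def ball)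
  have deriv: "measure_derivative A g \<nu>1 \<nu>2 x = f x" if x: "x \<notin> S0" for x
    unfolding measure_derivative_def upper[OF x] lower[OF x] by (rule the_equality) auto
  have S0_borel: "S0 \<in> sets borel" using S0 sets by (auto simp: null_sets_def)
  have ext: "extended_derivative A g \<nu>1 \<nu>2 S0 = (\<lambda>x. if x \<in> S0 then 0 else enn2real (f x))"
    by (auto simp: fun_eq_iff extended_derivative_def deriv)
  have "extended_derivative A g \<nu>1 \<nu>2 S0 \<in> borel_measurable borel"
    unfolding ext using S0_borel f(1) by measurable
  moreover have "emeasure \<nu>2 B = (\<integral>\<^sup>+x\<in>B. ennreal (extended_derivative A g \<nu>1 \<nu>2 S0 x) \<partial>\<nu>1)"
    if B: "B \<in> sets borel" for B
  proof -
    have "emeasure \<nu>2 B = (\<integral>\<^sup>+x\<in>B. f x \<partial>\<nu>1)"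
      unfolding f(2)[symmetric]
      by (rule emeasure_density) (use f(1) B in \<open>simp_all add: sets measurable_cong_sets[OF sets refl]\<close>)
    also have "\<dots> = (\<integral>\<^sup>+x\<in>B. ennreal (extended_derivative A g \<nu>1 \<nu>2 S0 x) \<partial>\<nu>1)"
    proof (rule nn_integral_cong_AE)
      show "AE x in \<nu>1. f x * indicator B x
          = ennreal (extended_derivative A g \<nu>1 \<nu>2 S0 x) * indicator B x"
        using AE_not_in[OF S0]
      proof eventually_elim
        case (elim x)
        then have "ennreal (enn2real (f x)) = f x" using fin[of x] by (intro ennreal_enn2real) simp
        then show ?case using elim by (simp add: ext)
      qed
    qed
    finally show ?thesis .
  qed
  ultimately show ?thesis
    using S0 upper lower deriv fin by (intro bexI[of _ S0]) (auto simp: derivative_defined_def)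
qed

end
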